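(* Let $(\mathcal L,\mathcal P)$ be an extremal configuration with each point of $\mathcal P$ at least $N^{1/3-}$ rich. Then for each acceptable random selection $\mathcal L_{N^{1/3}}\subset\mathcal L$ there is a refinement $\mathcal P'\subset\mathcal P$ with $|\mathcal P'|\ge\frac12|\mathcal P|$ such that no point of $\mathcal P'$ is contained in a cell of $\mathcal L_{N^{1/3}}$ with more than $N^{+}$ sides, each such cell contains at most $N^{1/3+}$ points of $\mathcal P'$, and the partition of $\mathcal P'$ by these cells is a point weighted cell decomposition for the extremal configuration $(\mathcal L,\mathcal P')$.
   Context: Conventions: $N$ is a large parameter and $\epsilon_0>0$ a fixed small exponent. $A\lesssim B$ means $A\le CB$ with $C$ independent of $N$. $N^{a+}$ (resp. $N^{a-}$) denotes $N^{a+\epsilon}$ (resp. $N^{a-\epsilon}$) for some $0\le\epsilon\lesssim\epsilon_0$, possibly different at each occurrence. A configuration $(\mathcal L,\mathcal P)$ is a set $\mathcal L$ of lines and a set $\mathcal P$ of points in $\mathbb R^2$ with $N^{1-}\lesssim|\mathcal L|,|\mathcal P|\le N$; it is extremal if the number of incident pairs is $\gtrsim N^{4/3-}$. A point is $k$-rich if incident to at least $k$ lines of $\mathcal L$. A partition of a point set into $r^2$ disjoint subsets (cells) is a point weighted cell decomposition if no line of $\mathcal L$ is incident to points in $\gtrsim r$ cells and no cell contains $\gtrsim N^{1+}/r^2$ points. Acceptable selection: let $r=N^{1/3}$, $C$ a large constant and $K_0=\frac{CN\log N}{r}$. A subset $\mathcal L_r\subset\mathcal L$ (obtained by choosing each line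 independently with probability $r/N$) is acceptable if: (i) $r/2\le|\mathcal L_r|\le 2r$; (ii) for each $l\in\mathcal L$, order $\mathcal L\setminus\{l\}$ by the position of their intersection with $l$ (concurrent lines ordered arbitrarily); for each $l'\ne l$, one of the $K_0$ consecutive lines following $l'$ lies in $\mathcal L_r$; (iii) for a fixed vertical direction not parallel to any line of $\mathcal L$ and each intersection point $p$ of two lines of $\mathcal L$, it is not the case that none of the first $K_0$ lines above $p$ and none of the first $K_0$ lines below $p$ (along the vertical line through $p$) lie in $\mathcal L_r$; (iv) for any two intersection points $p_1,p_2$ of pairs of lines of $\mathcal L$ whose open segment meets at least $K_0$ lines of $\mathcal L$, one of those lines lies in $\mathcal L_r$. The cells of $\mathcal L_r$ are the connected components of the complement of the union of its lines.
   Formalization: Points of P' on lines of the selection lie in no open cell (all of P may, so the literal claim fails); such points are counted in every adjacent closed cell, and the cell decomposition is asserted for every assignment of them to an adjacent cell. *)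

theory Defs
  imports "HOL-Analysis.Analysis"
begin

type_synonym point = "real^2"

definition is_line :: "point set \<Rightarrow> bool" where
  "is_line l \<longleftrightarrow> affine l \<and> aff_dim l = 1"

text \<open>
  Asymptotic conventions. An exponent written with a superscript minus or plus sign
  carries a loss \<open>\<eta>\<close>, which is a bounded multiple of the small exponent; implied
  constants are explicit parameters \<open>c\<close> (lower bounds) and \<open>C\<close> (upper bounds). For
  \<open>N \<ge> 1\<close> all bounds are monotone in \<open>\<eta>\<close>, so one common loss for the hypotheses and one
  for the conclusions cover the case of different losses at different occurrences.
\<close>

definition configuration ::
  "real \<Rightarrow> real \<Rightarrow> real \<Rightarrow> point set set \<Rightarrow> point set \<Rightarrow> bool" where
  "configuration c \<eta> N L P \<longleftrightarrow>
     finite L \<and> finite P \<and> (\<forall>l\<in>L. is_line l) \<and>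
     c * N powr (1 - \<eta>) \<le> real (card L) \<and> real (card L) \<le> N \<and>
     c * N powr (1 - \<eta>) \<le> real (card P) \<and> real (card P) \<le> N"

definition incidences :: "point set set \<Rightarrow> point set \<Rightarrow> (point set \<times> point) set" where
  "incidences L P = {(l, p). l \<in> L \<and> p \<in> P \<and> p \<in> l}"

definition extremal ::
  "real \<Rightarrow> real \<Rightarrow> real \<Rightarrow> point set set \<Rightarrow> point set \<Rightarrow> bool" where
  "extremal c \<eta> N L P \<longleftrightarrow>
     configuration c \<eta> N L P \<and>
     c * N powr (4/3 - \<eta>) \<le> real (card (incidences L P))"

definition rich :: "real \<Rightarrow> point set set \<Rightarrow> point \<Rightarrow> bool" where
  "rich k L p \<longleftrightarrow> k \<le> real (card {l \<in> L. p \<in> l})"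

text \<open>
  The number \<open>r\<^sup>2\<close> of parts is an order of magnitude: up to a constant from above, and up to
  a constant and a factor \<open>N powr \<eta>\<close> from below. Parts of a \<^const>\<open>partition_on\<close> are
  nonempty.
\<close>

definition point_weighted_cell_decomposition ::
  "real \<Rightarrow> real \<Rightarrow> real \<Rightarrow> real \<Rightarrow> real \<Rightarrow> point set set \<Rightarrow> point set \<Rightarrow> point set set \<Rightarrow> bool" where
  "point_weighted_cell_decomposition c C \<eta> N r L P \<Q> \<longleftrightarrow>
     partition_on P \<Q> \<and>
     c * N powr (- \<eta>) * r\<^sup>2 \<le> real (card \<Q>) \<and> real (card \<Q>) \<le> C * r\<^sup>2 \<and>
     (\<forall>l\<in>L. real (card {Q \<in> \<Q>. l \<inter> Q \<noteq> {}}) \<le> C * r) \<and>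
     (\<forall>Q\<in>\<Q>. real (card Q) \<le> C * N powr (1 + \<eta>) / r\<^sup>2)"

definition intersection_points :: "point set set \<Rightarrow> point set" where
  "intersection_points L = {p. \<exists>l\<in>L. \<exists>m\<in>L. l \<noteq> m \<and> p \<in> l \<and> p \<in> m}"

text \<open>
  Position of the line \<open>m\<close> on the line \<open>t \<mapsto> a + t u\<close>; only used when the two lines meet
  in exactly one point.
\<close>

definition line_coord :: "point \<Rightarrow> point \<Rightarrow> point set \<Rightarrow> real" where
  "line_coord a u m = (THE t. a + t *\<^sub>R u \<in> m)"

text \<open>A weakly sorted enumeration; lines at equal position appear in an arbitrary order.\<close>

definition ordering_by :: "('a \<Rightarrow> real) \<Rightarrow> 'a set \<Rightarrow> 'a list \<Rightarrow> bool" where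
  "ordering_by pos A xs \<longleftrightarrow> distinct xs \<and> set xs = A \<and> sorted (map pos xs)"

text \<open>
  Only lines that meet \<open>l\<close> have a position on \<open>l\<close>. The requirement concerns those members of
  the ordering that have at least \<open>K\<close> successors: without this restriction the last line
  in the ordering could never satisfy it.
\<close>

definition acceptable_along ::
  "nat \<Rightarrow> point set set \<Rightarrow> point set set \<Rightarrow> point set \<Rightarrow> bool" where
  "acceptable_along K L Lr l \<longleftrightarrow>
     (\<exists>a u xs. u \<noteq> 0 \<and> l = range (\<lambda>t. a + t *\<^sub>R u) \<and>
        ordering_by (line_coord a u) {m \<in> L - {l}. m \<inter> l \<noteq> {}} xs \<and>
        (\<forall>i. i + K < length xs \<longrightarrow> (\<exists>j. i < j \<and> j \<le> i + K \<and> xs ! j \<in> Lr)))"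

text \<open>
  Here \<open>xs\<close> and \<open>ys\<close> list the lines above and below \<open>p\<close> in direction \<open>v\<close>, nearest first.
  Lines through \<open>p\<close> are neither above nor below.
\<close>

definition acceptable_vertically ::
  "nat \<Rightarrow> point set set \<Rightarrow> point \<Rightarrow> point set set \<Rightarrow> point \<Rightarrow> bool" where
  "acceptable_vertically K L v Lr p \<longleftrightarrow>
     (\<exists>xs ys. ordering_by (line_coord p v) {m \<in> L. line_coord p v m > 0} xs \<and>
        ordering_by (\<lambda>m. - line_coord p v m) {m \<in> L. line_coord p v m < 0} ys \<and>
        \<not> (set (take K xs) \<inter> Lr = {} \<and> set (take K ys) \<inter> Lr = {}))"

definition K0 :: "real \<Rightarrow> real \<Rightarrow> real" where
  "K0 C N = C * N * ln N / N powr (1/3)"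

definition acceptable ::
  "real \<Rightarrow> real \<Rightarrow> point set set \<Rightarrow> point \<Rightarrow> point set set \<Rightarrow> bool" where
  "acceptable C N L v Lr \<longleftrightarrow>
     Lr \<subseteq> L \<and>
     N powr (1/3) / 2 \<le> real (card Lr) \<and> real (card Lr) \<le> 2 * N powr (1/3) \<and>
     (\<forall>l\<in>L. acceptable_along (nat \<lceil>K0 C N\<rceil>) L Lr l) \<and>
     v \<noteq> 0 \<and> (\<forall>l\<in>L. \<forall>x\<in>l. x + v \<notin> l) \<and>
     (\<forall>p\<in>intersection_points L. acceptable_vertically (nat \<lceil>K0 C N\<rceil>) L v Lr p) \<and>
     (\<forall>p\<in>intersection_points L. \<forall>q\<in>intersection_points L.
        K0 C N \<le> real (card {l \<in> L. l \<inter> open_segment p q \<noteq> {}}) \<longrightarrow>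
        (\<exists>l\<in>Lr. l \<inter> open_segment p q \<noteq> {}))"

definition cells :: "point set set \<Rightarrow> point set set" where
  "cells Lr = components (- \<Union>Lr)"

definition sides :: "point set \<Rightarrow> point set set" where
  "sides c = {F. F facet_of closure c}"

text \<open>
  Points of \<open>P\<close> may lie on the lines of \<open>Lr\<close> (even all of them may), hence in no cell. Such a
  point counts as contained in each cell whose closure contains it, and a partition of \<open>P\<close>
  by the cells puts it into one of these, in an arbitrary way. A point off the lines has its
  own cell as the only choice.
\<close>

definition cell_assignment :: "point set set \<Rightarrow> point set \<Rightarrow> (point \<Rightarrow> point set) \<Rightarrow> bool" where
  "cell_assignment Lr P f \<longleftrightarrow> (\<forall>p\<in>P. f p \<in> cells Lr \<and> p \<in> closure (f p))"

definition cell_partition :: "point set \<Rightarrow> (point \<Rightarrow> point set) \<Rightarrow> point set set" where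
  "cell_partition P f = (\<lambda>c. {p \<in> P. f p = c}) ` f ` P"

end

(*
  Let b(Q) be the number of lines of Lr that contribute an edge to the cell Q. By the zone theorem
  the sum of b(Q)^2 over all cells is O(r^2). By acceptability at most O(b(Q) K0) lines of L cross Q
  in a relevant way: each edge is crossed by at most K0 of them, and so are the pencils at each of
  the O(b(Q)) vertices. Moreover each of these lines has at most K0 crossings inside Q. Joining
  consecutive points of P on each line (Szekely) and applying the crossing lemma, with this local
  bound on the number of crossings, shows that closure Q contains at most b(Q) N^(1/3+) points of
  the N^(1/3-)-rich set P. The cells with b(Q) > N^(B1 e) therefore contain at most
  N^(-B1 e) * (sum of b(Q)^2) * N^(1/3+) = N^(1+) / N^(B1 e) points, fewer than half of P when B1
  is large; P' consists of the remaining points.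
*)
theory Submission
  imports Defs
begin

section \<open>Straight-line graphs without crossings\<close>

text \<open>The bound for a cell has to be linear in b(Q). Counting every pair of the O(b(Q) K0)
  lines as a possible crossing would give b(Q)^2 N^(1/3+), and a bound on the sum of b(Q)^2 then
  leaves no gain on the cells with large b(Q). At most K0 crossings per line save one factor b(Q),
  and this factor is what the threshold exploits.

  Three degeneracies shape the geometry. Many lines may pass through one vertex, so b(Q) counts only
  lines owning a boundary point of Q that lies on no other sample line. Points may lie on the sample
  lines, so cells enter through their closures, and rich points on edges and at vertices are counted
  separately. Cells may be unbounded, where the condition on segments between intersection points
  gives no control; lines that meet the boundary in a single vertex or not at all are counted along
  another line that crosses them inside Q. For this reason the relevant lines are those that meet
  another line of L inside Q.\<close>

lemma open_segment_alt:
  fixes u w :: "'a::real_vector"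
  assumes "u \<noteq> w"
  shows "open_segment u w = {(1 - t) *\<^sub>R u + t *\<^sub>R w | t. 0 < t \<and> t < 1}"
  using assms by (auto simp: in_segment)

definition slope :: "('a \<Rightarrow> real) \<Rightarrow> ('a \<Rightarrow> real) \<Rightarrow> 'a \<Rightarrow> 'a \<Rightarrow> real" where
  "slope X Y u w = (Y w - Y u) / (X w - X u)"

definition height :: "('a \<Rightarrow> real) \<Rightarrow> ('a \<Rightarrow> real) \<Rightarrow> 'a \<Rightarrow> 'a \<Rightarrow> real \<Rightarrow> real" where
  "height X Y u w x = Y u + (x - X u) * slope X Y u w"

text \<open>\<open>X\<close> and \<open>Y\<close> are abstract coordinates, so that any direction
  avoided by the edges can serve as the vertical one. Each edge is stored once, directed to the
  right, and \<open>height\<close> turns crossings into comparisons of affine functions.\<close>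

locale noncrossing_graph =
  fixes X Y :: "'a::real_vector \<Rightarrow> real" and V :: "'a set" and E :: "('a \<times> 'a) set"
  assumes lin: "linear X" "linear Y"
    and coords_inj: "\<And>p q. X p = X q \<Longrightarrow> Y p = Y q \<Longrightarrow> p = q"
    and fin: "finite V" and edges: "E \<subseteq> V \<times> V"
    and rightward: "\<And>u w. (u, w) \<in> E \<Longrightarrow> X u < X w"
    and vertex_free: "\<And>u w z. (u, w) \<in> E \<Longrightarrow> z \<in> V \<Longrightarrow> z \<notin> open_segment u w"
    and noncrossing: "\<And>u w u' w'. (u, w) \<in> E \<Longrightarrow> (u', w') \<in> E \<Longrightarrow> (u, w) \<noteq> (u', w') \<Longrightarrow>
       open_segment u w \<inter> open_segment u' w' = {}"
begin

abbreviation "sl \<equiv> slope X Y"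
abbreviation "ht \<equiv> height X Y"

lemma fin_E: "finite E"
  using finite_subset[OF edges] fin by blast

lemma ht_left [simp]: "ht u w (X u) = Y u"
  by (simp add: height_def)

lemma ht_right: "(u, w) \<in> E \<Longrightarrow> ht u w (X w) = Y w"
  using rightward[of u w] by (simp add: height_def slope_def)

lemma ht_mono_slope: "sl u a < sl u b \<Longrightarrow> X u < x \<Longrightarrow> ht u a x < ht u b x"
  by (simp add: height_def)

lemma edge_point:
  assumes "(u, w) \<in> E" "X u < x" "x < X w"
  obtains z where "z \<in> open_segment u w" "X z = x" "Y z = ht u w x"
proof -
  define t where "t = (x - X u) / (X w - X u)"
  have t: "0 < t" "t < 1" using assms by (auto simp: t_def field_simps)
  have tx: "t * (X w - X u) = x - X u" using assms by (simp add: t_def)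
  let ?z = "(1 - t) *\<^sub>R u + t *\<^sub>R w"
  have lX: "X ?z = (1 - t) * X u + t * X w" and lY: "Y ?z = (1 - t) * Y u + t * Y w"
    using lin by (simp_all only: linear_add linear_scale real_scaleR_def)
  have "u \<noteq> w" using assms rightward by fastforce
  then have "?z \<in> open_segment u w" using t by (auto simp: open_segment_alt)
  moreover have "X ?z = x" using tx unfolding lX by (simp add: algebra_simps)
  moreover have "Y ?z = ht u w x"
  proof -
    have "ht u w x = Y u + t * (Y w - Y u)" by (simp add: height_def slope_def t_def)
    then show ?thesis unfolding lY by (simp add: algebra_simps)
  qed
  ultimately show thesis using that by blast
qed

lemma vertex_off_edge:
  assumes "(u, w) \<in> E" "z \<in> V" "X u < X z" "X z < X w"
  shows "Y z \<noteq> ht u w (X z)"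
  using edge_point[OF assms(1,3,4)] coords_inj vertex_free[OF assms(1,2)] by metis

lemma edges_apart:
  assumes "(u, w) \<in> E" "(u', w') \<in> E" "(u, w) \<noteq> (u', w')"
    "X u < x" "x < X w" "X u' < x" "x < X w'"
  shows "ht u w x \<noteq> ht u' w' x"
proof
  assume eq: "ht u w x = ht u' w' x"
  obtain z where z: "z \<in> open_segment u w" "X z = x" "Y z = ht u w x"
    using edge_point assms by blast
  obtain z' where z': "z' \<in> open_segment u' w'" "X z' = x" "Y z' = ht u' w' x"
    using edge_point assms by blast
  have "z = z'" using z z' eq coords_inj by simp
  then show False using z(1) z'(1) noncrossing[OF assms(1-3)] by blast
qed

text \<open>By the intermediate value theorem, a change of order would put a common point strictly
  inside both edges. The conclusion is weak because the edges may share their right end at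
  \<open>x2\<close>.\<close>

lemma edge_order:
  assumes "(u, w) \<in> E" "(u', w') \<in> E" "X u \<le> x1" "X u' \<le> x1" "x1 < x2" "x2 \<le> X w" "x2 \<le> X w'"
    and lt: "ht u w x1 < ht u' w' x1"
  shows "ht u w x2 \<le> ht u' w' x2"
proof (rule ccontr)
  assume c: "\<not> ?thesis"
  define d where "d x = ht u w x - ht u' w' x" for x
  have "\<exists>x\<ge>x1. x \<le> x2 \<and> d x = 0"
  proof (rule IVT')
    show "continuous_on {x1..x2} d" unfolding d_def height_def by (intro continuous_intros)
  qed (use lt c assms(5) in \<open>auto simp: d_def\<close>)
  then obtain x where x: "x1 \<le> x" "x \<le> x2" "d x = 0" by blast
  have "x \<noteq> x1" "x \<noteq> x2" using x(3) lt c by (auto simp: d_def)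
  moreover have "(u, w) \<noteq> (u', w')" using lt by auto
  ultimately show False
    using edges_apart[OF assms(1,2), of x] x assms(3-7) by (auto simp: d_def)
qed

lemma slope_inj:
  assumes "(u, a) \<in> E" "(u, b) \<in> E" "sl u a = sl u b"
  shows "a = b"
proof (rule ccontr)
  assume "a \<noteq> b"
  have "X u < X a" "X u < X b" using assms rightward by auto
  then obtain x where "X u < x" "x < X a" "x < X b"
    using dense[of "X u" "min (X a) (X b)"] by auto
  then show False
    using edges_apart[OF assms(1,2), of x] \<open>a \<noteq> b\<close> assms(3) by (auto simp: height_def)
qed

text \<open>
  Two consecutive right edges at \<open>u\<close> are charged to the first vertex \<open>z\<close> in the wedge between
  them. A vertex is charged at most three times: as the end of the lower edge, as the end of the
  upper edge, and from the interior. Only the top right edge of each \<open>u\<close> is not charged.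
\<close>

definition in_wedge :: "'a \<Rightarrow> 'a \<Rightarrow> 'a \<Rightarrow> 'a \<Rightarrow> bool" where
  "in_wedge u a b z \<longleftrightarrow> z \<in> V \<and> X u < X z \<and> X z \<le> X a \<and> X z \<le> X b \<and>
     ht u a (X z) \<le> Y z \<and> Y z \<le> ht u b (X z)"

definition wedge :: "'a \<Rightarrow> 'a \<Rightarrow> 'a \<Rightarrow> 'a \<Rightarrow> bool" where
  "wedge u a b z \<longleftrightarrow> (u, a) \<in> E \<and> (u, b) \<in> E \<and> sl u a < sl u b \<and>
     (\<forall>c. (u, c) \<in> E \<longrightarrow> \<not> (sl u a < sl u c \<and> sl u c < sl u b)) \<and>
     in_wedge u a b z \<and> (\<forall>z'. in_wedge u a b z' \<longrightarrow> X z \<le> X z')"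

lemma wedge_exists:
  assumes "(u, a) \<in> E" "(u, c) \<in> E" "sl u a < sl u c"
  obtains b z where "wedge u a b z"
proof -
  let ?B = "{b. (u, b) \<in> E \<and> sl u a < sl u b}"
  have "finite ?B" by (rule finite_subset[of _ V]) (use edges fin in auto)
  moreover have "c \<in> ?B" using assms by auto
  ultimately obtain b where b: "b \<in> ?B" "\<And>b'. b' \<in> ?B \<Longrightarrow> sl u b \<le> sl u b'"
    using ex_is_arg_min_if_finite[of ?B "sl u"] by (auto simp: is_arg_min_linorder)
  let ?Z = "Collect (in_wedge u a b)"
  have ab: "a \<in> V" "b \<in> V" "X u < X a" "X u < X b" "ht u a (X a) = Y a" "ht u b (X b) = Y b"
    using assms b(1) edges rightward ht_right by auto
  \<comment> \<open>The wedge is cut off at the nearer of the two right ends. That end itself lies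
    in it, so there is a vertex to charge.\<close>
  have "in_wedge u a b (if X a \<le> X b then a else b)"
    using ab ht_mono_slope[of u a b "X a"] ht_mono_slope[of u a b "X b"] b(1)
    by (auto simp: in_wedge_def less_imp_le)
  then have "?Z \<noteq> {}" by blast
  moreover have "finite ?Z" by (rule finite_subset[OF _ fin]) (auto simp: in_wedge_def)
  ultimately obtain z where z: "z \<in> ?Z" "\<And>z'. z' \<in> ?Z \<Longrightarrow> X z \<le> X z'"
    using ex_is_arg_min_if_finite[of ?Z X] by (auto simp: is_arg_min_linorder)
  have "wedge u a b z"
    unfolding wedge_def using assms b z by (fastforce simp: not_less)
  then show thesis using that by blast
qed

text \<open>The position of a second apex \<open>u'\<close>, not left of \<open>u\<close>, relative
  to the wedge at \<open>u\<close> decides. Inside, it precedes \<open>z\<close>; above, its edge to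
  \<open>z\<close> must cross the upper edge at \<open>u\<close>; below, its own upper edge passes
  above \<open>z\<close> and must cross the edge from \<open>u\<close> to \<open>z\<close>.\<close>

lemma wedge_at_lower_end_aux:
  assumes "wedge u z b z" "wedge u' z b' z" "X u \<le> X u'"
  shows "u = u'"
proof (rule ccontr)
  assume ne: "u \<noteq> u'"
  have E: "(u, z) \<in> E" "(u, b) \<in> E" "(u', z) \<in> E" "(u', b') \<in> E"
    and X: "X u < X z" "X u' < X z" "X z \<le> X b" "X z \<le> X b'"
    and V: "u \<in> V" "u' \<in> V"
    and m: "\<And>y. in_wedge u z b y \<Longrightarrow> X z \<le> X y"
    using assms edges by (auto simp: wedge_def in_wedge_def)
  have hb: "Y z < ht u b (X z)" "Y z < ht u' b' (X z)"
    using ht_mono_slope[of u z b "X z"] ht_mono_slope[of u' z b' "X z"] assms X ht_right E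
    by (auto simp: wedge_def)
  have hz: "ht u z (X z) = Y z" "ht u' z (X z) = Y z" using E ht_right by auto
  show False
  proof (cases "Y u' > ht u z (X u')")
    case True
    have "\<not> ht u b (X u') < Y u'"
      using edge_order[OF E(2,3), of "X u'" "X z"] assms(3) X hb hz by auto
    moreover have "X u \<noteq> X u'"
    proof
      assume eq: "X u = X u'"
      then have "ht u b (X u') < Y u'" using True ht_left by metis
      then show False using calculation by simp
    qed
    ultimately have "in_wedge u z b u'" using True V assms(3) X by (auto simp: in_wedge_def)
    then show False using m X by fastforce
  next
    case False
    have "Y u' \<noteq> ht u z (X u')"
    proof (cases "X u = X u'")
      case True
      then show ?thesis using coords_inj ne ht_left by metis
    next
      case False
      then show ?thesis using vertex_off_edge[OF E(1) V(2)] assms(3) X by auto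
    qed
    then have "ht u' b' (X u') < ht u z (X u')" using False by simp
    then show False using edge_order[OF E(4,1), of "X u'" "X z"] assms(3) X hb hz by auto
  qed
qed

lemma wedge_at_lower_end:
  assumes "wedge u z b z" "wedge u' z b' z"
  shows "u = u'"
  using wedge_at_lower_end_aux assms by (metis linear)

text \<open>As \<open>z\<close> is an end of none of the four edges, it lies strictly between both
  pairs. A second apex \<open>u'\<close> above or below the wedge at \<open>u\<close> would have an
  edge crossing a side of that wedge, so \<open>u'\<close> lies inside and precedes
  \<open>z\<close>.\<close>

lemma wedge_interior_aux:
  assumes w: "wedge u a b z" "wedge u' a' b' z" and z: "z \<notin> {a, b, a', b'}" and le: "X u \<le> X u'"
  shows "u = u'"
proof (rule ccontr)
  assume ne: "u \<noteq> u'"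
  have E: "(u, a) \<in> E" "(u, b) \<in> E" "(u', a') \<in> E" "(u', b') \<in> E"
    and X: "X u < X z" "X u' < X z" "X z \<le> X a" "X z \<le> X b" "X z \<le> X a'" "X z \<le> X b'"
    and V: "u \<in> V" "u' \<in> V" "z \<in> V"
    and m: "\<And>y. in_wedge u a b y \<Longrightarrow> X z \<le> X y"
    and h: "ht u a (X z) \<le> Y z" "Y z \<le> ht u b (X z)" "ht u' a' (X z) \<le> Y z" "Y z \<le> ht u' b' (X z)"
    using w edges by (auto simp: wedge_def in_wedge_def)
  have strict: "Y z \<noteq> ht p q (X z)" if "(p, q) \<in> E" "X p < X z" "X z \<le> X q" "z \<noteq> q" for p q
    using vertex_off_edge[OF that(1) V(3)] that ht_right[OF that(1)] coords_inj
    by (cases "X z = X q") auto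
  have h': "ht u a (X z) < Y z" "Y z < ht u b (X z)" "ht u' a' (X z) < Y z" "Y z < ht u' b' (X z)"
    using strict[OF E(1)] strict[OF E(2)] strict[OF E(3)] strict[OF E(4)] X z h by force+
  have "\<not> ht u b (X u') < Y u'"
    using edge_order[OF E(2,3), of "X u'" "X z"] le X h' by auto
  moreover have "\<not> Y u' < ht u a (X u')"
    using edge_order[OF E(4,1), of "X u'" "X z"] le X h' by auto
  moreover have "X u \<noteq> X u'"
  proof
    assume eq: "X u = X u'"
    then have "Y u' = Y u" using calculation ht_left by (metis linorder_less_linear)
    then show False using eq coords_inj ne by metis
  qed
  ultimately have "in_wedge u a b u'" using V le X by (auto simp: in_wedge_def)
  then show False using m X by fastforce
qed

lemma wedge_interior:
  assumes "wedge u a b z" "wedge u' a' b' z" "z \<notin> {a, b, a', b'}"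
  shows "u = u' \<and> a = a'"
proof -
  have u: "u = u'"
    using wedge_interior_aux[OF assms(1,2)] wedge_interior_aux[OF assms(2,1)] assms(3)
    by (metis insert_iff linear singletonD)
  \<comment> \<open>Wedges at a common apex are separated by slope: the upper edge of one is at most
    as steep as the lower edge of the other, so \<open>z\<close> cannot be strictly below the former
    and not below the latter.\<close>
  have *: False if w: "wedge u a b z" "wedge u c d z" and z: "z \<noteq> c" "z \<noteq> b"
    and lt: "sl u a < sl u c" for a b c d
  proof -
    have "sl u b \<le> sl u c" using w lt by (auto simp: wedge_def not_less)
    moreover have "X u < X z" using w by (auto simp: wedge_def in_wedge_def)
    moreover have "Y z < ht u b (X z)"
    proof -
      have "(u, b) \<in> E" "z \<in> V" "X z \<le> X b" "Y z \<le> ht u b (X z)"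
        using w by (auto simp: wedge_def in_wedge_def)
      then show ?thesis
        using vertex_off_edge[of u b z] ht_right[of u b] coords_inj[of z b] z(2) \<open>X u < X z\<close>
        by (cases "X z = X b") force+
    qed
    moreover have "ht u c (X z) \<le> Y z" using w by (auto simp: wedge_def in_wedge_def)
    ultimately show False by (smt (verit, best) height_def mult_left_mono)
  qed
  have "sl u a = sl u a'"
    using *[of a b a' b'] *[of a' b' a b] assms u by (metis insert_iff linorder_less_linear)
  then show ?thesis using slope_inj assms u by (auto simp: wedge_def)
qed

end

text \<open>Reversing the sign of \<open>Y\<close> exchanges the two sides of a wedge, so charges at
  the upper end reduce to charges at the lower end.\<close>

lemma (in noncrossing_graph) reflected: "noncrossing_graph X (\<lambda>p. - Y p) V E"
proof (rule noncrossing_graph.intro)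
  show "linear (\<lambda>p. - Y p)" using linear_compose_neg[OF lin(2)] .
  show "p = q" if "X p = X q" "- Y p = - Y q" for p q using coords_inj that by simp
qed (fact lin fin edges rightward vertex_free noncrossing)+

lemma (in noncrossing_graph) wedge_at_upper_end:
  assumes "wedge u a z z" "wedge u' a' z z"
  shows "u = u' \<and> a = a'"
proof -
  interpret R: noncrossing_graph X "\<lambda>p. - Y p" V E by (rule reflected)
  have s: "R.sl u w = - sl u w" for u w
    by (simp add: slope_def diff_divide_distrib)
  have h: "R.ht u w x = - ht u w x" for u w x
    by (simp add: height_def s)
  have flip: "R.wedge u b a z \<longleftrightarrow> wedge u a b z" for u a b z
    by (auto simp: R.wedge_def wedge_def R.in_wedge_def in_wedge_def h s)
  have u: "u = u'" using R.wedge_at_lower_end[of u z a u' a'] flip assms by blast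
  have "sl u a = sl u a'"
    using assms u by (auto simp: wedge_def) (metis linorder_less_linear)
  then show ?thesis using slope_inj assms u by (auto simp: wedge_def)
qed

theorem (in noncrossing_graph) card_edges_le: "card E \<le> 4 * card V"
proof -
  define T where "T = {(u, a) \<in> E. \<exists>c. (u, c) \<in> E \<and> sl u a < sl u c}"
  have "\<forall>e\<in>T. \<exists>b z. wedge (fst e) (snd e) b z"
  proof
    fix e assume "e \<in> T"
    then obtain c where "(fst e, snd e) \<in> E" "(fst e, c) \<in> E" "sl (fst e) (snd e) < sl (fst e) c"
      by (auto simp: T_def)
    then show "\<exists>b z. wedge (fst e) (snd e) b z" by (rule wedge_exists) blast
  qed
  then obtain b z where w: "\<And>e. e \<in> T \<Longrightarrow> wedge (fst e) (snd e) (b e) (z e)"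
    by metis
  have zV: "z ` T \<subseteq> V" using w by (auto simp: wedge_def in_wedge_def)
  have finT: "finite T" using fin_E by (auto simp: T_def intro: finite_subset[of _ E])
  have le: "card S \<le> card V" if "S \<subseteq> T" "inj_on z S" for S
    by (rule card_inj_on_le[OF that(2) _ fin]) (use that zV in blast)
  have 0: "card (E - T) \<le> card V"
  proof (rule card_inj_on_le[OF _ _ fin])
    show "inj_on fst (E - T)"
    proof (rule inj_onI)
      fix e e' assume e: "e \<in> E - T" "e' \<in> E - T" "fst e = fst e'"
      obtain u a a' where ua: "e = (u, a)" "e' = (u, a')" using e(3) by (metis prod.collapse)
      have "sl u a = sl u a'" using e unfolding ua T_def by (auto simp: not_less intro: antisym)
      then show "e = e'" using slope_inj e ua by auto
    qed
  qed (use edges in auto)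
  define T1 where "T1 = {e \<in> T. z e = snd e}"
  define T2 where "T2 = {e \<in> T. z e \<noteq> snd e \<and> z e = b e}"
  define T3 where "T3 = {e \<in> T. z e \<noteq> snd e \<and> z e \<noteq> b e}"
  have 1: "card T1 \<le> card V"
  proof (rule le)
    show "inj_on z T1"
    proof (rule inj_onI)
      fix e e' assume "e \<in> T1" "e' \<in> T1" "z e = z e'"
      then show "e = e'"
        using wedge_at_lower_end[of "fst e" "z e" "b e" "fst e'" "b e'"] w[of e] w[of e']
        by (auto simp: T1_def intro: prod_eqI)
    qed
  qed (auto simp: T1_def)
  have 2: "card T2 \<le> card V"
  proof (rule le)
    show "inj_on z T2"
    proof (rule inj_onI)
      fix e e' assume "e \<in> T2" "e' \<in> T2" "z e = z e'"
      then show "e = e'"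
        using wedge_at_upper_end[of "fst e" "snd e" "z e" "fst e'" "snd e'"] w[of e] w[of e']
        by (auto simp: T2_def intro: prod_eqI)
    qed
  qed (auto simp: T2_def)
  have 3: "card T3 \<le> card V"
  proof (rule le)
    show "inj_on z T3"
    proof (rule inj_onI)
      fix e e' assume "e \<in> T3" "e' \<in> T3" "z e = z e'"
      then show "e = e'"
        using wedge_interior[of "fst e" "snd e" "b e" "z e" "fst e'" "snd e'" "b e'"] w[of e] w[of e']
        by (auto simp: T3_def intro: prod_eqI)
    qed
  qed (auto simp: T3_def)
  have "T = T1 \<union> T2 \<union> T3" by (auto simp: T1_def T2_def T3_def)
  then have "card T \<le> card T1 + card T2 + card T3"
    by (metis (no_types, lifting) add.commute add_mono card_Un_le le_trans nat_add_left_cancel_le)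
  moreover have "card E \<le> card (E - T) + card T"
    using card_Un_le[of "E - T" T] fin_E finT
    by (metis (no_types, lifting) Un_Diff_cancel2 card_mono finite_Un finite_Diff le_trans sup_ge1)
  ultimately show ?thesis using 0 1 2 3 by linarith
qed

section \<open>The crossing lemma\<close>

text \<open>Colouring the vertices with \<open>q\<close> colours and keeping colour 0 is sampling
  with probability \<open>1/q\<close>, done by counting. A set \<open>S\<close> survives under
  \<open>q ^ (card V - card S)\<close> colourings; the product form avoids the subtraction.\<close>

lemma card_PiE_fixed:
  fixes q :: nat
  assumes "finite V" "S \<subseteq> V" "0 < q"
  shows "card {f \<in> PiE V (\<lambda>_. {..<q}). \<forall>v\<in>S. f v = 0} * q ^ card S = q ^ card V"
proof -
  have "{f \<in> PiE V (\<lambda>_. {..<q}). \<forall>v\<in>S. f v = 0} = PiE V (\<lambda>v. if v \<in> S then {0} else {..<q})"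
    using assms by (auto simp: PiE_iff extensional_def split: if_splits)
  then have "card {f \<in> PiE V (\<lambda>_. {..<q}). \<forall>v\<in>S. f v = 0} =
      (\<Prod>v\<in>V. if v \<in> S then 1 else q)"
    using assms by (simp add: card_PiE if_distrib cong: if_cong)
  also have "\<dots> = (\<Prod>v\<in>V - S. q)"
    using assms by (subst prod.If_cases) (auto simp: Diff_eq Collect_neg_eq)
  also have "\<dots> = q ^ (card V - card S)"
    using assms by (simp add: card_Diff_subset finite_subset)
  finally show ?thesis
    using card_mono[OF assms(1,2)] by (simp flip: power_add)
qed

lemma sum_card_PiE_fixed:
  fixes q :: nat
  assumes "finite V" "finite A" "0 < q" and d: "\<And>a. a \<in> A \<Longrightarrow> S a \<subseteq> V \<and> card (S a) = d"
  shows "(\<Sum>f\<in>PiE V (\<lambda>_. {..<q}). real (card {a \<in> A. \<forall>v\<in>S a. f v = 0})) * q ^ d = card A * q ^ card V"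
proof -
  let ?F = "PiE V (\<lambda>_. {..<q})"
  have "(\<Sum>f\<in>?F. card {a \<in> A. \<forall>v\<in>S a. f v = 0}) =
      (\<Sum>a\<in>A. card {f \<in> ?F. \<forall>v\<in>S a. f v = 0})"
    by (rule sum_multicount_gen) (use assms in \<open>auto intro!: finite_PiE\<close>)
  then have "(\<Sum>f\<in>?F. card {a \<in> A. \<forall>v\<in>S a. f v = 0}) * q ^ d =
      (\<Sum>a\<in>A. card {f \<in> ?F. \<forall>v\<in>S a. f v = 0} * q ^ card (S a))"
    using d by (simp add: sum_distrib_right)
  also have "\<dots> = card A * q ^ card V"
  proof -
    have "card {f \<in> ?F. \<forall>v\<in>S a. f v = 0} * q ^ card (S a) = q ^ card V" if "a \<in> A" for a
      using card_PiE_fixed[OF assms(1) _ assms(3)] d[OF that] by blast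
    then show ?thesis by simp
  qed
  finally have "real ((\<Sum>f\<in>?F. card {a \<in> A. \<forall>v\<in>S a. f v = 0}) * q ^ d) = real (card A * q ^ card V)"
    by (rule arg_cong)
  then show ?thesis by simp
qed

text \<open>Ordered pairs: each crossing is counted twice, and the first components are exactly the
  edges that take part in some crossing.\<close>

definition crossings :: "('a::real_vector \<times> 'a) set \<Rightarrow> (('a \<times> 'a) \<times> ('a \<times> 'a)) set" where
  "crossings E = {((u, w), (u', w')) | u w u' w'. (u, w) \<in> E \<and> (u', w') \<in> E \<and> (u, w) \<noteq> (u', w') \<and>
     open_segment u w \<inter> open_segment u' w' \<noteq> {}}"

lemma crossingsE:
  assumes "c \<in> crossings E"
  obtains u w u' w' z where "c = ((u, w), (u', w'))" "(u, w) \<in> E" "(u', w') \<in> E"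
    "(u, w) \<noteq> (u', w')" "z \<in> open_segment u w" "z \<in> open_segment u' w'"
proof -
  obtain u w u' w' where *: "c = ((u, w), (u', w'))" "(u, w) \<in> E" "(u', w') \<in> E"
    "(u, w) \<noteq> (u', w')" "open_segment u w \<inter> open_segment u' w' \<noteq> {}"
    using assms unfolding crossings_def by blast
  then show thesis using that by blast
qed

text \<open>By \<open>adjacent\<close>, the two edges of a crossing have no common end, so a
  crossing survives the sampling exactly when four distinct vertices do.\<close>

locale straight_line_graph =
  fixes X Y :: "'a::real_vector \<Rightarrow> real" and V :: "'a set" and E :: "('a \<times> 'a) set"
  assumes lin: "linear X" "linear Y"
    and coords_inj: "\<And>p q. X p = X q \<Longrightarrow> Y p = Y q \<Longrightarrow> p = q"
    and fin: "finite V" and edges: "E \<subseteq> V \<times> V"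
    and rightward: "\<And>u w. (u, w) \<in> E \<Longrightarrow> X u < X w"
    and vertex_free: "\<And>u w z. (u, w) \<in> E \<Longrightarrow> z \<in> V \<Longrightarrow> z \<notin> open_segment u w"
    and adjacent: "\<And>u w u' w'. (u, w) \<in> E \<Longrightarrow> (u', w') \<in> E \<Longrightarrow> (u, w) \<noteq> (u', w') \<Longrightarrow>
       {u, w} \<inter> {u', w'} \<noteq> {} \<Longrightarrow> open_segment u w \<inter> open_segment u' w' = {}"
begin

lemma fin_E: "finite E"
  using finite_subset[OF edges] fin by blast

lemma fin_crossings: "finite (crossings E)"
  by (rule finite_subset[of _ "E \<times> E"]) (auto simp: crossings_def fin_E)

lemma card_edges_le_crossings: "card E \<le> 4 * card V + card (crossings E)"
proof -
  \<comment> \<open>Deleting every edge that takes part in a crossing leaves a plane graph; there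
    are at most as many such edges as ordered crossing pairs.\<close>
  interpret N: noncrossing_graph X Y V "E - fst ` crossings E"
  proof
    show "open_segment u w \<inter> open_segment u' w' = {}"
      if "(u, w) \<in> E - fst ` crossings E" "(u', w') \<in> E - fst ` crossings E" "(u, w) \<noteq> (u', w')"
      for u w u' w'
    proof (rule ccontr)
      assume "open_segment u w \<inter> open_segment u' w' \<noteq> {}"
      then have "((u, w), (u', w')) \<in> crossings E" using that unfolding crossings_def by blast
      then show False using that by force
    qed
  qed (use lin coords_inj edges rightward vertex_free fin in \<open>auto simp: linear_iff\<close>)
  have "card E \<le> card (E - fst ` crossings E) + card (fst ` crossings E)"
    using fin_E fin_crossings
    by (intro order.trans[OF card_mono card_Un_le]) auto
  also have "\<dots> \<le> 4 * card V + card (crossings E)"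
    using N.card_edges_le card_image_le[OF fin_crossings] by (meson add_mono)
  finally show ?thesis .
qed

lemma subgraph: "W \<subseteq> V \<Longrightarrow> straight_line_graph X Y W (E \<inter> W \<times> W)"
  by (rule straight_line_graph.intro)
    (use lin coords_inj edges rightward vertex_free fin adjacent in \<open>auto intro: finite_subset\<close>)

text \<open>The average of \<open>card_edges_le_crossings\<close> over all colourings, applied to
  the subgraph induced by colour 0: vertices survive with frequency \<open>1/q\<close>, edges with
  \<open>1/q^2\<close>, crossings with \<open>1/q^4\<close>. The result is multiplied by
  \<open>q^4\<close>.\<close>

theorem crossing_lemma_sampled:
  fixes q :: nat
  assumes "0 < q"
  shows "real (card E) * q ^ 2 \<le> 4 * real (card V) * q ^ 3 + card (crossings E)"
proof -
  let ?F = "PiE V (\<lambda>_. {..<q})"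
  define W where "W f = {v \<in> V. f v = (0::nat)}" for f
  define Sv where "Sv v = {v :: 'a}" for v
  define Se where "Se = (\<lambda>(u :: 'a, w). {u, w})"
  define Sc where "Sc = (\<lambda>(e, e'). Se e \<union> Se e')"
  have ineq: "real (card {e \<in> E. \<forall>v\<in>Se e. f v = 0}) \<le>
      4 * real (card {v \<in> V. \<forall>v\<in>Sv v. f v = 0}) + real (card {c \<in> crossings E. \<forall>v\<in>Sc c. f v = 0})"
    if "f \<in> ?F" for f
  proof -
    interpret G: straight_line_graph X Y "W f" "E \<inter> W f \<times> W f"
      by (rule subgraph) (auto simp: W_def)
    have "{e \<in> E. \<forall>v\<in>Se e. f v = 0} = E \<inter> W f \<times> W f"
      using edges by (auto simp: Se_def W_def)
    moreover have "{v \<in> V. \<forall>v\<in>Sv v. f v = 0} = W f" by (auto simp: Sv_def W_def)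
    moreover have "{c \<in> crossings E. \<forall>v\<in>Sc c. f v = 0} = crossings (E \<inter> W f \<times> W f)"
      using edges unfolding Sc_def Se_def W_def crossings_def 
      by (auto 0 4)
    ultimately show ?thesis using G.card_edges_le_crossings by simp
  qed
  have "card (Se e) = 2" "Se e \<subseteq> V" if "e \<in> E" for e
    using that rightward edges by (fastforce simp: Se_def card_2_iff split: prod.splits)+
  then have e: "(\<Sum>f\<in>?F. real (card {e \<in> E. \<forall>v\<in>Se e. f v = 0})) * q ^ 2 = card E * q ^ card V"
    using sum_card_PiE_fixed[OF fin fin_E assms, of Se 2] by blast
  have v: "(\<Sum>f\<in>?F. real (card {v \<in> V. \<forall>v\<in>Sv v. f v = 0})) * q ^ 1 = card V * q ^ card V"
    using sum_card_PiE_fixed[OF fin fin assms, of Sv 1] by (auto simp: Sv_def)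
  have Sc: "Sc c \<subseteq> V \<and> card (Sc c) = 4" if c0: "c \<in> crossings E" for c
  proof -
    obtain u w u' w' where c: "c = ((u, w), (u', w'))" "(u, w) \<in> E" "(u', w') \<in> E"
      "(u, w) \<noteq> (u', w')" "open_segment u w \<inter> open_segment u' w' \<noteq> {}"
      using c0 unfolding crossings_def by blast
    have "{u, w} \<inter> {u', w'} = {}" using adjacent c by blast
    moreover have "u \<noteq> w" "u' \<noteq> w'" using c rightward by fastforce+
    ultimately show ?thesis using c edges by (auto simp: Sc_def Se_def)
  qed
  have c: "(\<Sum>f\<in>?F. real (card {c \<in> crossings E. \<forall>v\<in>Sc c. f v = 0})) * q ^ 4 = card (crossings E) * q ^ card V"
    using sum_card_PiE_fixed[OF fin fin_crossings assms Sc] .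
  define SE where "SE = (\<Sum>f\<in>?F. real (card {e \<in> E. \<forall>v\<in>Se e. f v = 0}))"
  define SV where "SV = (\<Sum>f\<in>?F. real (card {v \<in> V. \<forall>v\<in>Sv v. f v = 0}))"
  define SC where "SC = (\<Sum>f\<in>?F. real (card {c \<in> crossings E. \<forall>v\<in>Sc c. f v = 0}))"
  have "SE \<le> (\<Sum>f\<in>?F. 4 * real (card {v \<in> V. \<forall>v\<in>Sv v. f v = 0}) +
      real (card {c \<in> crossings E. \<forall>v\<in>Sc c. f v = 0}))"
    unfolding SE_def by (rule sum_mono) (rule ineq)
  also have "\<dots> = 4 * SV + SC"
    by (simp add: sum.distrib sum_distrib_left SV_def SC_def)
  finally have "SE * real q ^ 4 \<le> (4 * SV + SC) * real q ^ 4"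
    by (rule mult_right_mono) simp
  moreover have "SE * real q ^ 4 = (SE * q ^ 2) * q ^ 2" by (simp flip: power_add add: mult.assoc)
  moreover have "SV * real q ^ 4 = (SV * q ^ 1) * q ^ 3"
    by (simp add: power3_eq_cube power4_eq_xxxx mult.assoc)
  then have "SV * real q ^ 4 = card V * q ^ card V * q ^ 3" using v by (simp only: SV_def of_nat_mult of_nat_power)
  ultimately have "real (card E) * q ^ card V * q ^ 2 \<le>
      4 * (card V * q ^ card V * q ^ 3) + card (crossings E) * q ^ card V"
    using e v c by (simp add: SE_def[symmetric] SC_def[symmetric] distrib_right)
  then have "(real (card E) * q ^ 2) * q ^ card V \<le>
      (4 * real (card V) * q ^ 3 + card (crossings E)) * q ^ card V"
    by (simp add: algebra_simps)
  then show ?thesis using assms by (simp add: mult_le_cancel_right)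
qed

theorem crossing_lemma:
  assumes "8 * card V \<le> card E"
  shows "real (card E) ^ 3 \<le> 512 * real (card V) ^ 2 * card (crossings E)"
proof (cases "card V = 0")
  case True
  then have "E = {}" using fin edges by auto
  then show ?thesis by simp
next
  case False
  define v where "v = real (card V)"
  define e where "e = real (card E)"
  \<comment> \<open>The largest integer with \<open>8 * v * q \<le> e\<close>. The vertex term is
    then at most half of the left side, and rounding costs a factor 2 at most, so
    \<open>e \<le> 16 * v * q\<close>; the constant is 512 = 2 * 16^2.\<close>
  define q where "q = card E div (8 * card V)"
  have v: "v > 0" using False by (simp add: v_def)
  have q: "0 < q" using assms False by (simp add: q_def div_greater_zero_iff)
  have "8 * card V * q \<le> card E" by (simp add: q_def)
  then have 1: "8 * v * q \<le> e" unfolding v_def e_def by (metis of_nat_le_iff of_nat_mult of_nat_numeral)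
  have "card E < 8 * card V * (q + 1)"
    using False unfolding q_def by (metis Suc_eq_plus1 dividend_less_times_div mult_pos_pos neq0_conv zero_less_numeral add.commute mult_Suc_right)
  then have "e < real (8 * card V * (q + 1))" unfolding e_def by (simp only: of_nat_less_iff)
  also have "\<dots> \<le> 16 * v * q" using q v by (simp add: v_def algebra_simps) 
  finally have 2: "e \<le> 16 * v * q" by simp
  have "e * q ^ 2 \<le> 4 * v * q ^ 3 + card (crossings E)"
    using crossing_lemma_sampled[OF q] by (simp add: e_def v_def)
  moreover have "8 * v * real q ^ 3 \<le> e * q ^ 2"
    using mult_right_mono[OF 1, of "real q ^ 2"] by (simp add: power3_eq_cube power2_eq_square mult.assoc)
  ultimately have 3: "e * q ^ 2 \<le> 2 * card (crossings E)" by simp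
  have "e ^ 2 \<le> (16 * v * q) ^ 2" using 2 by (intro power_mono) (auto simp: e_def)
  then have "e * e ^ 2 \<le> e * (16 * v * q) ^ 2" by (intro mult_left_mono) (auto simp: e_def)
  also have "\<dots> = 256 * v ^ 2 * (e * q ^ 2)" by (simp add: power_mult_distrib)
  also have "\<dots> \<le> 256 * v ^ 2 * (2 * card (crossings E))" using 3 by (intro mult_left_mono) auto
  finally show ?thesis by (simp add: e_def v_def power3_eq_cube power2_eq_square mult.assoc)
qed

end

section \<open>Lines in the plane and rich points\<close>

text \<open>The choice leaves scale and sign of the normal open, so sides of a line are compared
  through products \<open>lf l x * lf l y\<close>.\<close>

definition line_eqn :: "point set \<Rightarrow> point \<times> real" where
  "line_eqn l = (SOME (a, b). a \<noteq> 0 \<and> l = {x. a \<bullet> x = b})"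

definition nrm :: "point set \<Rightarrow> point" where
  "nrm l = fst (line_eqn l)"

definition lf :: "point set \<Rightarrow> point \<Rightarrow> real" where
  "lf l x = nrm l \<bullet> x - snd (line_eqn l)"

lemma line_eqn: 
  assumes "is_line l"
  shows nrm_nonzero: "nrm l \<noteq> 0" and mem_line_iff: "x \<in> l \<longleftrightarrow> lf l x = 0"
proof -
  have hull: "affine hull l = l"
    using assms by (simp add: is_line_def affine_hull_eq)
  have "aff_dim l = DIM(point) - 1" using assms by (simp add: is_line_def)
  then have "\<exists>a b. a \<noteq> 0 \<and> affine hull l = {x. a \<bullet> x = b}"
    by (simp only: aff_dim_eq_hyperplane)
  then obtain a b where "a \<noteq> 0" "l = {x. a \<bullet> x = b}"
    unfolding hull by blast
  then have "(\<lambda>(a, b). a \<noteq> 0 \<and> l = {x. a \<bullet> x = b}) (a, b)" by simp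
  then have "(\<lambda>(a, b). a \<noteq> 0 \<and> l = {x. a \<bullet> x = b}) (line_eqn l)"
    unfolding line_eqn_def by (rule someI)
  then show "nrm l \<noteq> 0" "x \<in> l \<longleftrightarrow> lf l x = 0"
    by (auto simp: nrm_def lf_def split: prod.splits)
qed

lemma lf_affine: "lf l ((1 - t) *\<^sub>R x + t *\<^sub>R y) = (1 - t) * lf l x + t * lf l y"
  by (simp add: lf_def inner_add_right algebra_simps)

lemma line_eqI:
  assumes "is_line l" "is_line m" "x \<noteq> y" "x \<in> l" "y \<in> l" "x \<in> m" "y \<in> m"
  shows "l = m"
proof -
  have "affine hull {x, y} = k" if "is_line k" "x \<in> k" "y \<in> k" for k
  proof (rule affine_dim_equal)
    show "affine hull {x, y} \<subseteq> k"
      using that by (intro hull_minimal) (auto simp: is_line_def)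
    show "aff_dim (affine hull {x, y}) = aff_dim k"
      using that assms(3) by (simp add: is_line_def aff_dim_2)
  qed (use that in \<open>auto simp: is_line_def\<close>)
  then show ?thesis using assms by metis
qed

lemma convex_line: "is_line l \<Longrightarrow> convex l"
  by (auto simp: is_line_def affine_imp_convex)

lemma line_combination:
  "is_line l \<Longrightarrow> x \<in> l \<Longrightarrow> y \<in> l \<Longrightarrow> (1 - t) *\<^sub>R x + t *\<^sub>R y \<in> l"
  by (simp add: mem_line_iff lf_affine)

lemma line_translate_mem:
  "is_line l \<Longrightarrow> x \<in> l \<Longrightarrow> y \<in> l \<Longrightarrow> x + t *\<^sub>R (y - x) \<in> l"
  using line_combination[of l x y t] by (simp add: algebra_simps)

lemma open_segment_line:
  "is_line l \<Longrightarrow> x \<in> l \<Longrightarrow> y \<in> l \<Longrightarrow> open_segment x y \<subseteq> l"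
  using convex_contains_open_segment convex_line by blast

text \<open>Its kernel is spanned by \<open>v\<close> if \<open>v\<close> is nonzero. On a line not
  parallel to \<open>v\<close> it is therefore an injective coordinate, and edges along such lines
  are never vertical.\<close>

definition transversal :: "point \<Rightarrow> point \<Rightarrow> real" where
  "transversal v p = v $ 2 * p $ 1 - v $ 1 * p $ 2"

lemma linear_transversal: "linear (transversal v)"
  by (rule linearI) (simp_all add: transversal_def algebra_simps)

lemma transversal_zero_imp:
  assumes "v \<noteq> 0" "transversal v p = 0"
  obtains t where "p = t *\<^sub>R v"
proof -
  have "p = ((p $ 1 * v $ 1 + p $ 2 * v $ 2) / (v $ 1 ^ 2 + v $ 2 ^ 2)) *\<^sub>R v"
  proof -
    have ne: "v $ 1 ^ 2 + v $ 2 ^ 2 \<noteq> 0"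
      using assms(1) by (auto simp: vec_eq_iff forall_2 sum_power2_eq_zero_iff)
    have "p $ i * (v $ 1 ^ 2 + v $ 2 ^ 2) = (p $ 1 * v $ 1 + p $ 2 * v $ 2) * v $ i" for i
    proof -
      have e: "v $ 2 * p $ 1 = v $ 1 * p $ 2" using assms(2) by (simp add: transversal_def)
      have "i = 1 \<or> i = 2" using exhaust_2 by blast
      then show ?thesis
      proof
        assume "i = 1"
        then show ?thesis using arg_cong[OF e, of "\<lambda>z. z * v $ 2"]
          by (simp add: power2_eq_square algebra_simps)
      next
        assume "i = 2"
        have "p $ 2 * v $ 1 * v $ 1 = p $ 1 * v $ 2 * v $ 1" using e by (simp add: algebra_simps)
        then show ?thesis using \<open>i = 2\<close> by (simp add: power2_eq_square algebra_simps)
      qed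
    qed
    then show ?thesis using ne by (simp add: vec_eq_iff nonzero_eq_divide_eq)
  qed
  then show thesis using that by blast
qed

lemma transversal_inj_on_line:
  assumes "is_line l" "v \<noteq> 0" "\<And>x. x \<in> l \<Longrightarrow> x + v \<notin> l" "p \<in> l" "q \<in> l"
    "transversal v p = transversal v q"
  shows "p = q"
proof (rule ccontr)
  assume ne: "p \<noteq> q"
  have "transversal v (q - p) = 0" using assms(6) linear_diff[OF linear_transversal] by simp
  then obtain t where t: "q - p = t *\<^sub>R v" using transversal_zero_imp[OF assms(2)] by metis
  then have "t \<noteq> 0" using ne by auto
  then have "p + (1 / t) *\<^sub>R (q - p) = p + v" using t by simp
  then show False using line_translate_mem[OF assms(1,4,5), of "1 / t"] assms(3,4) by simp
qed

lemma transversal_inner_inj: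
  assumes "v \<noteq> 0" "transversal v p = transversal v q" "v \<bullet> p = v \<bullet> q"
  shows "p = q"
proof -
  have "transversal v (q - p) = 0" using assms(2) linear_diff[OF linear_transversal] by simp
  then obtain t where t: "q - p = t *\<^sub>R v" using transversal_zero_imp[OF assms(1)] by metis
  have "v \<bullet> (q - p) = 0" using assms(3) by (simp add: inner_diff_right)
  then have "t = 0" using t assms(1) by simp
  then show ?thesis using t by simp
qed

lemma linear_open_segment_bounds:
  assumes "linear f" "f u < (f w :: real)" "z \<in> open_segment u w"
  shows "f u < f z" "f z < f w"
proof -
  obtain t where t: "0 < t" "t < 1" "z = (1 - t) *\<^sub>R u + t *\<^sub>R w"
    using assms(3) by (auto simp: in_segment)
  have fz: "f z = f u + t * (f w - f u)"
    unfolding t(3) using assms(1) by (simp only: linear_add linear_scale real_scaleR_def) (simp add: algebra_simps)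
  show "f u < f z" using fz t assms(2) by simp
  have "t * (f w - f u) < 1 * (f w - f u)" using t assms(2) by (intro mult_strict_right_mono) auto
  then show "f z < f w" using fz by simp
qed

lemma mem_open_segment_lineI:
  assumes "is_line l" "inj_on f l" "linear f" "u \<in> l" "w \<in> l" "z \<in> l" "f u < (f z :: real)" "f z < f w"
  shows "z \<in> open_segment u w"
proof -
  define t where "t = (f z - f u) / (f w - f u)"
  have t: "0 < t" "t < 1" using assms by (auto simp: t_def field_simps)
  let ?y = "(1 - t) *\<^sub>R u + t *\<^sub>R w"
  have "?y \<in> l" using assms line_combination by blast
  moreover have "f ?y = f u + t * (f w - f u)"
    using assms(3) by (simp only: linear_add linear_scale real_scaleR_def) (simp add: algebra_simps)
  then have "f ?y = f z" using assms(7,8) by (simp add: t_def)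
  ultimately have "z = ?y" using assms(2,6) by (auto dest: inj_onD)
  moreover have "u \<noteq> w" using assms by auto
  ultimately show ?thesis using t by (auto simp: in_segment)
qed

lemma card_le_of_image:
  assumes "finite B" "\<And>x. x \<in> A \<Longrightarrow> f x \<in> B" "\<And>x y. x \<in> A \<Longrightarrow> y \<in> A \<Longrightarrow> f x = f y \<Longrightarrow> x = y"
  shows "card A \<le> card B"
  by (rule card_inj_on_le[of f]) (use assms in \<open>auto intro: inj_onI\<close>)

text \<open>
  Szekely's argument: join consecutive points of \<open>P\<close> on each line and apply the crossing
  lemma. Crossings only occur inside \<open>Q\<close>, so the number of them is at most \<open>card L * K\<close>.
\<close>

lemma card_rich_points_le:
  fixes L :: "point set set" and P Q :: "point set" and k :: real and K :: nat
  assumes finL: "finite L" and finP: "finite P" and lines: "\<And>l. l \<in> L \<Longrightarrow> is_line l"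
    and v: "v \<noteq> 0" "\<And>l x. l \<in> L \<Longrightarrow> x \<in> l \<Longrightarrow> x + v \<notin> l"
    and Q: "convex Q" "P \<subseteq> Q"
    and cross: "\<And>l. l \<in> L \<Longrightarrow> card {m \<in> L - {l}. m \<inter> (l \<inter> Q) \<noteq> {}} \<le> K"
    and rich: "\<And>p. p \<in> P \<Longrightarrow> k \<le> real (card {l \<in> L. p \<in> l})" and k: "16 \<le> k"
  shows "real (card P) \<le> 4096 * real (card L) * K / k ^ 3 + 2 * real (card L) / k"
proof -
  let ?X = "transversal v"
  have inj: "inj_on ?X l" if "l \<in> L" for l
    using transversal_inj_on_line[OF lines[OF that] v(1)] v(2)[OF that] by (meson inj_onI)
  define E where "E = {(u, w). u \<in> P \<and> w \<in> P \<and> ?X u < ?X w \<and> open_segment u w \<inter> P = {} \<and>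
      (\<exists>l\<in>L. u \<in> l \<and> w \<in> l)}"
  have "\<forall>e\<in>E. \<exists>l\<in>L. fst e \<in> l \<and> snd e \<in> l" by (auto simp: E_def)
  then obtain ln where ln: "\<And>u w. (u, w) \<in> E \<Longrightarrow> ln (u, w) \<in> L \<and> u \<in> ln (u, w) \<and> w \<in> ln (u, w)"
    by (metis fst_conv snd_conv)
  have seg: "open_segment u w \<subseteq> ln (u, w)" if "(u, w) \<in> E" for u w
    using open_segment_line ln[OF that] lines by metis
  have right: "?X u < ?X w" if "(u, w) \<in> E" for u w
    using that by (simp add: E_def)
  have free: "z \<notin> P" if "(u, w) \<in> E" "z \<in> open_segment u w" for u w z
    using that by (auto simp: E_def)
  have ends: "u \<in> P" "w \<in> P" if "(u, w) \<in> E" for u w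
    using that by (auto simp: E_def)
  \<comment> \<open>Edges join neighbours on a line. If two edges of one line shared an interior
    point without being equal, an end of one of them would be a point of \<open>P\<close> inside the
    other.\<close>
  have same: "u = u' \<and> w = w'" if e: "(u, w) \<in> E" "(u', w') \<in> E" "ln (u, w) = ln (u', w')"
    and z: "z \<in> open_segment u w" "z \<in> open_segment u' w'" for u w u' w' z
  proof -
    let ?l = "ln (u, w)"
    have l: "?l \<in> L" "is_line ?l" "u \<in> ?l" "w \<in> ?l" "u' \<in> ?l" "w' \<in> ?l"
      using ln e lines by metis+
    have X: "?X u < ?X z" "?X z < ?X w" "?X u' < ?X z" "?X z < ?X w'"
      using linear_open_segment_bounds[OF linear_transversal _ z(1)]
        linear_open_segment_bounds[OF linear_transversal _ z(2)] right e by blast+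
    note on = mem_open_segment_lineI[OF l(2) inj[OF l(1)] linear_transversal]
    have "?X u = ?X u'"
    proof (rule ccontr)
      assume "?X u \<noteq> ?X u'"
      then consider "?X u < ?X u'" | "?X u' < ?X u" by linarith
      then show False
      proof cases
        case 1
        then have "u' \<in> open_segment u w" using on[OF l(3,4,5)] X by linarith
        then show False using e free ends by blast
      next
        case 2
        then have "u \<in> open_segment u' w'" using on[OF l(5,6,3)] X by linarith
        then show False using e free ends by blast
      qed
    qed
    moreover have "?X w = ?X w'"
    proof (rule ccontr)
      assume "?X w \<noteq> ?X w'"
      then consider "?X w < ?X w'" | "?X w' < ?X w" by linarith
      then show False
      proof cases
        case 1
        then have "w \<in> open_segment u' w'" using on[OF l(5,6,4)] X by linarith
        then show False using e free ends by blast
      next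
        case 2
        then have "w' \<in> open_segment u w" using on[OF l(3,4,6)] X by linarith
        then show False using e free ends by blast
      qed
    qed
    ultimately show ?thesis using inj[OF l(1)] l by (auto dest: inj_onD)
  qed
  interpret G: straight_line_graph ?X "\<lambda>p. v \<bullet> p" P E
  proof (rule straight_line_graph.intro)
    show "linear (\<lambda>p. v \<bullet> p)" by (simp add: linear_iff inner_add_right)
    show "p = q" if "?X p = ?X q" "v \<bullet> p = v \<bullet> q" for p q
      using transversal_inner_inj[OF v(1)] that by blast
    show "open_segment u w \<inter> open_segment u' w' = {}"
      if e: "(u, w) \<in> E" "(u', w') \<in> E" "(u, w) \<noteq> (u', w')" "{u, w} \<inter> {u', w'} \<noteq> {}" for u w u' w'
    proof (rule ccontr)
      assume "open_segment u w \<inter> open_segment u' w' \<noteq> {}"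
      then obtain z where z: "z \<in> open_segment u w" "z \<in> open_segment u' w'" by blast
      have ne: "ln (u, w) \<noteq> ln (u', w')" using same[OF e(1,2)] z e(3) by blast
      obtain p where p: "p \<in> {u, w}" "p \<in> {u', w'}" using e(4) by blast
      have "z \<noteq> p" using z(1) p(1) by (auto simp: open_segment_def)
      moreover have "p \<in> ln (u, w)" "p \<in> ln (u', w')" "z \<in> ln (u, w)" "z \<in> ln (u', w')"
        using p ln e(1,2) seg z by blast+
      moreover have "is_line (ln (u, w))" "is_line (ln (u', w'))" using ln e(1,2) lines by blast+
      ultimately show False using line_eqI ne by blast
    qed
  qed (use finP linear_transversal in \<open>auto simp: E_def\<close>)
  \<comment> \<open>A crossing is determined by the ordered pair of its lines: these meet in one
    point, and on each of them only one edge has this point in its interior. The point lies in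
    \<open>Q\<close> by convexity, so \<open>cross\<close> applies.\<close>
  have "card (crossings E) \<le> card (SIGMA l:L. {m \<in> L - {l}. m \<inter> (l \<inter> Q) \<noteq> {}})"
  proof (rule card_le_of_image[of _ _ "\<lambda>(e, e'). (ln e, ln e')"])
    show "finite (SIGMA l:L. {m \<in> L - {l}. m \<inter> (l \<inter> Q) \<noteq> {}})" using finL by auto
  next
    fix c assume "c \<in> crossings E"
    then obtain u w u' w' z where c: "c = ((u, w), (u', w'))" "(u, w) \<in> E" "(u', w') \<in> E"
      "(u, w) \<noteq> (u', w')" "z \<in> open_segment u w" "z \<in> open_segment u' w'"
      by (rule crossingsE)
    have zl: "z \<in> ln (u, w)" "z \<in> ln (u', w')" using seg c(2,3,5,6) by blast+
    have "z \<in> Q" using c(2,5) Q convex_contains_open_segment unfolding E_def by blast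
    then show "(case c of (e, e') \<Rightarrow> (ln e, ln e')) \<in> (SIGMA l:L. {m \<in> L - {l}. m \<inter> (l \<inter> Q) \<noteq> {}})"
      using c same[OF c(2,3) _ c(5,6)] ln zl by auto
  next
    fix c d assume cd: "c \<in> crossings E" "d \<in> crossings E"
      and eq: "(case c of (e, e') \<Rightarrow> (ln e, ln e')) = (case d of (e, e') \<Rightarrow> (ln e, ln e'))"
    obtain u w u' w' z where c: "c = ((u, w), (u', w'))" "(u, w) \<in> E" "(u', w') \<in> E"
      "(u, w) \<noteq> (u', w')" "z \<in> open_segment u w" "z \<in> open_segment u' w'"
      using cd(1) by (rule crossingsE)
    obtain s t s' t' y where d: "d = ((s, t), (s', t'))" "(s, t) \<in> E" "(s', t') \<in> E"
      "(s, t) \<noteq> (s', t')" "y \<in> open_segment s t" "y \<in> open_segment s' t'"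
      using cd(2) by (rule crossingsE)
    have e: "ln (u, w) = ln (s, t)" "ln (u', w') = ln (s', t')" using eq c d by auto
    have ne: "ln (u, w) \<noteq> ln (u', w')" using same[OF c(2,3) _ c(5,6)] c(4) by blast
    have "z \<in> ln (u, w)" "z \<in> ln (u', w')" "y \<in> ln (u, w)" "y \<in> ln (u', w')"
      using seg[OF c(2)] seg[OF c(3)] seg[OF d(2)] seg[OF d(3)] c(5,6) d(5,6) e by auto
    moreover have "is_line (ln (u, w))" "is_line (ln (u', w'))"
      using ln[OF c(2)] ln[OF c(3)] lines by auto
    ultimately have "z = y" using line_eqI ne by blast
    then have "u = s \<and> w = t" "u' = s' \<and> w' = t'"
      using same[OF c(2) d(2) e(1) c(5)] same[OF c(3) d(3) e(2) c(6)] d(5,6) by auto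
    then show "c = d" using c(1) d(1) by simp
  qed
  also have "\<dots> = (\<Sum>l\<in>L. card {m \<in> L - {l}. m \<inter> (l \<inter> Q) \<noteq> {}})"
    by (rule card_SigmaI) (use finL in auto)
  also have "\<dots> \<le> card L * K" using sum_bounded_above[of L _ K] cross by simp
  finally have cr: "card (crossings E) \<le> card L * K" .
  define I where "I = (SIGMA p:P. {l \<in> L. p \<in> l})"
  \<comment> \<open>Incidences with a further point of \<open>P\<close> to the right on the same
    line. Each yields the edge to the next point, and every line has at most one incidence outside
    \<open>T\<close>.\<close>
  define T where "T = {(p, l) \<in> I. \<exists>w\<in>P. w \<in> l \<and> ?X p < ?X w}"
  have finI: "finite I" using finP finL by (auto simp: I_def)
  have "card P * k \<le> (\<Sum>p\<in>P. real (card {l \<in> L. p \<in> l}))"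
    using sum_mono[of P "\<lambda>_. k"] rich by simp
  also have "\<dots> = real (card I)" unfolding I_def using finP finL by (subst card_SigmaI) auto
  finally have I: "card P * k \<le> card I" .
  have "card (I - T) \<le> card L"
  proof (rule card_le_of_image[OF finL, of _ snd])
    fix x y assume xy: "x \<in> I - T" "y \<in> I - T" "snd x = snd y"
    obtain p q l where pq: "x = (p, l)" "y = (q, l)" using xy(3) by (metis prod.collapse)
    have "?X p = ?X q" "l \<in> L" "p \<in> l" "q \<in> l"
      using xy pq by (auto simp: I_def T_def not_less intro!: antisym)
    then show "x = y" using inj pq by (auto dest: inj_onD)
  qed (auto simp: I_def)
  moreover have "card T \<le> card E"
  proof -
    have "\<forall>x\<in>T. \<exists>w. (fst x, w) \<in> E \<and> w \<in> snd x"
    proof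
      fix x assume "x \<in> T"
      then obtain p l w0 where x: "x = (p, l)" "p \<in> P" "l \<in> L" "p \<in> l" "w0 \<in> P" "w0 \<in> l" "?X p < ?X w0"
        by (auto simp: T_def I_def)
      let ?W = "{w \<in> P \<inter> l. ?X p < ?X w}"
      have "finite ?W" "?W \<noteq> {}" using finP x by auto
      then obtain w where w: "w \<in> ?W" "\<And>w'. w' \<in> ?W \<Longrightarrow> ?X w \<le> ?X w'"
        using ex_is_arg_min_if_finite[of ?W ?X] by (auto simp: is_arg_min_linorder)
      have "z \<notin> P" if z: "z \<in> open_segment p w" for z
      proof
        assume "z \<in> P"
        moreover have "z \<in> l" using open_segment_line[OF lines[OF x(3)] x(4)] w(1) z by blast
        moreover have "?X p < ?X z" "?X z < ?X w"
          using linear_open_segment_bounds[OF linear_transversal _ z] w(1) by blast+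
        ultimately show False using w(2)[of z] by auto
      qed
      then show "\<exists>w. (fst x, w) \<in> E \<and> w \<in> snd x" using w(1) x by (auto simp: E_def)
    qed
    then obtain nx where nx: "\<And>x. x \<in> T \<Longrightarrow> (fst x, nx x) \<in> E \<and> nx x \<in> snd x" by metis
    show ?thesis
    proof (rule card_le_of_image[OF G.fin_E, of _ "\<lambda>x. (fst x, nx x)"])
      fix x y assume xy: "x \<in> T" "y \<in> T" "(fst x, nx x) = (fst y, nx y)"
      have "fst x \<noteq> nx x" using nx[OF xy(1)] by (auto simp: E_def)
      moreover have "fst x \<in> snd x" "fst y \<in> snd y" "snd x \<in> L" "snd y \<in> L"
        using xy by (auto simp: T_def I_def)
      ultimately have "snd x = snd y"
        using line_eqI[of "snd x" "snd y" "fst x" "nx x"] nx xy lines by auto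
      then show "x = y" using xy by (auto intro: prod_eqI)
    qed (use nx in auto)
  qed
  moreover have "card I = card (I - T) + card T"
  proof -
    have "T \<subseteq> I" by (auto simp: T_def)
    then show ?thesis using finI by (metis card_Diff_subset card_mono finite_subset le_add_diff_inverse2)
  qed
  ultimately have e: "card P * k \<le> card E + card L" using I by linarith
  show ?thesis
  \<comment> \<open>Either the number of lines already bounds the incidences, or half of them give
    edges and \<open>16 \<le> k\<close> yields the density \<open>8 * card P \<le> card E\<close>.
    The lost factor 2, cubed, turns 512 into 4096.\<close>
  proof (cases "card P * k \<le> 2 * card L")
    case True
    then have "real (card P) \<le> 2 * real (card L) / k" using k by (simp add: field_simps)
    moreover have "0 \<le> 4096 * real (card L) * K / k ^ 3" using k by simp
    ultimately show ?thesis by linarith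
  next
    case False
    then have e2: "card P * k / 2 \<le> card E" using e by simp
    have "real (card P) * 16 \<le> card P * k" using k by (intro mult_left_mono) auto
    then have "8 * card P \<le> card E" using e2 by linarith
    then have c: "real (card E) ^ 3 \<le> 512 * real (card P) ^ 2 * card (crossings E)"
      by (rule G.crossing_lemma)
    have "(card P * k / 2) ^ 3 \<le> real (card E) ^ 3"
      using e2 k by (intro power_mono) auto
    also note c
    also have "512 * real (card P) ^ 2 * card (crossings E) \<le> 512 * real (card P) ^ 2 * (card L * K)"
      using cr by (intro mult_left_mono) (auto simp flip: of_nat_mult)
    finally have m: "card P * k ^ 3 * (card P) ^ 2 \<le> (4096 * real (card L) * K) * (card P) ^ 2"
      by (simp add: power_mult_distrib power_divide power3_eq_cube power2_eq_square algebra_simps)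
    have "real (card P) > 0" using False by (cases "card P = 0") auto
    then have "card P * k ^ 3 \<le> 4096 * real (card L) * K"
      using m by (simp add: mult_le_cancel_right)
    then have "real (card P) \<le> 4096 * real (card L) * K / k ^ 3" using k by (simp add: field_simps)
    moreover have "0 \<le> 2 * real (card L) / k" using k by simp
    ultimately show ?thesis by linarith
  qed
qed

section \<open>Cells of a line arrangement\<close>

lemma closed_line: "is_line l \<Longrightarrow> closed l"
  by (simp add: is_line_def affine_closed)

lemma continuous_on_lf [continuous_intros]: "continuous_on S (lf l)"
  unfolding lf_def by (intro continuous_intros)

lemma finite_card_le_2I:
  assumes "\<And>a b c. a \<in> S \<Longrightarrow> b \<in> S \<Longrightarrow> c \<in> S \<Longrightarrow> a \<noteq> b \<Longrightarrow> b \<noteq> c \<Longrightarrow> a \<noteq> c \<Longrightarrow> False"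
  shows "finite S" "card S \<le> 2"
proof -
  have no: "\<not> (T \<subseteq> S \<and> card T = 3)" for T
    using assms by (auto simp: card_3_iff)
  show "finite S" using no infinite_arbitrarily_large[of S 3] by blast
  show "card S \<le> 2" using no obtain_subset_with_card_n[of 3 S] by (metis not_less_eq_eq numeral_2_eq_2 numeral_3_eq_3)
qed

locale line_arrangement =
  fixes R :: "point set set"
  assumes finite_R: "finite R" and line_R: "\<And>l. l \<in> R \<Longrightarrow> is_line l"
begin

lemma open_complement: "open (- \<Union>R)"
  by (intro open_Compl closed_Union) (auto intro: finite_R closed_line line_R)

lemma cell_open: "Q \<in> cells R \<Longrightarrow> open Q"
  unfolding cells_def using open_complement open_components by blast

lemma cell_nonempty: "Q \<in> cells R \<Longrightarrow> Q \<noteq> {}"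
  unfolding cells_def by (rule in_components_nonempty)

lemma cell_connected: "Q \<in> cells R \<Longrightarrow> connected Q"
  unfolding cells_def by (rule in_components_connected)

lemma cell_avoids: "Q \<in> cells R \<Longrightarrow> x \<in> Q \<Longrightarrow> l \<in> R \<Longrightarrow> x \<notin> l"
  unfolding cells_def using in_components_subset by blast

lemma lf_cell_nonzero: "Q \<in> cells R \<Longrightarrow> x \<in> Q \<Longrightarrow> l \<in> R \<Longrightarrow> lf l x \<noteq> 0"
  using cell_avoids mem_line_iff line_R by blast

lemma cell_same_side:
  assumes Q: "Q \<in> cells R" and "x \<in> Q" "y \<in> Q" "l \<in> R"
  shows "0 < lf l x * lf l y"
proof (rule ccontr)
  assume "\<not> ?thesis"
  then have "lf l x \<le> 0 \<and> 0 \<le> lf l y \<or> lf l y \<le> 0 \<and> 0 \<le> lf l x"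
    by (auto simp: not_less mult_le_0_iff)
  then have "\<exists>z\<in>Q. lf l z = 0"
    using connected_ivt_hyperplane[OF cell_connected[OF Q], of x y "nrm l" "snd (line_eqn l)"]
      connected_ivt_hyperplane[OF cell_connected[OF Q], of y x "nrm l" "snd (line_eqn l)"] assms
    by (auto simp: lf_def)
  then show False using lf_cell_nonzero assms by blast
qed

lemma convex_same_side: "convex {y. \<forall>l\<in>R. 0 < lf l x * lf l y}"
proof -
  have "{y. \<forall>l\<in>R. 0 < lf l x * lf l y} = (\<Inter>l\<in>R. {y. (lf l x *\<^sub>R nrm l) \<bullet> y > lf l x * snd (line_eqn l)})"
    by (auto simp: lf_def algebra_simps)
  then show ?thesis using convex_halfspace_gt by (auto intro!: convex_INT simp del: inner_scaleR_left)
qed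

text \<open>A cell is a full sign class: the class is convex, hence connected, and avoids the lines,
  while a connected set that avoids the lines cannot change sign.\<close>

lemma cell_eq:
  assumes Q: "Q \<in> cells R" "x \<in> Q"
  shows "Q = {y. \<forall>l\<in>R. 0 < lf l x * lf l y}"
proof
  show "Q \<subseteq> {y. \<forall>l\<in>R. 0 < lf l x * lf l y}" using cell_same_side Q by blast
  show "{y. \<forall>l\<in>R. 0 < lf l x * lf l y} \<subseteq> Q"
  proof (rule components_maximal)
    show "Q \<in> components (- \<Union>R)" using Q by (simp add: cells_def)
    show "connected {y. \<forall>l\<in>R. 0 < lf l x * lf l y}" using convex_same_side convex_connected by blast
    show "{y. \<forall>l\<in>R. 0 < lf l x * lf l y} \<subseteq> - \<Union> R" using mem_line_iff line_R by fastforce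
    have "x \<in> {y. \<forall>l\<in>R. 0 < lf l x * lf l y}"
      using lf_cell_nonzero[OF Q] by (auto simp: zero_less_mult_iff linorder_neq_iff)
    then show "Q \<inter> {y. \<forall>l\<in>R. 0 < lf l x * lf l y} \<noteq> {}" using Q by blast
  qed
qed

lemma cell_convex:
  assumes Q: "Q \<in> cells R"
  shows "convex Q"
proof -
  obtain x where "x \<in> Q" using cell_nonempty[OF Q] by blast
  from cell_eq[OF Q this] show ?thesis by (rule ssubst) (rule convex_same_side)
qed

lemma cell_memI:
  "Q \<in> cells R \<Longrightarrow> x \<in> Q \<Longrightarrow> (\<And>l. l \<in> R \<Longrightarrow> 0 < lf l x * lf l y) \<Longrightarrow> y \<in> Q"
  using cell_eq[of Q x] by blast

lemma cells_disjoint: "Q \<in> cells R \<Longrightarrow> Q' \<in> cells R \<Longrightarrow> x \<in> Q \<Longrightarrow> x \<in> Q' \<Longrightarrow> Q = Q'"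
  by (rule trans[OF cell_eq[of Q x] cell_eq[of Q' x, symmetric]])

lemma cell_unique:
  assumes "Q \<in> cells R" "Q' \<in> cells R" "x \<in> Q" "x' \<in> Q'" "\<And>l. l \<in> R \<Longrightarrow> 0 < lf l x * lf l x'"
  shows "Q = Q'"
  using cell_memI[OF assms(1,3,5)] cells_disjoint assms by blast

lemma closure_cell_side:
  assumes "Q \<in> cells R" "x \<in> Q" "z \<in> closure Q" "l \<in> R"
  shows "0 \<le> lf l x * lf l z"
proof -
  have "closure Q \<subseteq> {z. 0 \<le> lf l x * lf l z}"
  proof (rule closure_minimal)
    show "Q \<subseteq> {z. 0 \<le> lf l x * lf l z}" using cell_same_side assms by (auto intro: less_imp_le)
    show "closed {z. 0 \<le> lf l x * lf l z}" by (intro closed_Collect_le continuous_intros)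
  qed
  then show ?thesis using assms by blast
qed

lemma closure_cell_same_side:
  assumes "Q \<in> cells R" "z \<in> closure Q" "y \<in> closure Q" "l \<in> R"
  shows "0 \<le> lf l z * lf l y"
proof -
  obtain x where x: "x \<in> Q" using cell_nonempty assms by blast
  have "0 \<le> (lf l x * lf l z) * (lf l x * lf l y)"
    using closure_cell_side[OF assms(1) x] assms by (intro mult_nonneg_nonneg[of "_ * _" "_ * _"]) auto
  then have "0 \<le> (lf l x)\<^sup>2 * (lf l z * lf l y)" by (simp add: power2_eq_square algebra_simps)
  then show ?thesis using lf_cell_nonzero[OF assms(1) x assms(4)] by (simp add: zero_le_mult_iff)
qed

text \<open>For every line of \<open>R\<close> both ends are weakly on the side of \<open>Q\<close>.
  As no line contains both, one of them is strictly so, and hence all interior points are.\<close>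

lemma closure_cell_segment:
  assumes Q: "Q \<in> cells R" and z: "z \<in> closure Q" "y \<in> closure Q"
    and no: "\<And>l. l \<in> R \<Longrightarrow> z \<in> l \<Longrightarrow> y \<notin> l"
  shows "open_segment z y \<subseteq> Q"
proof
  fix p assume "p \<in> open_segment z y"
  then obtain t where t: "0 < t" "t < 1" "p = (1 - t) *\<^sub>R z + t *\<^sub>R y" by (auto simp: in_segment)
  obtain x where x: "x \<in> Q" using cell_nonempty Q by blast
  show "p \<in> Q"
  proof (rule cell_memI[OF Q x])
    fix l assume l: "l \<in> R"
    have "lf l x * lf l p = (1 - t) * (lf l x * lf l z) + t * (lf l x * lf l y)"
      unfolding t(3) lf_affine by (simp add: algebra_simps)
    moreover have "0 \<le> lf l x * lf l z" "0 \<le> lf l x * lf l y"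
      using closure_cell_side[OF Q x] z l by auto
    moreover have "lf l x * lf l z \<noteq> 0 \<or> lf l x * lf l y \<noteq> 0"
      using no[OF l] mem_line_iff[OF line_R[OF l]] lf_cell_nonzero[OF Q x l] by auto
    ultimately show "0 < lf l x * lf l p"
      using t by (smt (verit, best) mult_nonneg_nonneg mult_pos_pos)
  qed
qed

lemma closure_cell_off_lines:
  assumes "Q \<in> cells R" "z \<in> closure Q" "\<And>l. l \<in> R \<Longrightarrow> z \<notin> l"
  shows "z \<in> Q"
proof -
  obtain x where x: "x \<in> Q" using cell_nonempty assms by blast
  show ?thesis
    using closure_cell_side[OF assms(1) x assms(2)] lf_cell_nonzero[OF assms(1) x]
      mem_line_iff line_R assms(3)
    by (intro cell_memI[OF assms(1) x]) (metis less_le mult_eq_0_iff)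
qed

lemma closure_cell_convex: "Q \<in> cells R \<Longrightarrow> convex (closure Q)"
  by (simp add: cell_convex convex_closure)

lemma interior_closure_cell: "Q \<in> cells R \<Longrightarrow> interior (closure Q) = Q"
  by (simp add: cell_convex cell_open convex_interior_closure interior_open)

text \<open>
  Contacts are the points in the relative interior of an edge of \<open>Q\<close> on \<open>j\<close>. Degenerate vertices
  may lie on many lines, so only lines with a contact are counted as carrying an edge.
\<close>

definition contact :: "point set \<Rightarrow> point set \<Rightarrow> point \<Rightarrow> bool" where
  "contact Q j E \<longleftrightarrow> E \<in> j \<and> E \<in> closure Q \<and> (\<forall>i\<in>R - {j}. E \<notin> i)"

definition edge_lines :: "point set \<Rightarrow> point set set" where
  "edge_lines Q = {j \<in> R. \<exists>E. contact Q j E}"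

definition vertices :: "point set \<Rightarrow> point set" where
  "vertices Q = {p \<in> closure Q. \<exists>i\<in>R. \<exists>j\<in>R. i \<noteq> j \<and> p \<in> i \<and> p \<in> j}"

lemma finite_edge_lines: "finite (edge_lines Q)"
  using finite_R by (simp add: edge_lines_def)

text \<open>A further sample line through \<open>z\<close> has \<open>x\<close> and \<open>y\<close>
  weakly on the same side, so it contains both of them and is \<open>i\<close> itself.\<close>

lemma edge_interior_contact:
  assumes Q: "Q \<in> cells R" and i: "i \<in> R" and x: "x \<in> i" "x \<in> closure Q" and y: "y \<in> i" "y \<in> closure Q"
    and z: "z \<in> open_segment x y"
  shows "contact Q i z"
proof -
  obtain t where t: "0 < t" "t < 1" "z = (1 - t) *\<^sub>R x + t *\<^sub>R y" and ne: "x \<noteq> y"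
    using z by (auto simp: in_segment)
  have "z \<in> i" using open_segment_line[OF line_R[OF i] x(1) y(1)] z by blast
  moreover have "z \<in> closure Q"
    using closure_cell_convex[OF Q] x y z convex_contains_open_segment by blast
  moreover have "z \<notin> k" if k: "k \<in> R - {i}" for k
  proof
    assume "z \<in> k"
    then have "(1 - t) * lf k x + t * lf k y = 0" 
      using mem_line_iff[of k] line_R k t lf_affine by auto
    moreover have "0 \<le> lf k x * lf k y" using closure_cell_same_side[OF Q] x y k by blast
    ultimately have "lf k x = 0 \<and> lf k y = 0" using t
      by (smt (verit, ccfv_SIG) mult_eq_0_iff mult_neg_pos mult_pos_pos zero_le_mult_iff)
    then have "x \<in> k" "y \<in> k" using mem_line_iff[of k] line_R k by auto
    then have "k = i" using line_eqI[of k i x y] line_R k i x y ne by auto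
    then show False using k by blast
  qed
  ultimately show ?thesis by (auto simp: contact_def)
qed

lemma polyhedron_closure_cell:
  assumes Q: "Q \<in> cells R"
  shows "polyhedron (closure Q)"
proof -
  obtain x where x: "x \<in> Q" using cell_nonempty Q by blast
  have "closure Q = (\<Inter>l\<in>R. {z. 0 \<le> lf l x * lf l z})"
  proof
    show "closure Q \<subseteq> (\<Inter>l\<in>R. {z. 0 \<le> lf l x * lf l z})" using closure_cell_side[OF Q x] by blast
    show "(\<Inter>l\<in>R. {z. 0 \<le> lf l x * lf l z}) \<subseteq> closure Q"
    proof
      fix z assume z: "z \<in> (\<Inter>l\<in>R. {z. 0 \<le> lf l x * lf l z})"
      show "z \<in> closure Q"
      proof (cases "z = x")
        case True
        then show ?thesis using x closure_subset by blast
      next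
        case False
        have "open_segment z x \<subseteq> Q"
        proof
          fix p assume "p \<in> open_segment z x"
          then obtain t where t: "0 < t" "t < 1" "p = (1 - t) *\<^sub>R z + t *\<^sub>R x" by (auto simp: in_segment)
          show "p \<in> Q"
          proof (rule cell_memI[OF Q x])
            fix l assume l: "l \<in> R"
            have "lf l x * lf l p = (1 - t) * (lf l x * lf l z) + t * (lf l x * lf l x)"
              unfolding t(3) lf_affine by (simp add: algebra_simps)
            moreover have "0 \<le> lf l x * lf l z" using z l by blast
            moreover have "0 < lf l x * lf l x" using cell_same_side Q x l by blast
            ultimately show "0 < lf l x * lf l p"
              using t by (simp add: add_nonneg_pos)
          qed
        qed
        then have "closure (open_segment z x) \<subseteq> closure Q" by (rule closure_mono)
        then show ?thesis using False by (simp add: closure_open_segment subset_iff)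
      qed
    qed
  qed
  moreover have "polyhedron {z. 0 \<le> lf l x * lf l z}" for l
  proof -
    have "{z. 0 \<le> lf l x * lf l z} = {z. (lf l x *\<^sub>R nrm l) \<bullet> z \<ge> lf l x * snd (line_eqn l)}"
      by (auto simp: lf_def algebra_simps)
    then show ?thesis by (simp add: polyhedron_halfspace_ge del: inner_scaleR_left)
  qed
  ultimately show ?thesis using finite_R by (auto intro: polyhedron_Inter)
qed

text \<open>A relative interior point of the facet lies on some sample line \<open>j\<close>. The
  trace of \<open>j\<close> on the closure is a face that contains the facet and has no larger
  dimension. The midpoint of two facet points is a contact, so \<open>j\<close> is an edge
  line.\<close>

lemma facet_eq:
  assumes Q: "Q \<in> cells R" and F: "F facet_of closure Q"
  obtains j where "j \<in> edge_lines Q" "F = closure Q \<inter> j"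
proof -
  obtain x where x: "x \<in> Q" using cell_nonempty Q by blast
  have "aff_dim (closure Q) = 2"
    using aff_dim_open[OF cell_open[OF Q] cell_nonempty[OF Q]] by (simp add: closure_aff_dim)
  then have dim: "aff_dim F = 1" and face: "F face_of closure Q" and "F \<noteq> {}"
    using F by (auto simp: facet_of_def)
  then have "F \<noteq> closure Q" using \<open>aff_dim (closure Q) = 2\<close> by auto
  then have disj: "F \<inter> Q = {}"
    using face_of_disjoint_interior[OF face] interior_closure_cell[OF Q] by simp
  have sub: "F \<subseteq> closure Q" using face face_of_imp_subset by blast
  have "convex F" using face face_of_imp_convex by blast
  then obtain p where p: "p \<in> rel_interior F" using \<open>F \<noteq> {}\<close> rel_interior_eq_empty by blast
  then have pF: "p \<in> F" using rel_interior_subset by blast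
  then obtain j where j: "j \<in> R" "p \<in> j" using closure_cell_off_lines[OF Q] sub disj by blast
  have j_eq: "j = {z. (lf j x *\<^sub>R nrm j) \<bullet> z = lf j x * snd (line_eqn j)}"
    using mem_line_iff[OF line_R[OF j(1)]] lf_cell_nonzero[OF Q x j(1)] by (auto simp: lf_def)
  have "closure Q \<inter> {z. (lf j x *\<^sub>R nrm j) \<bullet> z = lf j x * snd (line_eqn j)} face_of closure Q"
  proof (rule face_of_Int_supporting_hyperplane_ge[OF closure_cell_convex[OF Q]])
    show "(lf j x *\<^sub>R nrm j) \<bullet> z \<ge> lf j x * snd (line_eqn j)" if "z \<in> closure Q" for z
      using closure_cell_side[OF Q x that j(1)] by (simp add: lf_def algebra_simps)
  qed
  then have face_j: "closure Q \<inter> j face_of closure Q" by (simp only: j_eq[symmetric])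
  have Fj: "F \<subseteq> closure Q \<inter> j"
    by (rule subset_of_face_of[OF face_j sub]) (use p pF j sub in blast)
  have "F = closure Q \<inter> j"
  proof (rule ccontr)
    assume ne: "F \<noteq> closure Q \<inter> j"
    have "F face_of closure Q \<inter> j" using face_of_subset[OF face Fj] by blast
    then have "aff_dim F < aff_dim (closure Q \<inter> j)"
      using face_of_aff_dim_lt ne face_j face_of_imp_convex by blast
    also have "\<dots> \<le> aff_dim j" by (rule aff_dim_subset) blast
    also have "\<dots> = 1" using line_R j by (simp add: is_line_def)
    finally show False using dim by simp
  qed
  moreover have "j \<in> edge_lines Q"
  proof -
    have "\<not> (\<exists>a. F = {a})" using dim aff_dim_sing by fastforce
    then obtain a b where ab: "a \<in> F" "b \<in> F" "a \<noteq> b" using pF by blast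
    have "midpoint a b \<in> open_segment a b" using ab by simp
    then have "contact Q j (midpoint a b)"
      using edge_interior_contact[OF Q j(1)] ab Fj by blast
    then show ?thesis using j by (auto simp: edge_lines_def)
  qed
  ultimately show thesis using that by blast
qed

lemma card_sides_le: 
  assumes "Q \<in> cells R"
  shows "card (sides Q) \<le> card (edge_lines Q)"
proof -
  have "sides Q \<subseteq> (\<lambda>j. closure Q \<inter> j) ` edge_lines Q"
    using facet_eq[OF assms] by (auto simp: sides_def)
  then show ?thesis by (rule surj_card_le[OF finite_edge_lines])
qed

text \<open>Many of the lines through a degenerate vertex may carry no edge. That at least one of
  them does follows because the relative frontier of a polyhedron is the union of its
  facets.\<close>

lemma boundary_on_edge_line:
  assumes Q: "Q \<in> cells R" and p: "p \<in> closure Q" "p \<notin> Q"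
  obtains j where "j \<in> edge_lines Q" "p \<in> j"
proof -
  have int: "interior (closure Q) = Q" by (rule interior_closure_cell[OF Q])
  have "interior (closure Q) \<noteq> {}" unfolding int by (rule cell_nonempty[OF Q])
  then have "rel_interior (closure Q) = Q"
    by (rule rel_interior_nonempty_interior[THEN trans[OF _ int]])
  then have "p \<in> rel_frontier (closure Q)" using p unfolding rel_frontier_def by simp
  then obtain F where "F facet_of closure Q" "p \<in> F"
    using rel_frontier_of_polyhedron[OF polyhedron_closure_cell[OF Q]] by blast
  then show thesis using facet_eq[OF Q] that by blast
qed

lemma edge_lines_nonempty:
  assumes Q: "Q \<in> cells R" and "R \<noteq> {}"
  shows "edge_lines Q \<noteq> {}"
proof -
  have "Q \<noteq> UNIV"
  proof
    assume "Q = UNIV"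
    obtain l where "l \<in> R" using assms by blast
    moreover have "l \<noteq> {}" using line_R[OF \<open>l \<in> R\<close>] by (auto simp: is_line_def)
    ultimately show False using cell_avoids[OF Q] \<open>Q = UNIV\<close> by blast
  qed
  then have "\<not> closed Q" using cell_open[OF Q] cell_nonempty[OF Q] clopen by blast
  then obtain p where "p \<in> closure Q" "p \<notin> Q" using closure_subset closure_eq by blast
  then show ?thesis using boundary_on_edge_line[OF Q] by blast
qed

lemma vertices_off: "Q \<in> cells R \<Longrightarrow> p \<in> vertices Q \<Longrightarrow> p \<notin> Q"
  using cell_avoids by (auto simp: vertices_def)

lemma contact_not_vertex: "contact Q j p \<Longrightarrow> p \<notin> vertices Q"
  by (auto simp: contact_def vertices_def)

lemma boundary_cases:
  assumes Q: "Q \<in> cells R" and p: "p \<in> closure Q" "p \<notin> Q"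
  shows "p \<in> vertices Q \<or> (\<exists>j\<in>edge_lines Q. contact Q j p)"
proof -
  obtain j where j: "j \<in> edge_lines Q" "p \<in> j" using boundary_on_edge_line[OF assms] .
  show ?thesis
  proof (cases "contact Q j p")
    case False
    then obtain i where "i \<in> R" "i \<noteq> j" "p \<in> i" using j p by (auto simp: contact_def)
    then show ?thesis using j p by (auto simp: vertices_def edge_lines_def)
  qed (use j in blast)
qed

text \<open>Of three vertices on \<open>j\<close> the middle one would be interior to a segment with
  ends in the closure, hence a contact.\<close>

lemma vertices_on_line:
  assumes Q: "Q \<in> cells R" and j: "j \<in> R"
  shows "finite (vertices Q \<inter> j)" "card (vertices Q \<inter> j) \<le> 2"
proof -
  have no3: "False" if "a \<in> vertices Q \<inter> j" "b \<in> vertices Q \<inter> j" "c \<in> vertices Q \<inter> j" "a \<noteq> b" "b \<noteq> c" "a \<noteq> c" for a b c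
  proof -
    have no: "z \<notin> open_segment x y" if "x \<in> vertices Q \<inter> j" "y \<in> vertices Q \<inter> j" "z \<in> vertices Q \<inter> j" for x y z
      using edge_interior_contact[OF Q j, of x y z] contact_not_vertex[of Q j z] that by (auto simp: vertices_def)
    have "collinear {a, b, c}"
      by (rule collinear_subset[of j]) (use that line_R[OF j] in \<open>auto simp: is_line_def collinear_aff_dim\<close>)
    then have "between (b, c) a \<or> between (c, a) b \<or> between (a, b) c"
      by (simp add: collinear_between_cases)
    then show False using no that by (auto simp: between_mem_segment open_segment_def)
  qed
  show "finite (vertices Q \<inter> j)" by (rule finite_card_le_2I(1)) (rule no3)
  show "card (vertices Q \<inter> j) \<le> 2" by (rule finite_card_le_2I(2)) (rule no3)
qed

lemma vertices_subset:
  assumes "Q \<in> cells R"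
  shows "vertices Q \<subseteq> (\<Union>j\<in>edge_lines Q. vertices Q \<inter> j)"
proof
  fix p assume p: "p \<in> vertices Q"
  then have "p \<in> closure Q" "p \<notin> Q" using vertices_off[OF assms] by (auto simp: vertices_def)
  then obtain j where "j \<in> edge_lines Q" "p \<in> j" using boundary_on_edge_line[OF assms] by blast
  then show "p \<in> (\<Union>j\<in>edge_lines Q. vertices Q \<inter> j)" using p by blast
qed

lemma edge_lines_subset: "edge_lines Q \<subseteq> R"
  by (auto simp: edge_lines_def)

lemma finite_UN_vertices: "Q \<in> cells R \<Longrightarrow> finite (\<Union>j\<in>edge_lines Q. vertices Q \<inter> j)"
  by (rule finite_UN_I[OF finite_edge_lines]) (meson edge_lines_subset subsetD vertices_on_line(1))

lemma finite_vertices: "Q \<in> cells R \<Longrightarrow> finite (vertices Q)"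
  by (rule finite_subset[OF vertices_subset finite_UN_vertices])

lemma card_vertices_le:
  assumes Q: "Q \<in> cells R"
  shows "card (vertices Q) \<le> 2 * card (edge_lines Q)"
proof -
  have "card (vertices Q) \<le> card (\<Union>j\<in>edge_lines Q. vertices Q \<inter> j)"
    by (rule card_mono[OF finite_UN_vertices[OF Q] vertices_subset[OF Q]])
  also have "\<dots> \<le> (\<Sum>j\<in>edge_lines Q. card (vertices Q \<inter> j))" by (rule card_UN_le[OF finite_edge_lines])
  also have "\<dots> \<le> (\<Sum>j\<in>edge_lines Q. 2)"
    by (rule sum_mono) (meson edge_lines_subset subsetD vertices_on_line(2) Q)
  finally show ?thesis by simp
qed

end

section \<open>The zone of a line\<close>

definition perp :: "point \<Rightarrow> point" where
  "perp n = (\<chi> i. if i = 1 then - n $ 2 else n $ 1)"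

lemma perp_decomposition: "(n \<bullet> n) * (m \<bullet> p) = (m \<bullet> perp n) * (perp n \<bullet> p) + (m \<bullet> n) * (n \<bullet> p)"
  by (simp add: perp_def inner_vec_def sum_2 algebra_simps)

lemma perp_self: "perp n \<bullet> n = 0" "n \<bullet> perp n = 0" "perp n \<bullet> perp n = n \<bullet> n"
  by (simp_all add: perp_def inner_vec_def sum_2)

text \<open>
  Together with \<^term>\<open>lf l\<close> this is a system of rectangular coordinates in which \<open>l\<close> is the
  horizontal axis.
\<close>

definition along :: "point set \<Rightarrow> point \<Rightarrow> real" where
  "along l p = perp (nrm l) \<bullet> p"

lemma along_affine: "along l ((1 - t) *\<^sub>R p + t *\<^sub>R q) = (1 - t) * along l p + t * along l q"
  by (simp add: along_def inner_add_right)

lemma coords_eqI: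
  assumes "is_line l" "along l p = along l q" "lf l p = lf l q"
  shows "p = q"
proof -
  let ?n = "nrm l"
  have "perp ?n \<bullet> (p - q) = 0" "?n \<bullet> (p - q) = 0"
    using assms by (simp_all add: along_def lf_def inner_diff_right)
  then have "(?n \<bullet> ?n) * ((p - q) \<bullet> (p - q)) = 0"
    using perp_decomposition[of ?n "p - q" "p - q"] by simp
  then show ?thesis using nrm_nonzero[OF assms(1)] by simp
qed

definition transv :: "point set \<Rightarrow> point set \<Rightarrow> bool" where
  "transv l j \<longleftrightarrow> nrm j \<bullet> perp (nrm l) \<noteq> 0"

lemma lf_in_coords:
  assumes "is_line l"
  shows "lf j p = (nrm j \<bullet> perp (nrm l)) / (nrm l \<bullet> nrm l) * along l p
    + (nrm j \<bullet> nrm l) / (nrm l \<bullet> nrm l) * (lf l p + snd (line_eqn l)) - snd (line_eqn j)"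
proof -
  have "nrm j \<bullet> p = ((nrm j \<bullet> perp (nrm l)) * along l p + (nrm j \<bullet> nrm l) * (nrm l \<bullet> p)) / (nrm l \<bullet> nrm l)"
    using perp_decomposition[of "nrm l" "nrm j" p] nrm_nonzero[OF assms]
    by (simp add: along_def field_simps)
  then show ?thesis by (simp add: lf_def add_divide_distrib)
qed

lemma transv_form:
  assumes "is_line l" "transv l j"
  shows "\<exists>\<xi> \<mu> \<alpha>. \<alpha> \<noteq> 0 \<and> (\<forall>p. lf j p = \<alpha> * (along l p - \<xi> - \<mu> * lf l p))"
proof -
  define A B where "A = (nrm j \<bullet> perp (nrm l)) / (nrm l \<bullet> nrm l)"
    and "B = (nrm j \<bullet> nrm l) / (nrm l \<bullet> nrm l)"
  have A: "A \<noteq> 0" using assms nrm_nonzero by (simp add: A_def transv_def)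
  define e where "e = (snd (line_eqn j) - B * snd (line_eqn l)) / A"
  have e: "A * e = snd (line_eqn j) - B * snd (line_eqn l)" using A by (simp add: e_def)
  have "lf j p = A * (along l p - e - (- B / A) * lf l p)" for p
    using lf_in_coords[OF assms(1), of j p] A unfolding A_def[symmetric] B_def[symmetric]
    by (simp add: right_diff_distrib distrib_left e)
  then show ?thesis using A by blast
qed

lemma parallel_form:
  assumes "is_line l" "is_line j" "\<not> transv l j"
  shows "\<exists>h \<beta>. \<beta> \<noteq> 0 \<and> (\<forall>p. lf j p = \<beta> * (lf l p - h))"
proof -
  define B where "B = (nrm j \<bullet> nrm l) / (nrm l \<bullet> nrm l)"
  have "nrm j \<bullet> perp (nrm l) = 0" using assms(3) by (simp add: transv_def)
  then have "(nrm l \<bullet> nrm l) * (nrm j \<bullet> nrm j) = (nrm j \<bullet> nrm l) * (nrm l \<bullet> nrm j)"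
    using perp_decomposition[of "nrm l" "nrm j" "nrm j"] by simp
  then have B: "B \<noteq> 0" using nrm_nonzero assms by (auto simp: B_def)
  define e where "e = (snd (line_eqn j) - B * snd (line_eqn l)) / B"
  have e: "B * e = snd (line_eqn j) - B * snd (line_eqn l)" using B by (simp add: e_def)
  have "lf j p = B * (lf l p - e)" for p
    using lf_in_coords[OF assms(1), of j p] \<open>nrm j \<bullet> perp (nrm l) = 0\<close> unfolding B_def[symmetric]
    by (simp add: right_diff_distrib distrib_left e)
  then show ?thesis using B by blast
qed

section \<open>Cells that touch a given line\<close>

context line_arrangement
begin

text \<open>Cells are sign classes, so agreement on each line suffices. Points of the closures
  decide the lines that they avoid; the second disjunct is for the line on which they lie.\<close>

lemma cell_eqI_common_point:
  assumes Q: "Q \<in> cells R" "Q' \<in> cells R" and z: "z \<in> closure Q" "z' \<in> closure Q'"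
    and side: "\<And>i. i \<in> R \<Longrightarrow> 0 < lf i z * lf i z' \<or> (\<forall>x\<in>Q. \<forall>x'\<in>Q'. 0 < lf i x * lf i x')"
  shows "Q = Q'"
proof -
  obtain x x' where x: "x \<in> Q" "x' \<in> Q'" using cell_nonempty Q by blast
  show ?thesis
  proof (rule cell_unique[OF Q x])
    fix i assume i: "i \<in> R"
    show "0 < lf i x * lf i x'"
    proof (cases "0 < lf i z * lf i z'")
      case True
      have "0 \<le> lf i x * lf i z" "0 \<le> lf i x' * lf i z'"
        using closure_cell_side[OF Q(1) x(1) z(1) i] closure_cell_side[OF Q(2) x(2) z(2) i] by auto
      moreover have "lf i x \<noteq> 0" "lf i x' \<noteq> 0" using lf_cell_nonzero Q x i by blast+
      ultimately show ?thesis using True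
        by (auto simp: zero_less_mult_iff zero_le_mult_iff)
    next
      case False
      then show ?thesis using side[OF i] x by blast
    qed
  qed
qed

text \<open>A cell is determined by its side of \<open>l\<close> and the set of transversal lines
  that meet \<open>l\<close> left of the touching point. These sets are nested, so their cardinality
  suffices: \<open>card R + 1\<close> values for each of two sides. The line \<open>l\<close> may or
  may not belong to \<open>R\<close>; both cases occur later.\<close>

lemma card_cells_touching:
  assumes l: "is_line l"
  defines "T \<equiv> {Q \<in> cells R. \<exists>E\<in>closure Q. E \<in> l \<and> (\<forall>i\<in>R - {l}. E \<notin> i)}"
  shows "finite T \<and> card T \<le> 2 * (card R + 1)"
proof -
  have "\<forall>Q\<in>T. \<exists>E. E \<in> closure Q \<and> E \<in> l \<and> (\<forall>i\<in>R - {l}. E \<notin> i)" by (auto simp: T_def)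
  then obtain E where E: "\<And>Q. Q \<in> T \<Longrightarrow> E Q \<in> closure Q \<and> E Q \<in> l \<and> (\<forall>i\<in>R - {l}. E Q \<notin> i)"
    by metis
  define W where "W = {j \<in> R - {l}. transv l j}"
  have "\<forall>j\<in>W. \<exists>\<xi> \<mu> \<alpha>. \<alpha> \<noteq> 0 \<and> (\<forall>p. lf j p = \<alpha> * (along l p - \<xi> - \<mu> * lf l p))"
    using transv_form[OF l] by (auto simp: W_def)
  then obtain \<xi> \<mu> \<alpha> where form: "\<And>j. j \<in> W \<Longrightarrow> \<alpha> j \<noteq> 0"
      "\<And>j p. j \<in> W \<Longrightarrow> lf j p = \<alpha> j * (along l p - \<xi> j - \<mu> j * lf l p)"
    by metis
  define S where "S Q = {j \<in> W. \<xi> j < along l (E Q)}" for Q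
  define f where "f Q = (card (S Q), \<exists>x\<in>Q. 0 < lf l x)" for Q
  have finW: "finite W" using finite_R by (simp add: W_def)
  have Eon: "lf l (E Q) = 0" if "Q \<in> T" for Q using E[OF that] mem_line_iff[OF l] by blast
  have *: "Q = Q'" if Q: "Q \<in> T" "Q' \<in> T" and f: "f Q = f Q'" and le: "along l (E Q) \<le> along l (E Q')" for Q Q'
  proof -
    have "S Q \<subseteq> S Q'" using le by (auto simp: S_def)
    then have SS: "S Q = S Q'" using f finW by (intro card_subset_eq) (auto simp: S_def f_def)
    show "Q = Q'"
    proof (rule cell_eqI_common_point)
      show "Q \<in> cells R" "Q' \<in> cells R" using Q by (auto simp: T_def)
      show "E Q \<in> closure Q" "E Q' \<in> closure Q'" using E Q by auto
      fix i assume i: "i \<in> R"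
      consider "i = l" | "i \<in> W" | "i \<noteq> l" "\<not> transv l i" using i by (auto simp: W_def)
      then show "0 < lf i (E Q) * lf i (E Q') \<or> (\<forall>x\<in>Q. \<forall>x'\<in>Q'. 0 < lf i x * lf i x')"
      proof cases
        case 1
        have c: "Q \<in> cells R" "Q' \<in> cells R" using Q by (auto simp: T_def)
        have "0 < lf i x * lf i x'" if x: "x \<in> Q" "x' \<in> Q'" for x x'
        proof -
          have "0 < lf i x \<longleftrightarrow> (\<exists>x\<in>Q. 0 < lf l x)"
            using cell_same_side[OF c(1) x(1) _ i] x(1) unfolding 1 by (metis order.asym zero_less_mult_iff)
          moreover have "0 < lf i x' \<longleftrightarrow> (\<exists>x\<in>Q'. 0 < lf l x)"
            using cell_same_side[OF c(2) x(2) _ i] x(2) unfolding 1 by (metis order.asym zero_less_mult_iff)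
          ultimately have "0 < lf i x \<longleftrightarrow> 0 < lf i x'" using f by (simp add: f_def)
          then show ?thesis using lf_cell_nonzero[OF c(1) x(1) i] lf_cell_nonzero[OF c(2) x(2) i]
            by (auto simp: zero_less_mult_iff)
        qed
        then show ?thesis by blast
      next
        case 2
        have nz: "lf i (E Q) \<noteq> 0" "lf i (E Q') \<noteq> 0"
          using E Q 2 mem_line_iff[OF line_R[OF i]] by (auto simp: W_def)
        have e: "lf i (E Q) = \<alpha> i * (along l (E Q) - \<xi> i)" "lf i (E Q') = \<alpha> i * (along l (E Q') - \<xi> i)"
          using form(2)[OF 2] Eon Q by auto
        have "\<xi> i < along l (E Q) \<longleftrightarrow> \<xi> i < along l (E Q')" using SS 2 by (auto simp: S_def)
        then have "0 < (along l (E Q) - \<xi> i) * (along l (E Q') - \<xi> i)"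
          using nz e by (auto simp: zero_less_mult_iff)
        then have "0 < (\<alpha> i * \<alpha> i) * ((along l (E Q) - \<xi> i) * (along l (E Q') - \<xi> i))"
          using form(1)[OF 2] by (intro mult_pos_pos[of "\<alpha> i * \<alpha> i"]) (auto simp: zero_less_mult_iff)
        then show ?thesis unfolding e by (simp add: algebra_simps)
      next
        case 3
        obtain h \<beta> where "\<beta> \<noteq> 0" "\<And>p. lf i p = \<beta> * (lf l p - h)"
          using parallel_form[OF l line_R[OF i] 3(2)] by blast
        then have "lf i (E Q) = lf i (E Q')" using Eon Q by simp
        moreover have "lf i (E Q) \<noteq> 0" using E Q 3 i mem_line_iff[OF line_R[OF i]] by auto
        ultimately show ?thesis by (auto simp: zero_less_mult_iff)
      qed
    qed
  qed
  have inj: "inj_on f T"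
  proof (rule inj_onI)
    fix Q Q' assume "Q \<in> T" "Q' \<in> T" "f Q = f Q'"
    then show "Q = Q'" using *[of Q Q'] *[of Q' Q] by (metis linear)
  qed
  have "card (S Q) \<le> card R" for Q
    using finite_R by (intro card_mono) (auto simp: S_def W_def)
  then have sub: "f ` T \<subseteq> {..card R} \<times> UNIV" by (auto simp: f_def)
  then have "finite T" using finite_imageD[OF finite_subset[OF sub] inj] by simp
  moreover have "card T \<le> card ({..card R} \<times> (UNIV :: bool set))"
    by (rule card_inj_on_le[OF inj sub]) simp
  ultimately show ?thesis by (simp add: card_cartesian_product)
qed

end

text \<open>
  The part of the plane above a line of the arrangement, in coordinates in which this line is
  the axis \<open>Y = 0\<close>; \<open>\<xi> j\<close> is the position of \<open>j\<close> on the axis and \<open>\<mu> j\<close> its inverse slope.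
\<close>

locale zone = line_arrangement +
  fixes X Y :: "point \<Rightarrow> real" and l :: "point set" and W :: "point set set"
    and \<xi> \<mu> \<alpha> :: "point set \<Rightarrow> real"
  assumes X_affine: "\<And>t p q. X ((1 - t) *\<^sub>R p + t *\<^sub>R q) = (1 - t) * X p + t * X q"
    and Y_affine: "\<And>t p q. Y ((1 - t) *\<^sub>R p + t *\<^sub>R q) = (1 - t) * Y p + t * Y q"
    and XY_inj: "\<And>p q. X p = X q \<Longrightarrow> Y p = Y q \<Longrightarrow> p = q"
    and l: "l \<in> R" "\<And>p. p \<in> l \<longleftrightarrow> Y p = 0" 
    and Y_side: "\<And>p q. 0 \<le> lf l p * lf l q \<longleftrightarrow> 0 \<le> Y p * Y q"
    and W: "W \<subseteq> R - {l}"
    and \<alpha>: "\<And>j. j \<in> W \<Longrightarrow> \<alpha> j \<noteq> 0"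
    and form: "\<And>j p. j \<in> W \<Longrightarrow> lf j p = \<alpha> j * (X p - \<xi> j - \<mu> j * Y p)"
begin

definition upper :: "point set \<Rightarrow> bool" where
  "upper Q \<longleftrightarrow> Q \<in> cells R \<and> (\<exists>x\<in>Q. 0 < Y x)"

text \<open>The line \<open>j\<close> carries an edge of the left chain of \<open>Q\<close>: it
  meets the axis to the left of a point where \<open>Q\<close> rests on the axis.\<close>

definition left_of :: "point set \<Rightarrow> point set \<Rightarrow> bool" where
  "left_of Q j \<longleftrightarrow> j \<in> W \<and> (\<exists>E. contact Q j E) \<and> (\<exists>B. contact Q l B \<and> \<xi> j < X B)"

definition offset :: "point set \<Rightarrow> point \<Rightarrow> real" where
  "offset j p = X p - \<xi> j - \<mu> j * Y p"

lemma offset_affine: "offset j ((1 - t) *\<^sub>R p + t *\<^sub>R q) = (1 - t) * offset j p + t * offset j q"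
  unfolding offset_def X_affine Y_affine by (simp add: algebra_simps)

lemma offset_zero: "j \<in> W \<Longrightarrow> p \<in> j \<longleftrightarrow> offset j p = 0"
proof -
  assume j: "j \<in> W"
  have "p \<in> j \<longleftrightarrow> lf j p = 0" by (rule mem_line_iff[OF line_R]) (use j W in blast)
  also have "\<dots> \<longleftrightarrow> \<alpha> j * offset j p = 0" using form[OF j] by (simp only: offset_def)
  finally show ?thesis using \<alpha>[OF j] by simp
qed

lemma offset_same_side:
  assumes "Q \<in> cells R" "j \<in> W" "z \<in> closure Q" "y \<in> closure Q" "0 < offset j y"
  shows "0 \<le> offset j z"
proof -
  have "0 \<le> lf j z * lf j y"
    by (rule closure_cell_same_side[OF assms(1)]) (use assms W in auto)
  then have "0 \<le> (\<alpha> j * \<alpha> j) * (offset j z * offset j y)"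
    using form[OF assms(2)] by (simp add: offset_def algebra_simps)
  moreover have "0 < \<alpha> j * \<alpha> j" using \<alpha>[OF assms(2)] by (auto simp: zero_less_mult_iff)
  ultimately show ?thesis using assms(5) by (simp add: zero_le_mult_iff)
qed

lemma left_of_side:
  assumes "Q \<in> cells R" "left_of Q j" "z \<in> closure Q"
  shows "0 \<le> offset j z"
proof -
  obtain B where B: "contact Q l B" "\<xi> j < X B" using assms by (auto simp: left_of_def)
  then have "Y B = 0" "B \<in> closure Q" using l by (auto simp: contact_def)
  then have "0 < offset j B" using B by (simp add: offset_def)
  then show ?thesis using offset_same_side[OF assms(1) _ assms(3)] \<open>B \<in> closure Q\<close> assms(2)
    by (auto simp: left_of_def)
qed

lemma upper_closure:
  assumes "upper Q" "z \<in> closure Q"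
  shows "0 \<le> Y z"
proof -
  obtain x where x: "x \<in> Q" "0 < Y x" "Q \<in> cells R" using assms by (auto simp: upper_def)
  have "0 \<le> lf l x * lf l z" by (rule closure_cell_side[OF x(3,1) assms(2) l(1)])
  then have "0 \<le> Y x * Y z" using Y_side by blast
  then show ?thesis using x by (simp add: zero_le_mult_iff)
qed

lemma contact_above:
  assumes "upper Q" "contact Q j E" "j \<in> W"
  shows "0 < Y E"
proof -
  have "E \<notin> l" using assms W l(1) by (auto simp: contact_def)
  then show ?thesis using upper_closure[OF assms(1)] assms(2) l(2) by (force simp: contact_def)
qed

lemma contact_offset:
  assumes "Q \<in> cells R" "left_of Q j" "contact Q i E" "i \<noteq> j"
  shows "0 < offset j E"
proof -
  have j: "j \<in> W" using assms by (auto simp: left_of_def)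
  then have "E \<notin> j" using assms W by (auto simp: contact_def)
  then show ?thesis using left_of_side[OF assms(1,2)] assms(3) offset_zero[OF j]
    by (force simp: contact_def)
qed

text \<open>Of two lines through the same point of the axis, the one with the larger inverse slope
  hides the other from \<open>Q\<close> everywhere above the axis.\<close>

lemma left_of_distinct_aux:
  assumes Q: "upper Q" and "left_of Q j" "left_of Q g" "\<xi> j = \<xi> g" "\<mu> j \<le> \<mu> g"
  shows "j = g"
proof (rule ccontr)
  assume ne: "j \<noteq> g"
  have c: "Q \<in> cells R" using Q by (simp add: upper_def)
  obtain E where E: "contact Q j E" using assms by (auto simp: left_of_def)
  have j: "j \<in> W" using assms by (auto simp: left_of_def)
  have "offset j E = 0" using E offset_zero[OF j] by (auto simp: contact_def)
  moreover have "0 < offset g E" using contact_offset[OF c assms(3) E ne] .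
  moreover have "0 \<le> (\<mu> g - \<mu> j) * Y E" using contact_above[OF Q E j] assms by simp
  ultimately show False using assms(4) by (simp add: offset_def algebra_simps)
qed

lemma left_of_distinct:
  assumes "upper Q" "left_of Q j" "left_of Q g" "\<xi> j = \<xi> g"
  shows "j = g"
  using left_of_distinct_aux[of Q j g] left_of_distinct_aux[of Q g j] assms
  by (cases "\<mu> j \<le> \<mu> g") auto

text \<open>
  If \<open>j\<close> is followed by \<open>g\<close> on the left chain of \<open>Q\<close>, then beyond \<open>Q\<close> it is cut off from the
  axis by \<open>Q\<close> and \<open>g\<close>: the segment from an edge on \<open>j\<close> further up to the axis would cross \<open>Q\<close>.
\<close>

lemma left_of_twice_aux:
  assumes Q: "upper Q" "upper Q'" and jg: "left_of Q j" "left_of Q g" "\<xi> g < \<xi> j"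
    and j': "left_of Q' j"
    and E: "contact Q j E" "contact Q' j E'" "Y E \<le> Y E'"
  shows "Q = Q'"
proof (rule ccontr)
  assume ne: "Q \<noteq> Q'"
  have c: "Q \<in> cells R" "Q' \<in> cells R" using Q by (auto simp: upper_def)
  have W': "j \<in> W" "g \<in> W" using jg by (auto simp: left_of_def)
  then have R': "j \<in> R" "g \<in> R" "j \<noteq> l" "g \<noteq> l" using W by auto
  have gj: "g \<noteq> j" using jg(3) by auto
  define d where "d = \<xi> j - \<xi> g"
  define \<kappa> where "\<kappa> = \<mu> g - \<mu> j"
  have rel: "offset j p - offset g p + d = \<kappa> * Y p" for p
    by (simp add: offset_def d_def \<kappa>_def algebra_simps)
  have d: "d > 0" using jg(3) by (simp add: d_def)
  obtain F where F: "contact Q g F" using jg by (auto simp: left_of_def)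
  obtain B' where B': "contact Q' l B'" using j' by (auto simp: left_of_def)
  have YB: "Y B' = 0" using B' l by (auto simp: contact_def)
  have sE: "offset j E = 0" "offset j E' = 0" using E offset_zero[OF W'(1)] by (auto simp: contact_def)
  have tF: "offset g F = 0" using F offset_zero[OF W'(2)] by (auto simp: contact_def)
  have tE: "0 < offset g E" using contact_offset[OF c(1) jg(2) E(1)] gj by auto
  have sF: "0 < offset j F" using contact_offset[OF c(1) jg(1) F gj] .
  have sB: "0 < offset j B'" using contact_offset[OF c(2) j' B'] R' by auto
  have tB: "offset g B' = offset j B' + d" using rel[of B'] YB by simp
  have YF: "0 < Y F" "0 < Y E" "0 < Y E'" using contact_above Q E F W' by blast+
  have "0 < \<kappa> * Y F" using rel[of F] sF tF d by simp
  then have \<kappa>: "0 < \<kappa>" using YF by (simp add: zero_less_mult_iff)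
  have "0 \<le> offset g E'"
    using offset_same_side[OF c(2) W'(2), of E' B'] B' E(2) tB sB d by (auto simp: contact_def)
  moreover have "E' \<notin> g" using E(2) R' gj by (auto simp: contact_def)
  ultimately have tE': "0 < offset g E'" using offset_zero[OF W'(2)] by force
  show False
  proof (cases "Y E = Y E'")
    case True
    have "X E = X E'" using sE True by (simp add: offset_def)
    then have EE: "E = E'" using XY_inj True by blast
    \<comment> \<open>Contacts on \<open>j\<close> at equal height coincide. The common point
      decides the side of every other line, and both cells lie to the right of
      \<open>j\<close>.\<close>
    have "Q = Q'"
    proof (rule cell_eqI_common_point[OF c])
      show "E \<in> closure Q" "E \<in> closure Q'" using E EE by (auto simp: contact_def)
      fix i assume i: "i \<in> R"
      show "0 < lf i E * lf i E \<or> (\<forall>x\<in>Q. \<forall>x'\<in>Q'. 0 < lf i x * lf i x')"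
      proof (cases "i = j")
        case False
        then have "lf i E \<noteq> 0" using E(1) i mem_line_iff[OF line_R[OF i]] by (auto simp: contact_def)
        then show ?thesis by (auto simp: zero_less_mult_iff)
      next
        case True
        have "0 < lf i x * lf i x'" if x: "x \<in> Q" "x' \<in> Q'" for x x'
        proof -
          have "0 \<le> offset j x" "0 \<le> offset j x'"
            using left_of_side[OF c(1) jg(1)] left_of_side[OF c(2) j'] x closure_subset by blast+
          then have "0 \<le> (\<alpha> j * \<alpha> j) * (offset j x * offset j x')"
            by (intro mult_nonneg_nonneg[of "_ * _" "_ * _"]) auto
          then have "0 \<le> lf i x * lf i x'"
            unfolding True form[OF W'(1)] by (simp add: offset_def algebra_simps)
          then show ?thesis using lf_cell_nonzero[OF c(1) x(1) i] lf_cell_nonzero[OF c(2) x(2) i]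
            by (auto simp: less_le)
        qed
        then show ?thesis by blast
      qed
    qed
    then show False using ne by blast
  next
    case False
    have eqE: "offset g E = d - \<kappa> * Y E" "offset g E' = d - \<kappa> * Y E'"
      using rel[of E] rel[of E'] sE by auto
    have tt: "offset g E' < offset g E" using eqE False E(3) \<kappa> by simp
    have tEd: "offset g E \<le> d" using eqE(1) YF \<kappa> by (simp add: mult_nonneg_nonneg)
    \<comment> \<open>The affine function that vanishes at \<open>E\<close> and \<open>F\<close>. It
      separates \<open>E'\<close> from \<open>B'\<close>, and \<open>z\<close> is where the segment
      between these two meets the line through \<open>E\<close> and \<open>F\<close>.\<close>
    define \<psi> where "\<psi> p = offset j p / offset j F + offset g p / offset g E - 1" for p
    have \<psi>E: "\<psi> E' < 0" using tt tE sE by (simp add: \<psi>_def)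
    have "1 \<le> offset g B' / offset g E" using tB sB tEd tE by simp
    moreover have "0 < offset j B' / offset j F" using sB sF by simp
    ultimately have \<psi>B: "0 < \<psi> B'" unfolding \<psi>_def by linarith
    define \<tau> where "\<tau> = \<psi> E' / (\<psi> E' - \<psi> B')"
    have \<tau>: "0 < \<tau>" "\<tau> < 1" using \<psi>E \<psi>B by (auto simp: \<tau>_def divide_simps)
    define z where "z = (1 - \<tau>) *\<^sub>R E' + \<tau> *\<^sub>R B'"
    have "\<psi> z = (1 - \<tau>) * \<psi> E' + \<tau> * \<psi> B'"
      unfolding \<psi>_def z_def offset_affine by (simp add: add_divide_distrib diff_divide_distrib algebra_simps)
    also have "\<dots> = \<psi> E' - \<tau> * (\<psi> E' - \<psi> B')" by (simp add: algebra_simps)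
    also have "\<dots> = 0" using \<psi>E \<psi>B by (simp add: \<tau>_def)
    finally have \<psi>z: "\<psi> z = 0" .
    have sz: "0 < offset j z" using \<tau> sB sE by (simp add: z_def offset_affine)
    have "0 < offset g B'" using tB sB d by simp
    then have tz: "0 < offset g z" using \<tau> tE' by (simp add: z_def offset_affine add_pos_pos)
    define \<theta> where "\<theta> = offset j z / offset j F"
    have \<theta>z: "offset g z / offset g E = 1 - \<theta>" using \<psi>z by (simp add: \<psi>_def \<theta>_def)
    have "0 < offset g z / offset g E" using tz tE by simp
    then have \<theta>: "0 < \<theta>" "\<theta> < 1" using sz sF \<theta>z by (auto simp: \<theta>_def)
    \<comment> \<open>A point of the segment from \<open>E\<close> to \<open>F\<close> with the same
      two offsets as \<open>z\<close>. Since \<open>\<kappa>\<close> is positive, the offsets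
      determine a point, so \<open>z\<close> lies in both cells.\<close>
    define y where "y = (1 - \<theta>) *\<^sub>R E + \<theta> *\<^sub>R F"
    have "offset j y = offset j z" using sE sF by (simp add: y_def offset_affine \<theta>_def)
    moreover have "offset g y = offset g z"
    proof -
      have "offset g y = (1 - \<theta>) * offset g E" using tF by (simp add: y_def offset_affine)
      also have "\<dots> = offset g z" unfolding \<theta>z[symmetric] using tE by simp
      finally show ?thesis .
    qed
    ultimately have "\<kappa> * Y y = \<kappa> * Y z" "offset j y = offset j z" using rel[of y] rel[of z] by auto
    then have "Y y = Y z" "X y = X z" using \<kappa> by (auto simp: offset_def)
    then have yz: "y = z" using XY_inj by blast
    have "E \<noteq> F" using E(1) F gj R' by (auto simp: contact_def)
    then have "y \<in> open_segment E F" using \<theta> by (auto simp: y_def in_segment)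
    moreover have "open_segment E F \<subseteq> Q"
      by (rule closure_cell_segment[OF c(1)]) (use E(1) F gj in \<open>auto simp: contact_def\<close>)
    ultimately have "y \<in> Q" by blast
    have "E' \<noteq> B'" using YF YB by auto
    then have "z \<in> open_segment E' B'" using \<tau> by (auto simp: z_def in_segment)
    moreover have "open_segment E' B' \<subseteq> Q'"
      by (rule closure_cell_segment[OF c(2)]) (use E(2) B' R' in \<open>auto simp: contact_def\<close>)
    ultimately have "z \<in> Q'" by blast
    then show False using \<open>y \<in> Q\<close> yz cells_disjoint[OF c] ne by blast
  qed
qed

lemma left_of_twice:
  assumes Q: "upper Q" "upper Q'" and jg: "left_of Q j" "left_of Q g" "\<xi> g < \<xi> j"
    and jg': "left_of Q' j" "left_of Q' g'" "\<xi> g' < \<xi> j"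
  shows "Q = Q'"
proof -
  obtain E E' where E: "contact Q j E" "contact Q' j E'" using jg(1) jg'(1) by (auto simp: left_of_def)
  show ?thesis
  proof (cases "Y E \<le> Y E'")
    case True
    then show ?thesis using left_of_twice_aux[OF Q jg jg'(1) E] by blast
  next
    case False
    then show ?thesis using left_of_twice_aux[OF Q(2,1) jg' jg(1) E(2,1)] by simp
  qed
qed

text \<open>A line with a further one to its left on the chain of the same cell occurs in this way
  in one cell only, which gives \<open>card R\<close>. What remains is at most one leftmost line for
  each cell touching the axis.\<close>

lemma card_left_of:
  "finite {(Q, j). upper Q \<and> left_of Q j}"
  "card {(Q, j). upper Q \<and> left_of Q j} \<le> card R + 2 * (card R + 1)"
proof -
  let ?S = "{(Q, j). upper Q \<and> left_of Q j}"
  define A where "A = {(Q, j) \<in> ?S. \<exists>g. left_of Q g \<and> \<xi> g < \<xi> j}"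
  define T where "T = {Q \<in> cells R. \<exists>E\<in>closure Q. E \<in> l \<and> (\<forall>i\<in>R - {l}. E \<notin> i)}"
  have T: "finite T" "card T \<le> 2 * (card R + 1)"
    using card_cells_touching[OF line_R[OF l(1)]] unfolding T_def by auto
  have A: "inj_on snd A" "snd ` A \<subseteq> R"
  proof (rule inj_onI)
    fix a b assume ab: "a \<in> A" "b \<in> A" "snd a = snd b"
    obtain Q Q' j where Q: "a = (Q, j)" "b = (Q', j)" using ab(3) by (metis prod.collapse)
    have "upper Q" "upper Q'" "left_of Q j" "left_of Q' j" using ab unfolding Q A_def by auto
    moreover obtain g g' where "left_of Q g" "\<xi> g < \<xi> j" "left_of Q' g'" "\<xi> g' < \<xi> j"
      using ab unfolding Q A_def by auto
    ultimately show "a = b" using left_of_twice[of Q Q' j g g'] unfolding Q by simp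
  qed (use W in \<open>auto simp: A_def left_of_def\<close>)
  have B: "inj_on fst (?S - A)" "fst ` (?S - A) \<subseteq> T"
  proof (rule inj_onI)
    fix a b assume ab: "a \<in> ?S - A" "b \<in> ?S - A" "fst a = fst b"
    obtain Q j j' where Q: "a = (Q, j)" "b = (Q, j')" using ab(3) by (metis prod.collapse)
    have "\<xi> j = \<xi> j'" using ab unfolding Q A_def by (auto simp: not_less intro: antisym)
    then show "a = b" using ab left_of_distinct[of Q j j'] unfolding Q by auto
  qed (auto simp: upper_def left_of_def contact_def T_def)
  have fA: "finite A" using A finite_R finite_subset finite_imageD by blast
  have fB: "finite (?S - A)" using B T finite_subset finite_imageD by blast
  have sub: "?S \<subseteq> A \<union> (?S - A)" by blast
  show "finite ?S" by (rule finite_subset[OF sub finite_UnI[OF fA fB]])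
  have "card ?S \<le> card (A \<union> (?S - A))" by (rule card_mono[OF finite_UnI[OF fA fB] sub])
  also have "\<dots> \<le> card A + card (?S - A)" by (rule card_Un_le)
  also have "\<dots> \<le> card R + 2 * (card R + 1)"
    using card_inj_on_le[OF A finite_R] card_inj_on_le[OF B T(1)] T(2) by linarith
  finally show "card ?S \<le> card R + 2 * (card R + 1)" .
qed

end

section \<open>From the zone of one line to the sum over all cells\<close>

context line_arrangement
begin

definition touching :: "point set \<Rightarrow> point set set" where
  "touching l = {Q \<in> cells R. \<exists>E\<in>closure Q. E \<in> l \<and> (\<forall>i\<in>R - {l}. E \<notin> i)}"

lemma touching_bounds: "is_line l \<Longrightarrow> finite (touching l)" "is_line l \<Longrightarrow> card (touching l) \<le> 2 * (card R + 1)"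
  using card_cells_touching[of l] by (auto simp: touching_def)

lemma edge_line_touching: "Q \<in> cells R \<Longrightarrow> l \<in> edge_lines Q \<Longrightarrow> Q \<in> touching l"
  by (auto simp: edge_lines_def touching_def contact_def)

text \<open>One of three parallel lines lies between the other two, and it would cut a cell with
  contacts on both of these.\<close>

lemma parallel_edge_line_unique:
  assumes Q: "Q \<in> cells R" and l: "l \<in> edge_lines Q" and j: "j \<in> edge_lines Q" "j \<noteq> l" "\<not> transv l j"
    and j': "j' \<in> edge_lines Q" "j' \<noteq> l" "\<not> transv l j'"
  shows "j = j'"
proof (rule ccontr)
  assume ne: "j \<noteq> j'"
  have R': "l \<in> R" "j \<in> R" "j' \<in> R" using assms by (auto simp: edge_lines_def)
  obtain B E E' where c: "contact Q l B" "contact Q j E" "contact Q j' E'"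
    using l j j' by (auto simp: edge_lines_def)
  obtain h b where h: "b \<noteq> 0" "\<And>p. lf j p = b * (lf l p - h)"
    using parallel_form[OF line_R[OF R'(1)] line_R[OF R'(2)] j(3)] by blast
  obtain h' b' where h': "b' \<noteq> 0" "\<And>p. lf j' p = b' * (lf l p - h')"
    using parallel_form[OF line_R[OF R'(1)] line_R[OF R'(3)] j'(3)] by blast
  have cl: "B \<in> closure Q" "E \<in> closure Q" "E' \<in> closure Q" using c by (auto simp: contact_def)
  have "lf l B = 0" using c(1) mem_line_iff[OF line_R[OF R'(1)]] by (auto simp: contact_def)
  have E: "lf j E = 0" "lf j' E \<noteq> 0" "lf l E \<noteq> 0"
    using c(2) ne j R' mem_line_iff line_R by (auto simp: contact_def)
  have E': "lf j' E' = 0" "lf j E' \<noteq> 0" "lf l E' \<noteq> 0"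
    using c(3) ne j' R' mem_line_iff line_R by (auto simp: contact_def)
  have "lf l E = h" "lf l E' = h'" using E(1) E'(1) h h' by auto
  have nn: "0 \<le> (b * b) * x \<Longrightarrow> b \<noteq> 0 \<Longrightarrow> 0 \<le> x" for b x :: real
    by (metis mult_pos_neg not_le not_real_square_gt_zero)
  have "0 \<le> lf j B * lf j E'" by (rule closure_cell_same_side[OF Q cl(1,3) R'(2)])
  then have "0 \<le> (b * b) * ((0 - h) * (h' - h))"
    using \<open>lf l B = 0\<close> \<open>lf l E' = h'\<close> h(2) by (simp add: algebra_simps)
  then have 1: "0 \<le> (0 - h) * (h' - h)" using h(1) by (rule nn)
  have "0 \<le> lf j' B * lf j' E" by (rule closure_cell_same_side[OF Q cl(1,2) R'(3)])
  then have "0 \<le> (b' * b') * ((0 - h') * (h - h'))"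
    using \<open>lf l B = 0\<close> \<open>lf l E = h\<close> h'(2) by (simp add: algebra_simps)
  then have 2: "0 \<le> (0 - h') * (h - h')" using h'(1) by (rule nn)
  have 3: "0 \<le> h * h'"
    using closure_cell_same_side[OF Q cl(2,3) R'(1)] \<open>lf l E = h\<close> \<open>lf l E' = h'\<close> by simp
  have 4: "h \<noteq> 0" "h' \<noteq> 0" "h \<noteq> h'"
    using E E' h h' \<open>lf l E = h\<close> \<open>lf l E' = h'\<close> by auto
  show False
    using 1 2 3 4 by (auto simp: zero_le_mult_iff mult_le_0_iff)
qed

text \<open>The signs \<open>\<rho>\<close> and \<open>\<sigma>\<close> reflect the picture in the
  two axes, so the analysis of the left chain above the axis covers all four cases.\<close>

lemma zone_instance:
  fixes \<rho> \<sigma> :: real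
  assumes l: "l \<in> R" and W: "W \<subseteq> R - {l}" and \<alpha>: "\<And>j. j \<in> W \<Longrightarrow> \<alpha> j \<noteq> 0"
    and form: "\<And>j p. j \<in> W \<Longrightarrow> lf j p = \<alpha> j * (along l p - \<xi> j - \<mu> j * lf l p)"
    and sgn: "\<rho> * \<rho> = 1" "\<sigma> * \<sigma> = 1"
  shows "zone R (\<lambda>p. \<rho> * along l p) (\<lambda>p. \<sigma> * lf l p) l W (\<lambda>j. \<rho> * \<xi> j) (\<lambda>j. \<rho> * \<sigma> * \<mu> j) (\<lambda>j. \<rho> * \<alpha> j)"
proof (rule zone.intro[OF line_arrangement_axioms zone_axioms.intro])
  have nz: "\<rho> \<noteq> 0" "\<sigma> \<noteq> 0" using sgn by auto
  show "\<rho> * along l ((1 - t) *\<^sub>R p + t *\<^sub>R q) = (1 - t) * (\<rho> * along l p) + t * (\<rho> * along l q)" for t p q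
    unfolding along_affine by (simp add: algebra_simps)
  show "\<sigma> * lf l ((1 - t) *\<^sub>R p + t *\<^sub>R q) = (1 - t) * (\<sigma> * lf l p) + t * (\<sigma> * lf l q)" for t p q
    unfolding lf_affine by (simp add: algebra_simps)
  show "p = q" if "\<rho> * along l p = \<rho> * along l q" "\<sigma> * lf l p = \<sigma> * lf l q" for p q
    using coords_eqI[OF line_R[OF l], of p q] that nz by simp
  show "l \<in> R" by fact
  show "p \<in> l \<longleftrightarrow> \<sigma> * lf l p = 0" for p using mem_line_iff[OF line_R[OF l]] nz by simp
  show "0 \<le> lf l p * lf l q \<longleftrightarrow> 0 \<le> \<sigma> * lf l p * (\<sigma> * lf l q)" for p q
  proof -
    have "\<sigma> * lf l p * (\<sigma> * lf l q) = (\<sigma> * \<sigma>) * (lf l p * lf l q)" by (simp add: algebra_simps)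
    then show ?thesis unfolding sgn(2) by (simp only: mult_1)
  qed
  show "W \<subseteq> R - {l}" by fact
  show "\<rho> * \<alpha> j \<noteq> 0" if "j \<in> W" for j using \<alpha>[OF that] nz by simp
  show "lf j p = \<rho> * \<alpha> j * (\<rho> * along l p - \<rho> * \<xi> j - \<rho> * \<sigma> * \<mu> j * (\<sigma> * lf l p))" if "j \<in> W" for j p
  proof -
    have "\<rho> * \<alpha> j * (\<rho> * along l p - \<rho> * \<xi> j - \<rho> * \<sigma> * \<mu> j * (\<sigma> * lf l p))
        = (\<rho> * \<rho>) * \<alpha> j * (along l p - \<xi> j - (\<sigma> * \<sigma>) * \<mu> j * lf l p)"
      by (simp add: algebra_simps)
    also have "\<dots> = \<alpha> j * (along l p - \<xi> j - \<mu> j * lf l p)"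
      by (simp only: sgn mult_1)
    finally show ?thesis by (rule trans[OF form[OF that] sym])
  qed
qed

lemma zone_complexity:
  assumes l: "l \<in> R"
  defines "Z \<equiv> {(Q, j). Q \<in> cells R \<and> l \<in> edge_lines Q \<and> j \<in> edge_lines Q}"
  shows "finite Z" "card Z \<le> 28 * card R"
proof -
  define W where "W = {j \<in> R - {l}. transv l j}"
  have "\<forall>j\<in>W. \<exists>\<xi> \<mu> \<alpha>. \<alpha> \<noteq> 0 \<and> (\<forall>p. lf j p = \<alpha> * (along l p - \<xi> - \<mu> * lf l p))"
    using transv_form[OF line_R[OF l]] by (auto simp: W_def)
  then obtain \<xi> \<mu> \<alpha> where form: "\<And>j. j \<in> W \<Longrightarrow> \<alpha> j \<noteq> 0"
      "\<And>j p. j \<in> W \<Longrightarrow> lf j p = \<alpha> j * (along l p - \<xi> j - \<mu> j * lf l p)"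
    by metis
  define S where "S \<rho> \<sigma> = {(Q, j). (Q \<in> cells R \<and> (\<exists>x\<in>Q. 0 < \<sigma> * lf l x)) \<and>
     (j \<in> W \<and> (\<exists>E. contact Q j E) \<and> (\<exists>B. contact Q l B \<and> \<rho> * \<xi> j < \<rho> * along l B))}" for \<rho> \<sigma> :: real
  have S: "finite (S \<rho> \<sigma>) \<and> card (S \<rho> \<sigma>) \<le> 3 * card R + 2" if "\<rho> * \<rho> = 1" "\<sigma> * \<sigma> = 1" for \<rho> \<sigma>
  proof -
    interpret z: zone R "\<lambda>p. \<rho> * along l p" "\<lambda>p. \<sigma> * lf l p" l W "\<lambda>j. \<rho> * \<xi> j" "\<lambda>j. \<rho> * \<sigma> * \<mu> j" "\<lambda>j. \<rho> * \<alpha> j"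
      by (rule zone_instance[OF l _ form that]) (auto simp: W_def)
    show ?thesis
      using z.card_left_of unfolding z.upper_def z.left_of_def S_def by simp
  qed
  have tl: "finite (touching l)" "card (touching l) \<le> 2 * (card R + 1)"
    using touching_bounds line_R[OF l] by auto
  define D where "D = {x \<in> Z. snd x = l}"
  define P where "P = {x \<in> Z. snd x \<noteq> l \<and> \<not> transv l (snd x)}"
  have fst_t: "fst x \<in> touching l" if "x \<in> Z" for x using that edge_line_touching by (auto simp: Z_def)
  have D: "inj_on fst D" "fst ` D \<subseteq> touching l"
    using fst_t by (auto simp: D_def inj_on_def prod_eq_iff)
  have P: "inj_on fst P" "fst ` P \<subseteq> touching l"
  proof (rule inj_onI)
    fix x y assume xy: "x \<in> P" "y \<in> P" "fst x = fst y"
    then show "x = y"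
      using parallel_edge_line_unique[of "fst x" l "snd x" "snd y"]
      by (auto simp: P_def Z_def)
  qed (use fst_t in \<open>auto simp: P_def\<close>)
  have fin: "finite D" "finite P"
    using finite_imageD[OF finite_subset[OF D(2) tl(1)] D(1)]
      finite_imageD[OF finite_subset[OF P(2) tl(1)] P(1)] .
  have sub: "Z \<subseteq> D \<union> (P \<union> (S 1 1 \<union> (S 1 (-1) \<union> (S (-1) 1 \<union> S (-1) (-1)))))"
  proof
    fix x assume x: "x \<in> Z"
    obtain Q j where Q: "x = (Q, j)" "Q \<in> cells R" "l \<in> edge_lines Q" "j \<in> edge_lines Q" using x by (auto simp: Z_def)
    show "x \<in> D \<union> (P \<union> (S 1 1 \<union> (S 1 (-1) \<union> (S (-1) 1 \<union> S (-1) (-1)))))"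
    proof (cases "j = l \<or> \<not> transv l j")
      case True
      then show ?thesis using x Q(1) by (auto simp: D_def P_def)
    next
      case False
      then have j: "j \<in> W" using Q by (auto simp: W_def edge_lines_def)
      obtain B E where BE: "contact Q l B" "contact Q j E" using Q by (auto simp: edge_lines_def)
      have jR: "j \<in> R" using j by (auto simp: W_def)
      have "lf j B \<noteq> 0" using BE(1) False jR mem_line_iff[OF line_R[OF jR]] by (auto simp: contact_def)
      moreover have "lf l B = 0" using BE(1) mem_line_iff[OF line_R[OF l]] by (auto simp: contact_def)
      ultimately have B: "\<xi> j < along l B \<or> \<xi> j > along l B" using form(2)[OF j, of B] by auto
      obtain y where y: "y \<in> Q" using cell_nonempty Q by blast
      then have "0 < lf l y \<or> 0 < - lf l y" using lf_cell_nonzero[OF Q(2) y l] by linarith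
      then show ?thesis using B BE j Q(1,2) y unfolding S_def by auto
    qed
  qed
  have SS: "finite (S 1 1)" "finite (S 1 (-1))" "finite (S (-1) 1)" "finite (S (-1) (-1))"
    "card (S 1 1) \<le> 3 * card R + 2" "card (S 1 (-1)) \<le> 3 * card R + 2"
    "card (S (-1) 1) \<le> 3 * card R + 2" "card (S (-1) (-1)) \<le> 3 * card R + 2"
    using S[of 1 1] S[of 1 "-1"] S[of "-1" 1] S[of "-1" "-1"] by auto
  have finU: "finite (D \<union> (P \<union> (S 1 1 \<union> (S 1 (-1) \<union> (S (-1) 1 \<union> S (-1) (-1))))))"
    using fin SS by (intro finite_UnI)
  show "finite Z" by (rule finite_subset[OF sub finU])
  have "card Z \<le> card (D \<union> (P \<union> (S 1 1 \<union> (S 1 (-1) \<union> (S (-1) 1 \<union> S (-1) (-1))))))"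
    by (rule card_mono[OF finU sub])
  \<comment> \<open>The pairs with \<open>j = l\<close> and those with \<open>j\<close> parallel to
    \<open>l\<close> contribute at most one per touching cell, the four reflected chains at most
    \<open>3 * card R + 2\<close> each. The total \<open>16 * card R + 12\<close> is at most
    \<open>28 * card R\<close> because \<open>R\<close> contains \<open>l\<close>.\<close>
  also have "\<dots> \<le> card D + (card P + (card (S 1 1) + (card (S 1 (-1)) + (card (S (-1) 1) + card (S (-1) (-1))))))"
    by (intro order.trans[OF card_Un_le] add_left_mono order.refl)
  also have "\<dots> \<le> 2 * (card R + 1) + (2 * (card R + 1) +
      ((3 * card R + 2) + ((3 * card R + 2) + ((3 * card R + 2) + (3 * card R + 2)))))"
    by (intro add_mono SS(5-8) order.trans[OF card_inj_on_le[OF D tl(1)] tl(2)]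
        order.trans[OF card_inj_on_le[OF P tl(1)] tl(2)])
  also have "\<dots> = 16 * card R + 12" by simp
  also have "\<dots> \<le> 28 * card R"
  proof -
    have "card R \<noteq> 0" using l finite_R by auto
    then show ?thesis by linarith
  qed
  finally show "card Z \<le> 28 * card R" .
qed

lemma finite_cells:
  assumes "R \<noteq> {}"
  shows "finite (cells R)"
proof (rule finite_subset)
  show "cells R \<subseteq> (\<Union>l\<in>R. touching l)"
    using edge_lines_nonempty[OF _ assms] edge_line_touching edge_lines_subset by blast
  show "finite (\<Union>l\<in>R. touching l)" using finite_R touching_bounds line_R by blast
qed

text \<open>The square counts ordered pairs of edge lines; fixing the first line leaves the
  complexity of its zone, which is linear in \<open>card R\<close>.\<close>

theorem sum_card_edge_lines_squared:
  assumes "R \<noteq> {}"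
  shows "(\<Sum>Q\<in>cells R. (card (edge_lines Q))\<^sup>2) \<le> 28 * (card R)\<^sup>2"
proof -
  define Z where "Z l = {(Q, j). Q \<in> cells R \<and> l \<in> edge_lines Q \<and> j \<in> edge_lines Q}" for l
  have Z: "finite (Z l)" "card (Z l) \<le> 28 * card R" if "l \<in> R" for l
    using zone_complexity[OF that] by (auto simp: Z_def)
  have "(\<Sum>Q\<in>cells R. (card (edge_lines Q))\<^sup>2) = (\<Sum>Q\<in>cells R. card (edge_lines Q \<times> edge_lines Q))"
    by (simp add: card_cartesian_product power2_eq_square)
  also have "\<dots> = card (SIGMA Q:cells R. edge_lines Q \<times> edge_lines Q)"
    using finite_cells[OF assms] finite_edge_lines by (subst card_SigmaI) auto
  also have "\<dots> \<le> card (SIGMA l:R. Z l)"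
  proof (rule card_le_of_image[of _ _ "\<lambda>(Q, l, j). (l, (Q, j))"])
    show "finite (SIGMA l:R. Z l)" using finite_R Z by blast
  qed (use edge_lines_subset in \<open>auto simp: Z_def\<close>)
  also have "\<dots> = (\<Sum>l\<in>R. card (Z l))" using finite_R Z by (subst card_SigmaI) auto
  also have "\<dots> \<le> (\<Sum>l\<in>R. 28 * card R)" using Z by (intro sum_mono) auto
  finally show ?thesis by (simp add: power2_eq_square algebra_simps)
qed

lemma card_cells_le:
  assumes "R \<noteq> {}"
  shows "card (cells R) \<le> 28 * (card R)\<^sup>2"
proof -
  have "(\<Sum>Q\<in>cells R. 1) \<le> (\<Sum>Q\<in>cells R. (card (edge_lines Q))\<^sup>2)"
    using edge_lines_nonempty[OF _ assms] finite_edge_lines by (intro sum_mono) (auto simp: Suc_le_eq card_gt_0_iff)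
  then show ?thesis using sum_card_edge_lines_squared[OF assms] by simp
qed

text \<open>At most \<open>card R\<close> points of \<open>l\<close> lie on another sample line, and
  \<open>f\<close> sends each to a single cell although many cells may meet there. All other points
  of \<open>l\<close> are assigned to cells that touch \<open>l\<close> away from the other
  lines.\<close>

lemma card_cells_assigned_on_line:
  assumes f: "cell_assignment R P f" and l: "is_line l"
  shows "card (f ` (P \<inter> l)) \<le> 3 * card R + 2" "finite (f ` (P \<inter> l))"
proof -
  define A where "A = {p \<in> P \<inter> l. \<exists>i\<in>R - {l}. p \<in> i}"
  have "\<forall>p\<in>A. \<exists>i. i \<in> R - {l} \<and> p \<in> i" by (auto simp: A_def)
  then obtain g where g: "\<And>p. p \<in> A \<Longrightarrow> g p \<in> R - {l} \<and> p \<in> g p" by metis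
  have inj: "inj_on g A"
  proof (rule inj_onI)
    fix p q assume pq: "p \<in> A" "q \<in> A" "g p = g q"
    show "p = q"
    proof (rule ccontr)
      assume "p \<noteq> q"
      then have "l = g p" using line_eqI[of l "g p" p q] l line_R g[OF pq(1)] g[OF pq(2)] pq
        by (auto simp: A_def)
      then show False using g[OF pq(1)] by simp
    qed
  qed
  have gR: "g ` A \<subseteq> R" using g by blast
  have A: "finite A" "card A \<le> card R"
    using finite_imageD[OF finite_subset[OF gR finite_R] inj] card_inj_on_le[OF inj gR finite_R] by auto
  have sub: "f ` (P \<inter> l) \<subseteq> f ` A \<union> touching l"
    using f by (fastforce simp: A_def touching_def cell_assignment_def)
  have fin: "finite (f ` A \<union> touching l)" using A touching_bounds[OF l] by simp
  show "finite (f ` (P \<inter> l))" by (rule finite_subset[OF sub fin])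
  have "card (f ` (P \<inter> l)) \<le> card (f ` A \<union> touching l)" by (rule card_mono[OF fin sub])
  also have "\<dots> \<le> card (f ` A) + card (touching l)" by (rule card_Un_le)
  also have "\<dots> \<le> card R + 2 * (card R + 1)"
    using card_image_le[OF A(1), of f] A(2) touching_bounds[OF l] by linarith
  finally show "card (f ` (P \<inter> l)) \<le> 3 * card R + 2" by simp
qed

end

section \<open>Lines crossing a cell of an acceptable sample\<close>

lemma coords_surj:
  assumes "is_line l"
  obtains p where "along l p = x" "lf l p = y"
proof -
  let ?n = "nrm l"
  have n: "?n \<bullet> ?n \<noteq> 0" using nrm_nonzero[OF assms] by simp
  define p where "p = (x / (?n \<bullet> ?n)) *\<^sub>R perp ?n + ((y + snd (line_eqn l)) / (?n \<bullet> ?n)) *\<^sub>R ?n"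
  have "along l p = x" "lf l p = y"
    using n by (simp_all add: p_def along_def lf_def inner_add_right perp_self)
  then show thesis using that by blast
qed

lemma transv_meets:
  assumes "is_line l" "is_line j" "transv l j"
  shows "\<exists>p. lf l p = h \<and> p \<in> j"
proof -
  obtain \<xi> \<mu> \<alpha> where "\<forall>p. lf j p = \<alpha> * (along l p - \<xi> - \<mu> * lf l p)"
    using transv_form[OF assms(1,3)] by blast
  moreover obtain p where "along l p = \<xi> + \<mu> * h" "lf l p = h" using coords_surj[OF assms(1)] by metis
  ultimately have "lf l p = h" "lf j p = 0" by auto
  then show ?thesis using mem_line_iff[OF assms(2)] by blast
qed

lemma lf_pencil:
  assumes "is_line l"
  shows "\<exists>A B. \<forall>z. lf m z = lf m p + A * (along l z - along l p) + B * (lf l z - lf l p)"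
proof -
  define A B where "A = (nrm m \<bullet> perp (nrm l)) / (nrm l \<bullet> nrm l)"
    and "B = (nrm m \<bullet> nrm l) / (nrm l \<bullet> nrm l)"
  have f: "lf m z = A * along l z + B * (lf l z + snd (line_eqn l)) - snd (line_eqn m)" for z
    using lf_in_coords[OF assms] unfolding A_def B_def by blast
  have "lf m z = lf m p + A * (along l z - along l p) + B * (lf l z - lf l p)" for z
    unfolding f[of z] f[of p] by (simp add: algebra_simps)
  then show ?thesis by blast
qed

text \<open>Elements with at most \<open>K\<close> members above them all lie above the lowest of
  their kind, so there are at most \<open>K\<close> of them; likewise from below.\<close>

lemma card_le_of_top_or_bottom:
  fixes \<tau> :: "'a \<Rightarrow> real"
  assumes "finite S" "\<And>l. l \<in> S \<Longrightarrow> card {m \<in> S. \<tau> l \<le> \<tau> m} \<le> K \<or> card {m \<in> S. \<tau> m \<le> \<tau> l} \<le> K"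
  shows "card S \<le> 2 * K"
proof -
  define A where "A = {l \<in> S. card {m \<in> S. \<tau> l \<le> \<tau> m} \<le> K}"
  define B where "B = {l \<in> S. card {m \<in> S. \<tau> m \<le> \<tau> l} \<le> K}"
  have fin: "finite A" "finite B" using assms(1) by (auto simp: A_def B_def)
  have "card A \<le> K"
  proof (cases "A = {}")
    case False
    then obtain l where l: "l \<in> A" "\<And>m. m \<in> A \<Longrightarrow> \<tau> l \<le> \<tau> m"
      using ex_is_arg_min_if_finite[OF fin(1), of \<tau>] by (auto simp: is_arg_min_linorder)
    have "card A \<le> card {m \<in> S. \<tau> l \<le> \<tau> m}"
      using assms(1) l(2) by (intro card_mono) (auto simp: A_def)
    then show ?thesis using l(1) by (auto simp: A_def)
  qed simp
  moreover have "card B \<le> K"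
  proof (cases "B = {}")
    case False
    then obtain l where l: "l \<in> B" "\<And>m. m \<in> B \<Longrightarrow> - \<tau> l \<le> - \<tau> m"
      using ex_is_arg_min_if_finite[OF fin(2), of "\<lambda>m. - \<tau> m"] by (auto simp: is_arg_min_linorder)
    have "card B \<le> card {m \<in> S. \<tau> m \<le> \<tau> l}"
      using assms(1) l(2) by (intro card_mono) (auto simp: B_def)
    then show ?thesis using l(1) by (auto simp: B_def)
  qed simp
  moreover have "S = A \<union> B" using assms(2) by (auto simp: A_def B_def)
  then have "card S \<le> card A + card B" using card_Un_le by metis
  ultimately show ?thesis by simp
qed

lemma line_coord_eq:
  assumes "is_line m" "m \<noteq> l" "is_line l" "l = range (\<lambda>t. a + t *\<^sub>R u)" "u \<noteq> 0" "x \<in> m" "x \<in> l"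
  shows "a + line_coord a u m *\<^sub>R u = x"
proof -
  obtain t where t: "x = a + t *\<^sub>R u" using assms by auto
  have "line_coord a u m = t"
    unfolding line_coord_def
  proof (rule the_equality)
    show "a + t *\<^sub>R u \<in> m" using t assms by simp
    fix s assume s: "a + s *\<^sub>R u \<in> m"
    then have "a + s *\<^sub>R u = a + t *\<^sub>R u"
      using line_eqI[OF assms(1,3), of "a + s *\<^sub>R u" x] assms t by blast
    then show "s = t" using assms(5) by simp
  qed
  then show ?thesis using t by simp
qed

text \<open>If more than \<open>K\<close> lines met \<open>S\<close>, the first and the last of them
  in the ordering would be at least \<open>K\<close> places apart, with a sample line listed after
  the first and no later than the last. Its position lies between theirs, hence in \<open>S\<close>.
  Ties of concurrent lines are harmless, as only positions matter.\<close>

lemma acceptable_gap: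
  assumes acc: "acceptable_along K L R l" and L: "finite L" "\<And>m. m \<in> L \<Longrightarrow> is_line m" and l: "l \<in> L"
    and S: "S \<subseteq> l" "convex S" "\<And>m. m \<in> R - {l} \<Longrightarrow> m \<inter> S = {}"
  shows "card {m \<in> L - {l}. m \<inter> S \<noteq> {}} \<le> K"
proof (rule ccontr)
  assume big': "\<not> ?thesis"
  define M where "M = {m \<in> L - {l}. m \<inter> S \<noteq> {}}"
  have big: "K < card M" using big' by (simp add: M_def)
  obtain a u xs where u: "u \<noteq> 0" "l = range (\<lambda>t. a + t *\<^sub>R u)"
    and ord: "ordering_by (line_coord a u) {m \<in> L - {l}. m \<inter> l \<noteq> {}} xs"
    and window: "\<And>i. i + K < length xs \<Longrightarrow> \<exists>j. i < j \<and> j \<le> i + K \<and> xs ! j \<in> R"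
    using acc unfolding acceptable_along_def by blast
  let ?pos = "line_coord a u"
  have xs: "distinct xs" "set xs = {m \<in> L - {l}. m \<inter> l \<noteq> {}}" "sorted (map ?pos xs)"
    using ord by (auto simp: ordering_by_def)
  have M: "a + ?pos m *\<^sub>R u \<in> S" "m \<in> set xs" if mM: "m \<in> M" for m
  proof -
    obtain x where x: "x \<in> m" "x \<in> S" using mM by (auto simp: M_def)
    have "a + ?pos m *\<^sub>R u = x"
      using line_coord_eq[of m l a u x] mM x S(1) L(2) l u by (auto simp: M_def)
    then show "a + ?pos m *\<^sub>R u \<in> S" using x by simp
    show "m \<in> set xs" using mM S(1) xs(2) by (auto simp: M_def)
  qed
  define I where "I = {i. i < length xs \<and> xs ! i \<in> M}"
  have finI: "finite I" by (simp add: I_def)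
  have "M \<subseteq> (\<lambda>i. xs ! i) ` I" using M(2) by (fastforce simp: I_def in_set_conv_nth)
  then have "card M \<le> card I" using finI by (rule surj_card_le[rotated])
  then have cI: "K < card I" using big by simp
  then have neI: "I \<noteq> {}" by auto
  define i0 i1 where "i0 = Min I" and "i1 = Max I"
  have i: "i0 \<in> I" "i1 \<in> I" using finI neI by (auto simp: i0_def i1_def)
  have "I \<subseteq> {i0..i1}" using finI by (auto simp: i0_def i1_def)
  then have "card I \<le> card {i0..i1}" by (rule card_mono[rotated]) simp
  then have "i0 + K \<le> i1" using cI by simp
  moreover have i1: "i1 < length xs" using i by (simp add: I_def)
  ultimately obtain j where j: "i0 < j" "j \<le> i1" "xs ! j \<in> R" using window[of i0] by fastforce
  have t: "?pos (xs ! i0) \<le> ?pos (xs ! j)" "?pos (xs ! j) \<le> ?pos (xs ! i1)"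
    using sorted_nth_mono[OF xs(3), of i0 j] sorted_nth_mono[OF xs(3), of j i1] j i1 by auto
  have ends: "a + ?pos (xs ! i0) *\<^sub>R u \<in> S" "a + ?pos (xs ! i1) *\<^sub>R u \<in> S"
    using M(1) i by (auto simp: I_def)
  have "a + ?pos (xs ! j) *\<^sub>R u \<in> S"
  proof (cases "?pos (xs ! i0) = ?pos (xs ! i1)")
    case True
    then show ?thesis using t ends by auto
  next
    case False
    define s0 s1 s where "s0 = ?pos (xs ! i0)" and "s1 = ?pos (xs ! i1)" and "s = ?pos (xs ! j)"
    define \<theta> where "\<theta> = (s - s0) / (s1 - s0)"
    have lt: "s0 < s1" using False t by (simp add: s0_def s1_def)
    then have \<theta>: "0 \<le> \<theta>" "\<theta> \<le> 1" using t by (auto simp: \<theta>_def s0_def s1_def s_def)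
    have "\<theta> * (s1 - s0) = s - s0" using lt by (simp add: \<theta>_def)
    then have seq: "s = (1 - \<theta>) * s0 + \<theta> * s1" by (simp add: algebra_simps)
    have "a + s *\<^sub>R u = (1 - \<theta>) *\<^sub>R (a + s0 *\<^sub>R u) + \<theta> *\<^sub>R (a + s1 *\<^sub>R u)"
      unfolding seq by (simp add: algebra_simps)
    moreover have "(1 - \<theta>) *\<^sub>R (a + s0 *\<^sub>R u) + \<theta> *\<^sub>R (a + s1 *\<^sub>R u) \<in> S"
      using ends \<theta> unfolding s0_def s1_def by (intro convexD_alt[OF S(2)])
    ultimately show ?thesis by (simp add: s_def)
  qed
  moreover have "xs ! j \<in> set xs" using j i1 by simp
  then have "xs ! j \<in> R - {l}" "a + ?pos (xs ! j) *\<^sub>R u \<in> xs ! j"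
  proof -
    assume "xs ! j \<in> set xs"
    then obtain x where x: "xs ! j \<in> L - {l}" "x \<in> xs ! j" "x \<in> l" using xs(2) by auto
    then show "xs ! j \<in> R - {l}" using j by blast
    have "a + ?pos (xs ! j) *\<^sub>R u = x"
      using line_coord_eq[of "xs ! j" l a u x] x L(2) l u by auto
    then show "a + ?pos (xs ! j) *\<^sub>R u \<in> xs ! j" using x by simp
  qed
  ultimately show False using S(3) by blast
qed

text \<open>Windows in an ordering need an integer length, while the condition on segments uses the
  real bound; hence \<open>K\<close> beside \<open>\<kappa>\<close>, later the ceiling of
  \<open>K0\<close> and \<open>K0\<close> itself.\<close>

locale acceptable_sample = line_arrangement +
  fixes L :: "point set set" and K :: nat and \<kappa> :: real
  assumes finite_L: "finite L" and line_L: "\<And>l. l \<in> L \<Longrightarrow> is_line l"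
    and R_subset: "R \<subseteq> L" and R_nonempty: "R \<noteq> {}" and K_pos: "1 \<le> K" and \<kappa>_le: "\<kappa> \<le> real K"
    and sample_along: "\<And>l. l \<in> L \<Longrightarrow> acceptable_along K L R l"
    and sample_between: "\<And>p q. p \<in> intersection_points L \<Longrightarrow> q \<in> intersection_points L \<Longrightarrow>
      \<kappa> \<le> real (card {l \<in> L. l \<inter> open_segment p q \<noteq> {}}) \<Longrightarrow> \<exists>l\<in>R. l \<inter> open_segment p q \<noteq> {}"
begin

lemma card_crossing_in_cell:
  assumes "Q \<in> cells R" "l \<in> L"
  shows "card {m \<in> L - {l}. m \<inter> (l \<inter> Q) \<noteq> {}} \<le> K"
proof (rule acceptable_gap[OF sample_along[OF assms(2)] finite_L line_L assms(2)])
  show "convex (l \<inter> Q)"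
    using convex_line[OF line_L[OF assms(2)]] cell_convex[OF assms(1)] by (rule convex_Int)
  show "m \<inter> (l \<inter> Q) = {}" if "m \<in> R - {l}" for m
    using cell_avoids[OF assms(1)] that by blast
  show "l \<inter> Q \<subseteq> l" by (rule Int_lower1)
qed

lemma card_crossing_edge:
  assumes Q: "Q \<in> cells R" and j: "j \<in> R"
  shows "card {m \<in> L - {j}. \<exists>E\<in>m. contact Q j E} \<le> K"
proof -
  have jL: "j \<in> L" using j R_subset by blast
  have "card {m \<in> L - {j}. m \<inter> {E. contact Q j E} \<noteq> {}} \<le> K"
  proof (rule acceptable_gap[OF sample_along[OF jL] finite_L line_L jL])
    show "convex {E. contact Q j E}"
      unfolding convex_contains_open_segment
    proof (intro ballI subsetI)
      fix x y z assume "x \<in> {E. contact Q j E}" "y \<in> {E. contact Q j E}" "z \<in> open_segment x y"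
      then show "z \<in> {E. contact Q j E}"
        using edge_interior_contact[OF Q j, of x y z] by (simp add: contact_def)
    qed
    show "{E. contact Q j E} \<subseteq> j" by (auto simp: contact_def)
    show "m \<inter> {E. contact Q j E} = {}" if "m \<in> R - {j}" for m
      using that by (auto simp: contact_def)
  qed
  moreover have "{m \<in> L - {j}. m \<inter> {E. contact Q j E} \<noteq> {}} = {m \<in> L - {j}. \<exists>E\<in>m. contact Q j E}"
    by blast
  ultimately show ?thesis by simp
qed

text \<open>A line containing a point of \<open>Q\<close> with at least two lines through it is of
  this kind. Without the second line there is no bound in terms of \<open>K\<close>: a strip may
  contain arbitrarily many parallel lines.\<close>

definition crossed :: "point set \<Rightarrow> point set set" where
  "crossed Q = {l \<in> L. \<exists>z\<in>l \<inter> Q. \<exists>l'\<in>L. l' \<noteq> l \<and> z \<in> l'}"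

definition through_edge :: "point set \<Rightarrow> point set set" where
  "through_edge Q = (\<Union>j\<in>edge_lines Q. {m \<in> L - {j}. \<exists>E\<in>m. contact Q j E})"

lemma crossed_not_R: "Q \<in> cells R \<Longrightarrow> l \<in> crossed Q \<Longrightarrow> l \<notin> R"
  using cell_avoids by (auto simp: crossed_def)

lemma card_through_edge:
  assumes "Q \<in> cells R"
  shows "card (through_edge Q) \<le> card (edge_lines Q) * K"
proof -
  have "card (through_edge Q) \<le> (\<Sum>j\<in>edge_lines Q. card {m \<in> L - {j}. \<exists>E\<in>m. contact Q j E})"
    unfolding through_edge_def by (rule card_UN_le[OF finite_edge_lines])
  also have "\<dots> \<le> (\<Sum>j\<in>edge_lines Q. K)"
    using card_crossing_edge[OF assms] edge_lines_subset by (intro sum_mono) blast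
  finally show ?thesis by simp
qed

lemma not_through_edge:
  assumes "Q \<in> cells R" "l \<in> crossed Q" "l \<notin> through_edge Q" "y \<in> l" "j \<in> R"
  shows "\<not> contact Q j y"
proof
  assume c: "contact Q j y"
  have "l \<noteq> j" using crossed_not_R[OF assms(1,2)] assms(5) by blast
  then have "l \<in> through_edge Q"
    using c assms by (auto simp: through_edge_def edge_lines_def crossed_def)
  then show False using assms(3) by blast
qed

lemma frontier_cell: "Q \<in> cells R \<Longrightarrow> frontier Q = closure Q - Q"
  by (simp add: cell_open frontier_def interior_open)

text \<open>
  Rays from a vertex \<open>p\<close> into \<open>Q\<close> are compared by the slope \<open>T\<close> in the coordinates of a line
  \<open>i\<close> of the arrangement through \<open>p\<close>; the function \<open>H\<close> is positive on the side of \<open>Q\<close>.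
\<close>

lemma card_vertex_vertex_lines:
  assumes Q: "Q \<in> cells R" and p: "p \<in> vertices Q"
  shows "card {l \<in> crossed Q - through_edge Q. p \<in> l \<and> (\<exists>q\<in>vertices Q. q \<noteq> p \<and> q \<in> l)} \<le> K + 2"
proof (rule ccontr)
  define S where "S = {l \<in> crossed Q - through_edge Q. p \<in> l \<and> (\<exists>q\<in>vertices Q. q \<noteq> p \<and> q \<in> l)}"
  assume "\<not> ?thesis"
  then have big: "K + 2 < card S" by (simp add: S_def)
  have SL: "S \<subseteq> L" by (auto simp: S_def crossed_def)
  then have finS: "finite S" using finite_L finite_subset by blast
  have "\<forall>l\<in>S. \<exists>q\<in>vertices Q. q \<noteq> p \<and> q \<in> l" by (auto simp: S_def)
  then obtain q where q: "\<And>l. l \<in> S \<Longrightarrow> q l \<in> vertices Q \<and> q l \<noteq> p \<and> q l \<in> l" by metis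
  obtain i where i: "i \<in> R" "p \<in> i" using p by (auto simp: vertices_def)
  obtain x where x: "x \<in> Q" using cell_nonempty[OF Q] by blast
  define H where "H z = lf i x * lf i z" for z
  define T where "T z = (along i z - along i p) / H z" for z
  have ip: "lf i p = 0" using i mem_line_iff[OF line_R] by blast
  have nx: "lf i x \<noteq> 0" using lf_cell_nonzero[OF Q x i(1)] .
  have pl: "p \<in> l" "is_line l" "l \<noteq> i" "q l \<in> closure Q" if "l \<in> S" for l
  proof -
    show "p \<in> l" using that by (simp add: S_def)
    show "is_line l" using that SL line_L by blast
    show "l \<noteq> i" using that crossed_not_R[OF Q, of l] i(1) by (auto simp: S_def)
    show "q l \<in> closure Q" using q[OF that] by (simp add: vertices_def)
  qed
  have Hq: "0 < H (q l)" if l: "l \<in> S" for l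
  proof -
    have "0 \<le> H (q l)" unfolding H_def
      by (rule closure_cell_side[OF Q x _ i(1)]) (use q[OF l] in \<open>auto simp: vertices_def\<close>)
    moreover have "lf i (q l) \<noteq> 0"
      using line_eqI[of l i p "q l"] q[OF l] pl[OF l] i line_R mem_line_iff[OF line_R[OF i(1)]] by metis
    ultimately show ?thesis using nx by (auto simp: H_def less_le)
  qed
  \<comment> \<open>In the pencil at \<open>p\<close>, the side of \<open>l\<close> on which
    \<open>q m\<close> lies depends only on the comparison of the two slopes, since \<open>H\<close>
    is positive and \<open>A\<close> is fixed.\<close>
  have slope: "\<exists>A. \<forall>m\<in>S. lf l (q m) = A * (H (q m) * (T (q m) - T (q l)))" if l: "l \<in> S" for l
  proof -
    obtain A B where AB: "\<And>z. lf l z = lf l p + A * (along i z - along i p) + B * (lf i z - lf i p)"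
      using lf_pencil[OF line_R[OF i(1)], of l p] by blast
    have "lf l p = 0" using pl[OF l] mem_line_iff by blast
    then have form: "lf l z = A * (along i z - along i p) + (B / lf i x) * H z" for z
      using AB[of z] ip nx by (simp add: H_def)
    have form': "lf l (q m) = H (q m) * (A * T (q m) + B / lf i x)" if "m \<in> S" for m
    proof -
      have "H (q m) * T (q m) = along i (q m) - along i p" using Hq[OF that] by (simp add: T_def)
      then have e: "A * (along i (q m) - along i p) = H (q m) * (A * T (q m))" by (metis mult.left_commute)
      show ?thesis
        unfolding form[of "q m"] e by (simp only: distrib_left mult.commute[of "B / lf i x"])
    qed
    have "lf l (q l) = 0" using q[OF l] pl[OF l] mem_line_iff by blast
    then have "A * T (q l) + B / lf i x = 0" using form'[OF l] Hq[OF l] by simp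
    then have "B / lf i x = - A * T (q l)" by simp
    then have "lf l (q m) = A * (H (q m) * (T (q m) - T (q l)))" if "m \<in> S" for m
      using form'[OF that] by (simp add: algebra_simps)
    then show ?thesis by blast
  qed
  have off: "lf l (q m) \<noteq> 0" if "l \<in> S" "m \<in> S" "l \<noteq> m" for l m
    using line_eqI[of l m p "q m"] q[OF that(2)] pl[OF that(1)] pl[OF that(2)] that(3) mem_line_iff by metis
  have T_inj: "T (q l) \<noteq> T (q m)" if "l \<in> S" "m \<in> S" "l \<noteq> m" for l m
    using off[OF that] slope[OF that(1)] that(2) by fastforce
  have "S \<noteq> {}" using big by auto
  obtain l1 where l1: "l1 \<in> S" "\<And>m. m \<in> S \<Longrightarrow> T (q l1) \<le> T (q m)"
    using ex_is_arg_min_if_finite[OF finS \<open>S \<noteq> {}\<close>, of "\<lambda>m. T (q m)"] by (auto simp: is_arg_min_linorder)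
  obtain l2 where l2: "l2 \<in> S" "\<And>m. m \<in> S \<Longrightarrow> - T (q l2) \<le> - T (q m)"
    using ex_is_arg_min_if_finite[OF finS \<open>S \<noteq> {}\<close>, of "\<lambda>m. - T (q m)"] by (auto simp: is_arg_min_linorder)
  \<comment> \<open>A line of intermediate slope separates the far vertices of the two extreme
    lines, so it meets the open segment between them. Setting the extreme lines aside accounts for
    the 2 in \<open>K + 2\<close>.\<close>
  have cut: "\<exists>y. y \<in> l \<and> y \<in> open_segment (q l1) (q l2)" if l: "l \<in> S - {l1, l2}" for l
  proof -
    have lS: "l \<in> S" using l by blast
    obtain A where A: "\<And>m. m \<in> S \<Longrightarrow> lf l (q m) = A * (H (q m) * (T (q m) - T (q l)))"
      using slope[OF lS] by blast
    have "T (q l1) < T (q l)" "T (q l) < T (q l2)"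
      using l1 l2 l T_inj[OF l1(1) lS] T_inj[OF l2(1) lS] by (force simp: less_le)+
    then have neg: "H (q l1) * (T (q l1) - T (q l)) < 0" "0 < H (q l2) * (T (q l2) - T (q l))"
      using Hq l1(1) l2(1) by (auto simp: mult_less_0_iff)
    define a b where "a = lf l (q l1)" and "b = lf l (q l2)"
    have ab: "a * b < 0"
    proof -
      have "a * b = (A * A) * ((H (q l1) * (T (q l1) - T (q l))) * (H (q l2) * (T (q l2) - T (q l))))"
        unfolding a_def b_def A[OF l1(1)] A[OF l2(1)] by (simp only: mult_ac)
      moreover have "A \<noteq> 0" using off[OF lS l1(1)] A[OF l1(1)] l by auto
      then have "0 < A * A" by (auto simp: zero_less_mult_iff linorder_neq_iff)
      moreover have "(H (q l1) * (T (q l1) - T (q l))) * (H (q l2) * (T (q l2) - T (q l))) < 0"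
        using neg by (rule mult_neg_pos)
      ultimately show ?thesis by (simp add: mult_pos_neg)
    qed
    then have ab': "a - b \<noteq> 0" by (auto simp: mult_less_0_iff)
    define t where "t = a / (a - b)"
    have t: "0 < t" "t < 1" using ab by (auto simp: t_def mult_less_0_iff divide_simps)
    have "lf l ((1 - t) *\<^sub>R q l1 + t *\<^sub>R q l2) = a - t * (a - b)"
      by (simp only: lf_affine a_def b_def) (simp add: algebra_simps)
    also have "\<dots> = 0" using ab' by (simp add: t_def)
    finally have "(1 - t) *\<^sub>R q l1 + t *\<^sub>R q l2 \<in> l" using mem_line_iff pl[OF lS] by blast
    moreover have "q l1 \<noteq> q l2" using ab by (auto simp: a_def b_def mult_less_0_iff)
    then have "(1 - t) *\<^sub>R q l1 + t *\<^sub>R q l2 \<in> open_segment (q l1) (q l2)"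
      using t by (auto simp: in_segment)
    ultimately show ?thesis by blast
  qed
  have c: "K < card (S - {l1, l2})"
    using big card_Diff_subset[of "{l1, l2}" S] l1(1) l2(1) card_insert_le_m1[of 2 "{l2}" l1]
    by (auto simp: card_insert_if split: if_splits)
  have "card (S - {l1, l2}) \<le> card {l \<in> L. l \<inter> open_segment (q l1) (q l2) \<noteq> {}}"
    using finite_L cut SL by (intro card_mono) auto
  then have "\<kappa> \<le> real (card {l \<in> L. l \<inter> open_segment (q l1) (q l2) \<noteq> {}})"
    using c \<kappa>_le by linarith
  moreover have "vertices Q \<subseteq> intersection_points L"
    using R_subset by (auto simp: vertices_def intersection_points_def)
  ultimately obtain k y where y: "k \<in> R" "y \<in> k" "y \<in> open_segment (q l1) (q l2)"
    using sample_between[of "q l1" "q l2"] q[OF l1(1)] q[OF l2(1)] by blast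
  show False
  \<comment> \<open>A segment inside \<open>Q\<close> cannot meet a sample line. If it runs along a
    sample line instead, an intermediate line passes through a contact there, although the lines of
    \<open>S\<close> were taken outside \<open>through_edge Q\<close>.\<close>
  proof (cases "\<exists>j\<in>R. q l1 \<in> j \<and> q l2 \<in> j")
    case False
    then have "open_segment (q l1) (q l2) \<subseteq> Q"
      by (intro closure_cell_segment[OF Q]) (use pl l1(1) l2(1) in blast)+
    then show False using y cell_avoids[OF Q] by blast
  next
    case True
    then obtain j where j: "j \<in> R" "q l1 \<in> j" "q l2 \<in> j" by blast
    obtain l where l: "l \<in> S - {l1, l2}" using c by (metis card.empty equals0I not_less0)
    then obtain w where w: "w \<in> l" "w \<in> open_segment (q l1) (q l2)" using cut by blast
    have "contact Q j w"
      by (rule edge_interior_contact[OF Q j(1,2) _ j(3) _ w(2)]) (use pl l1(1) l2(1) in blast)+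
    then show False using not_through_edge[OF Q _ _ w(1) j(1)] l by (auto simp: S_def)
  qed
qed

text \<open>Along \<open>m\<close> the cell can be left only at \<open>p\<close>, and the ray from
  \<open>p\<close> through \<open>z\<close> does not return there.\<close>

lemma ray_in_cell:
  assumes Q: "Q \<in> cells R" and m: "is_line m" "m \<inter> (closure Q - Q) = {p}" "z \<in> m" "z \<in> Q" and s: "0 < s"
  shows "p + s *\<^sub>R (z - p) \<in> Q"
proof (rule ccontr)
  let ?w = "p + s *\<^sub>R (z - p)"
  assume "?w \<notin> Q"
  have pm: "p \<in> m" "p \<noteq> z" using m by auto
  have "?w \<in> m" using line_translate_mem[OF m(1) pm(1) m(3)] .
  have "closed_segment z ?w \<inter> frontier Q \<noteq> {}"
    using \<open>?w \<notin> Q\<close> m(4) by (intro connected_Int_frontier) auto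
  then obtain y where y: "y \<in> closed_segment z ?w" "y \<in> closure Q - Q" using frontier_cell[OF Q] by blast
  then obtain t where t: "0 \<le> t" "t \<le> 1" "y = (1 - t) *\<^sub>R z + t *\<^sub>R ?w" by (auto simp: in_segment)
  then have "y \<in> m" using line_combination[OF m(1,3) \<open>?w \<in> m\<close>] by simp
  then have "y = p" using y m(2) by blast
  moreover have "y - p = ((1 - t) + t * s) *\<^sub>R (z - p)" unfolding t(3) by (simp add: algebra_simps)
  moreover have "(1 - t) + t * s \<noteq> 0"
    using t s by (smt (verit, best) mult_nonneg_nonneg mult_pos_pos)
  ultimately show False using pm by simp
qed

text \<open>These lines run from \<open>p\<close> to infinity inside \<open>Q\<close>. A second line
  that meets one of them, \<open>l\<close>, inside \<open>Q\<close> misses \<open>p\<close>; it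
  meets inside \<open>Q\<close> all rays whose slope is at least that of \<open>l\<close>, or all
  those whose slope is at most that. By \<open>card_crossing_in_cell\<close> these are at most
  \<open>K\<close>.\<close>

lemma card_vertex_infinity_lines:
  assumes Q: "Q \<in> cells R" and p: "p \<in> vertices Q"
  shows "card {l \<in> crossed Q. l \<inter> (closure Q - Q) = {p}} \<le> 2 * K"
proof -
  define S where "S = {l \<in> crossed Q. l \<inter> (closure Q - Q) = {p}}"
  have SL: "S \<subseteq> L" by (auto simp: S_def crossed_def)
  then have finS: "finite S" using finite_L finite_subset by blast
  have "\<forall>l\<in>S. \<exists>z l'. z \<in> l \<and> z \<in> Q \<and> l' \<in> L \<and> l' \<noteq> l \<and> z \<in> l'" by (auto simp: S_def crossed_def)
  then obtain z l' where z: "\<And>l. l \<in> S \<Longrightarrow> z l \<in> l \<and> z l \<in> Q \<and> l' l \<in> L \<and> l' l \<noteq> l \<and> z l \<in> l' l"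
    by metis
  obtain i where i: "i \<in> R" "p \<in> i" using p by (auto simp: vertices_def)
  obtain x where x: "x \<in> Q" using cell_nonempty[OF Q] by blast
  define H where "H z = lf i x * lf i z" for z
  define T where "T z = (along i z - along i p) / H z" for z
  have ip: "lf i p = 0" using i mem_line_iff[OF line_R] by blast
  have nx: "lf i x \<noteq> 0" using lf_cell_nonzero[OF Q x i(1)] .
  have pl: "p \<in> l" "is_line l" "z l \<noteq> p" if "l \<in> S" for l
    using that SL line_L z[OF that] by (auto simp: S_def)
  have Hz: "0 < H (z l)" if "l \<in> S" for l
    unfolding H_def using cell_same_side[OF Q x _ i(1)] z[OF that] by blast
  have "card {m \<in> S. T (z l) \<le> T (z m)} \<le> K \<or> card {m \<in> S. T (z m) \<le> T (z l)} \<le> K" if l: "l \<in> S" for l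
  proof -
    have l'L: "l' l \<in> L" "is_line (l' l)" using z[OF l] line_L by auto
    have p': "p \<notin> l' l" using line_eqI[OF l'L(2) pl(2)[OF l], of p "z l"] z[OF l] pl[OF l] by metis
    define \<gamma> where "\<gamma> = lf (l' l) p"
    have \<gamma>: "\<gamma> \<noteq> 0" using p' mem_line_iff[OF l'L(2)] by (simp add: \<gamma>_def)
    obtain A B where AB: "\<And>y. lf (l' l) y = \<gamma> + A * (along i y - along i p) + B * (lf i y - lf i p)"
      using lf_pencil[OF line_R[OF i(1)], of "l' l" p] unfolding \<gamma>_def by blast
    define g where "g m = A * T (z m) + B / lf i x" for m
    have form: "lf (l' l) (z m) = \<gamma> + H (z m) * g m" if m: "m \<in> S" for m
    proof -
      have "H (z m) * T (z m) = along i (z m) - along i p" using Hz[OF m] by (simp add: T_def)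
      moreover have "H (z m) * (B / lf i x) = B * lf i (z m)" using nx by (simp add: H_def)
      ultimately have "H (z m) * g m = A * (along i (z m) - along i p) + B * lf i (z m)"
        unfolding g_def by (simp add: distrib_left mult.left_commute)
      then show ?thesis using AB[of "z m"] ip by simp
    qed
    have "lf (l' l) (z l) = 0" using z[OF l] mem_line_iff[OF l'L(2)] by blast
    then have gl: "\<gamma> + H (z l) * g l = 0" using form[OF l] by simp
    \<comment> \<open>Along the ray the value of \<open>lf (l' l)\<close> starts at
      \<open>\<gamma>\<close> and changes at a constant rate; a negative
      \<open>\<gamma> * g m\<close> says that it moves towards 0, which it reaches at the parameter
      \<open>s\<close>.\<close>
    have hit: "m \<in> {m \<in> L - {l' l}. m \<inter> (l' l \<inter> Q) \<noteq> {}}" if m: "m \<in> S" and neg: "\<gamma> * g m < 0" for m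
    proof -
      define s where "s = - \<gamma> / (H (z m) * g m)"
      have gm: "g m \<noteq> 0" using neg by auto
      have "s = (- (\<gamma> * g m)) / (H (z m) * (g m * g m))" using gm by (simp add: s_def)
      moreover have "0 < H (z m) * (g m * g m)"
        using Hz[OF m] gm by (auto simp: zero_less_mult_iff linorder_neq_iff)
      ultimately have s: "0 < s" using neg by (simp only: divide_pos_pos neg_0_less_iff_less)
      have w: "p + s *\<^sub>R (z m - p) \<in> Q"
        by (rule ray_in_cell[OF Q pl(2)[OF m]]) (use m z[OF m] s in \<open>auto simp: S_def\<close>)
      have "lf (l' l) (p + s *\<^sub>R (z m - p)) = (1 - s) * lf (l' l) p + s * lf (l' l) (z m)"
        using lf_affine[of "l' l" s p "z m"] by (simp add: algebra_simps)
      also have "\<dots> = \<gamma> + s * (H (z m) * g m)" using form[OF m] by (simp add: \<gamma>_def algebra_simps)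
      also have "\<dots> = 0" using Hz[OF m] gm by (simp add: s_def)
      finally have "p + s *\<^sub>R (z m - p) \<in> l' l" using mem_line_iff[OF l'L(2)] by blast
      moreover have "p + s *\<^sub>R (z m - p) \<in> m"
        using line_translate_mem[OF pl(2)[OF m] pl(1)[OF m]] z[OF m] by blast
      moreover have "m \<noteq> l' l" using p' pl[OF m] by blast
      ultimately show ?thesis using w m SL by blast
    qed
    have "\<gamma> * (H (z l) * g l) = - (\<gamma> * \<gamma>)" using gl by (simp add: eq_neg_iff_add_eq_0 algebra_simps flip: distrib_left)
    then have "H (z l) * (\<gamma> * g l) < 0" using \<gamma> by (auto simp: mult.left_commute zero_less_mult_iff linorder_neq_iff)
    then have gl_neg: "\<gamma> * g l < 0" using Hz[OF l] by (simp add: mult_less_0_iff)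
    have gm: "\<gamma> * g m = \<gamma> * g l + \<gamma> * A * (T (z m) - T (z l))" for m
      by (simp add: g_def algebra_simps)
    have K: "card {m \<in> L - {l' l}. m \<inter> (l' l \<inter> Q) \<noteq> {}} \<le> K"
      by (rule card_crossing_in_cell[OF Q l'L(1)])
    have fin: "finite {m \<in> L - {l' l}. m \<inter> (l' l \<inter> Q) \<noteq> {}}" using finite_L by simp
    show ?thesis
    \<comment> \<open>\<open>g\<close> is affine in the slope and \<open>\<gamma> * g\<close> is
      negative at \<open>l\<close>, so it stays negative for all larger or for all smaller slopes;
      the sign of \<open>\<gamma> * A\<close> decides which.\<close>
    proof (cases "\<gamma> * A \<le> 0")
      case True
      have "{m \<in> S. T (z l) \<le> T (z m)} \<subseteq> {m \<in> L - {l' l}. m \<inter> (l' l \<inter> Q) \<noteq> {}}"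
      proof
        fix m assume "m \<in> {m \<in> S. T (z l) \<le> T (z m)}"
        then have m: "m \<in> S" "T (z l) \<le> T (z m)" by auto
        have "\<gamma> * A * (T (z m) - T (z l)) \<le> 0" using True m by (simp add: mult_nonpos_nonneg)
        then show "m \<in> {m \<in> L - {l' l}. m \<inter> (l' l \<inter> Q) \<noteq> {}}"
          using hit[OF m(1)] gm[of m] gl_neg by linarith
      qed
      then show ?thesis using card_mono[OF fin] K by (meson le_trans)
    next
      case False
      have "{m \<in> S. T (z m) \<le> T (z l)} \<subseteq> {m \<in> L - {l' l}. m \<inter> (l' l \<inter> Q) \<noteq> {}}"
      proof
        fix m assume "m \<in> {m \<in> S. T (z m) \<le> T (z l)}"
        then have m: "m \<in> S" "T (z m) \<le> T (z l)" by auto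
        have "\<gamma> * A * (T (z m) - T (z l)) \<le> 0" using False m by (simp add: mult_nonneg_nonpos)
        then show "m \<in> {m \<in> L - {l' l}. m \<inter> (l' l \<inter> Q) \<noteq> {}}"
          using hit[OF m(1)] gm[of m] gl_neg by linarith
      qed
      then show ?thesis using card_mono[OF fin] K by (meson le_trans)
    qed
  qed
  then have "card S \<le> 2 * K" by (rule card_le_of_top_or_bottom[OF finS])
  then show ?thesis by (simp add: S_def)
qed

text \<open>Lines inside \<open>Q\<close> miss the sample, so all of them are parallel to one sample
  line. A second line that meets one of them is transversal, hence meets all of them, and does so
  inside \<open>Q\<close>.\<close>

lemma card_contained_lines:
  assumes Q: "Q \<in> cells R"
  shows "card {l \<in> crossed Q. l \<inter> (closure Q - Q) = {}} \<le> K"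
proof (cases "{l \<in> crossed Q. l \<inter> (closure Q - Q) = {}} = {}")
  case False
  define S where "S = {l \<in> crossed Q. l \<inter> (closure Q - Q) = {}}"
  obtain l0 where l0: "l0 \<in> S" using False S_def by blast
  obtain i where i: "i \<in> R" using R_nonempty by blast
  have SL: "S \<subseteq> L" by (auto simp: S_def crossed_def)
  have inside: "m \<subseteq> Q" if m: "m \<in> S" for m
  proof (rule ccontr)
    assume "\<not> m \<subseteq> Q"
    moreover have "m \<inter> Q \<noteq> {}" using m by (auto simp: S_def crossed_def)
    moreover have "connected m" using convex_line convex_connected line_L SL m by blast
    ultimately have "m \<inter> frontier Q \<noteq> {}" by (intro connected_Int_frontier) auto
    then show False using m frontier_cell[OF Q] by (auto simp: S_def)
  qed
  have par: "\<exists>h b. b \<noteq> 0 \<and> (\<forall>p. lf m p = b * (lf i p - h))" if m: "m \<in> S" for m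
  proof (rule parallel_form[OF line_R[OF i]])
    show "is_line m" using m SL line_L by blast
    show "\<not> transv i m"
    proof
      assume "transv i m"
      then obtain p where "lf i p = 0" "p \<in> m" using transv_meets line_R[OF i] \<open>is_line m\<close> by blast
      then show False using inside[OF m] cell_avoids[OF Q _ i] mem_line_iff[OF line_R[OF i]] by blast
    qed
  qed
  obtain z l' where z: "z \<in> l0" "z \<in> Q" "l' \<in> L" "l' \<noteq> l0" "z \<in> l'"
    using l0 by (auto simp: S_def crossed_def)
  have l'line: "is_line l'" "is_line l0" using z line_L l0 SL by auto
  have tr: "transv i l'"
  proof (rule ccontr)
    assume "\<not> transv i l'"
    then obtain h' b' where h': "b' \<noteq> 0" "\<And>p. lf l' p = b' * (lf i p - h')"
      using parallel_form[OF line_R[OF i] l'line(1)] by blast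
    obtain h b where h: "b \<noteq> 0" "\<And>p. lf l0 p = b * (lf i p - h)" using par[OF l0] by blast
    have "lf l' z = 0" "lf l0 z = 0" using z l'line mem_line_iff by auto
    then have "h = h'" using h h' by simp
    then have "l' = l0" using h h' mem_line_iff l'line by auto
    then show False using z by blast
  qed
  have "S \<subseteq> {m \<in> L - {l'}. m \<inter> (l' \<inter> Q) \<noteq> {}}"
  proof
    fix m assume m: "m \<in> S"
    obtain h b where h: "b \<noteq> 0" "\<And>p. lf m p = b * (lf i p - h)" using par[OF m] by blast
    obtain p where p: "lf i p = h" "p \<in> l'" using transv_meets[OF line_R[OF i] l'line(1) tr] by blast
    have pm: "p \<in> m" using h p mem_line_iff line_L SL m by auto
    obtain p' where p': "lf i p' = h + 1" "p' \<in> l'" using transv_meets[OF line_R[OF i] l'line(1) tr] by blast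
    have "p' \<notin> m" using h p' mem_line_iff line_L SL m by auto
    then have "m \<noteq> l'" using p' by blast
    then show "m \<in> {m \<in> L - {l'}. m \<inter> (l' \<inter> Q) \<noteq> {}}" using pm p inside[OF m] m SL by blast
  qed
  then have "card S \<le> card {m \<in> L - {l'}. m \<inter> (l' \<inter> Q) \<noteq> {}}" using finite_L by (intro card_mono) auto
  also have "\<dots> \<le> K" by (rule card_crossing_in_cell[OF Q z(3)])
  finally show ?thesis by (simp add: S_def)
next
  case True
  show ?thesis unfolding True by simp
qed

text \<open>A line outside \<open>through_edge Q\<close> meets the frontier only in vertices: at
  least two, exactly one, or none. With \<open>b\<close> edge lines and at most \<open>2 * b\<close>
  vertices, the total is at most \<open>b * K + K + 2 * b * (3 * K + 2)\<close>, which is at most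
  \<open>12 * b * K\<close> as \<open>b\<close> and \<open>K\<close> are positive.\<close>

lemma card_crossed_le:
  assumes Q: "Q \<in> cells R"
  shows "card (crossed Q) \<le> 12 * card (edge_lines Q) * K"
proof -
  define A where "A p = {l \<in> crossed Q - through_edge Q. p \<in> l \<and> (\<exists>q\<in>vertices Q. q \<noteq> p \<and> q \<in> l)}" for p
  define B where "B p = {l \<in> crossed Q. l \<inter> (closure Q - Q) = {p}}" for p
  define C where "C = {l \<in> crossed Q. l \<inter> (closure Q - Q) = {}}"
  have fin: "finite (crossed Q)" using finite_L by (simp add: crossed_def)
  have finU: "finite (through_edge Q \<union> (C \<union> (\<Union>p\<in>vertices Q. A p \<union> B p)))"
  proof -
    have "through_edge Q \<subseteq> L" by (auto simp: through_edge_def)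
    then have "finite (through_edge Q)" using finite_L finite_subset by blast
    then show ?thesis using fin finite_vertices[OF Q] by (auto simp: A_def B_def C_def)
  qed
  have sub: "crossed Q \<subseteq> through_edge Q \<union> (C \<union> (\<Union>p\<in>vertices Q. A p \<union> B p))"
  proof
    fix l assume l: "l \<in> crossed Q"
    show "l \<in> through_edge Q \<union> (C \<union> (\<Union>p\<in>vertices Q. A p \<union> B p))"
    proof (cases "l \<in> through_edge Q \<or> l \<in> C")
      case False
      then obtain p where p: "p \<in> l" "p \<in> closure Q" "p \<notin> Q" using l by (auto simp: C_def)
      have v: "y \<in> vertices Q" if "y \<in> l" "y \<in> closure Q" "y \<notin> Q" for y
        using boundary_cases[OF Q that(2,3)] not_through_edge[OF Q l _ that(1)] False edge_lines_subset by blast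
      have "l \<in> A p \<or> l \<in> B p"
      proof (cases "l \<inter> (closure Q - Q) = {p}")
        case True
        then show ?thesis using l by (simp add: B_def)
      next
        case False
        then obtain q where "q \<in> l" "q \<in> closure Q" "q \<notin> Q" "q \<noteq> p" using p by blast
        then show ?thesis using v l p \<open>\<not> (l \<in> through_edge Q \<or> l \<in> C)\<close> by (auto simp: A_def)
      qed
      then show ?thesis using v[OF p] by blast
    qed blast
  qed
  have "card (crossed Q) \<le> card (through_edge Q) + (card C + card (\<Union>p\<in>vertices Q. A p \<union> B p))"
    by (rule order.trans[OF card_mono[OF finU sub]]) (intro order.trans[OF card_Un_le] add_left_mono order.refl)
  also have "card (\<Union>p\<in>vertices Q. A p \<union> B p) \<le> (\<Sum>p\<in>vertices Q. card (A p \<union> B p))"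
    by (rule card_UN_le[OF finite_vertices[OF Q]])
  also have "\<dots> \<le> (\<Sum>p\<in>vertices Q. (K + 2) + 2 * K)"
  proof (rule sum_mono)
    fix p assume "p \<in> vertices Q"
    then have "card (A p) \<le> K + 2" "card (B p) \<le> 2 * K"
      using card_vertex_vertex_lines[OF Q] card_vertex_infinity_lines[OF Q] by (auto simp: A_def B_def)
    then show "card (A p \<union> B p) \<le> (K + 2) + 2 * K"
      using card_Un_le[of "A p" "B p"] by linarith
  qed
  also have "\<dots> = card (vertices Q) * (3 * K + 2)" by simp
  also have "\<dots> \<le> (2 * card (edge_lines Q)) * (5 * K)"
    using card_vertices_le[OF Q] K_pos by (intro mult_le_mono) auto
  finally have "card (crossed Q) \<le> card (through_edge Q) + (card C + (2 * card (edge_lines Q)) * (5 * K))"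
    by simp
  moreover have "card C \<le> card (edge_lines Q) * K"
  proof -
    have "1 \<le> card (edge_lines Q)" using edge_lines_nonempty[OF Q R_nonempty] finite_edge_lines by (simp add: Suc_le_eq card_gt_0_iff)
    then have "1 * K \<le> card (edge_lines Q) * K" by (rule mult_le_mono1)
    moreover have "card C \<le> K" using card_contained_lines[OF Q] unfolding C_def .
    ultimately show ?thesis by linarith
  qed
  ultimately show ?thesis using card_through_edge[OF Q] by (simp add: algebra_simps)
qed

end

section \<open>Rich points in a cell\<close>

context acceptable_sample
begin

text \<open>Two points of an edge share no line but \<open>j\<close>, so their other lines form
  disjoint families among the at most \<open>K\<close> lines crossing the edge. Each family has at
  least \<open>k - 1\<close>, hence at least \<open>k / 2\<close>, members.\<close>

lemma card_rich_on_edge: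
  fixes k :: real
  assumes Q: "Q \<in> cells R" and j: "j \<in> R" and P: "finite P"
    and rich: "\<And>p. p \<in> P \<Longrightarrow> k \<le> real (card {l \<in> L. p \<in> l})" and k: "2 \<le> k"
  shows "real (card {p \<in> P. contact Q j p}) \<le> 2 * real K / k"
proof -
  define S where "S = {p \<in> P. contact Q j p}"
  have fin: "finite S" using P by (simp add: S_def)
  have jL: "j \<in> L" using j R_subset by blast
  have "card (SIGMA p:S. {m \<in> L - {j}. p \<in> m}) \<le> card {m \<in> L - {j}. \<exists>E\<in>m. contact Q j E}"
  proof (rule card_le_of_image[of _ _ snd])
    fix x y assume xy: "x \<in> (SIGMA p:S. {m \<in> L - {j}. p \<in> m})" "y \<in> (SIGMA p:S. {m \<in> L - {j}. p \<in> m})"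
      and eq: "snd x = snd y"
    obtain p q m where pq: "x = (p, m)" "y = (q, m)" using eq by (metis prod.collapse)
    have m: "p \<in> S" "q \<in> S" "m \<in> L" "m \<noteq> j" "p \<in> m" "q \<in> m" using xy unfolding pq by auto
    then have "p \<in> j" "q \<in> j" by (auto simp: S_def contact_def)
    then have "p = q" using line_eqI[of j m p q] line_L[OF jL] line_L[OF m(3)] m(4-6) by blast
    then show "x = y" by (simp add: pq)
  qed (use finite_L in \<open>auto simp: S_def\<close>)
  then have "card (SIGMA p:S. {m \<in> L - {j}. p \<in> m}) \<le> K"
    using card_crossing_edge[OF Q j] by linarith
  then have le: "(\<Sum>p\<in>S. card {m \<in> L - {j}. p \<in> m}) \<le> K"
    using fin finite_L by (simp add: card_SigmaI)
  have each: "k / 2 \<le> real (card {m \<in> L - {j}. p \<in> m})" if p: "p \<in> S" for p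
  proof -
    have "{l \<in> L. p \<in> l} \<subseteq> insert j {m \<in> L - {j}. p \<in> m}" by blast
    then have "card {l \<in> L. p \<in> l} \<le> card (insert j {m \<in> L - {j}. p \<in> m})"
      using finite_L by (intro card_mono) auto
    also have "\<dots> \<le> card {m \<in> L - {j}. p \<in> m} + 1"
      using finite_L by (simp add: card_insert_if)
    finally have "k \<le> real (card {m \<in> L - {j}. p \<in> m}) + 1"
      using rich[of p] p by (auto simp: S_def)
    then show ?thesis using k by simp
  qed
  have "real (card S) * (k / 2) \<le> (\<Sum>p\<in>S. real (card {m \<in> L - {j}. p \<in> m}))"
    using sum_mono[of S "\<lambda>_. k / 2", OF each] by simp
  also have "\<dots> \<le> real K" using le by (simp flip: of_nat_sum)
  finally show ?thesis using k by (simp add: S_def field_simps)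
qed

lemma card_rich_on_boundary:
  fixes k :: real
  assumes Q: "Q \<in> cells R" and P: "finite P"
    and rich: "\<And>p. p \<in> P \<Longrightarrow> k \<le> real (card {l \<in> L. p \<in> l})" and k: "2 \<le> k"
  shows "real (card (P \<inter> (closure Q - Q))) \<le> real (card (edge_lines Q)) * (2 + 2 * real K / k)"
proof -
  have sub: "P \<inter> (closure Q - Q) \<subseteq> vertices Q \<union> (\<Union>j\<in>edge_lines Q. {p \<in> P. contact Q j p})"
    using boundary_cases[OF Q] by blast
  have fin: "finite (vertices Q \<union> (\<Union>j\<in>edge_lines Q. {p \<in> P. contact Q j p}))"
    using finite_vertices[OF Q] finite_edge_lines P by auto
  have "card (P \<inter> (closure Q - Q)) \<le> card (vertices Q) + card (\<Union>j\<in>edge_lines Q. {p \<in> P. contact Q j p})"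
    by (rule order.trans[OF card_mono[OF fin sub] card_Un_le])
  also have "\<dots> \<le> 2 * card (edge_lines Q) + (\<Sum>j\<in>edge_lines Q. card {p \<in> P. contact Q j p})"
    by (intro add_mono card_vertices_le[OF Q] card_UN_le finite_edge_lines)
  finally have "real (card (P \<inter> (closure Q - Q))) \<le>
      2 * real (card (edge_lines Q)) + (\<Sum>j\<in>edge_lines Q. real (card {p \<in> P. contact Q j p}))"
    by (simp flip: of_nat_sum)
  also have "(\<Sum>j\<in>edge_lines Q. real (card {p \<in> P. contact Q j p})) \<le> (\<Sum>j\<in>edge_lines Q. 2 * real K / k)"
  proof (rule sum_mono)
    fix j assume "j \<in> edge_lines Q"
    then show "real (card {p \<in> P. contact Q j p}) \<le> 2 * real K / k"
      using card_rich_on_edge[OF Q _ P rich k] edge_lines_subset by blast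
  qed
  finally show ?thesis by (simp add: algebra_simps)
qed

lemma card_rich_in_cell:
  fixes k :: real
  assumes Q: "Q \<in> cells R" and P: "finite P"
    and v: "v \<noteq> 0" "\<And>l x. l \<in> L \<Longrightarrow> x \<in> l \<Longrightarrow> x + v \<notin> l"
    and rich: "\<And>p. p \<in> P \<Longrightarrow> k \<le> real (card {l \<in> L. p \<in> l})" and k: "16 \<le> k"
  shows "real (card (P \<inter> Q)) \<le> real (card (edge_lines Q)) * (49152 * (real K)\<^sup>2 / k ^ 3 + 24 * real K / k)"
proof -
  have CL: "crossed Q \<subseteq> L" by (auto simp: crossed_def)
  then have fin: "finite (crossed Q)" using finite_L finite_subset by blast
  have "real (card (P \<inter> Q)) \<le> 4096 * real (card (crossed Q)) * K / k ^ 3 + 2 * real (card (crossed Q)) / k"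
  proof (rule card_rich_points_le[OF fin _ _ v(1) _ cell_convex[OF Q] _ _ _ k])
    show "finite (P \<inter> Q)" using P by simp
    show "is_line l" if "l \<in> crossed Q" for l using that CL line_L by blast
    show "x + v \<notin> l" if "l \<in> crossed Q" "x \<in> l" for l x using that CL v(2) by blast
    show "card {m \<in> crossed Q - {l}. m \<inter> (l \<inter> Q) \<noteq> {}} \<le> K" if "l \<in> crossed Q" for l
    proof -
      have "card {m \<in> crossed Q - {l}. m \<inter> (l \<inter> Q) \<noteq> {}} \<le> card {m \<in> L - {l}. m \<inter> (l \<inter> Q) \<noteq> {}}"
        using finite_L CL by (intro card_mono) auto
      then show ?thesis using card_crossing_in_cell[OF Q, of l] that CL by (meson le_trans subsetD)
    qed
    show "k \<le> real (card {l \<in> crossed Q. p \<in> l})" if p: "p \<in> P \<inter> Q" for p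
    proof -
      have big: "1 < card {l \<in> L. p \<in> l}" using rich[of p] p k by auto
      \<comment> \<open>Each line through a rich point of \<open>Q\<close> meets another line there,
        so passing from \<open>L\<close> to \<open>crossed Q\<close> preserves richness.\<close>
      have "{l \<in> L. p \<in> l} \<subseteq> {l \<in> crossed Q. p \<in> l}"
      proof
        fix l assume l: "l \<in> {l \<in> L. p \<in> l}"
        have "\<not> {l \<in> L. p \<in> l} \<subseteq> {l}" using big card_mono[of "{l}" "{l \<in> L. p \<in> l}"] by auto
        then show "l \<in> {l \<in> crossed Q. p \<in> l}" using l p by (auto simp: crossed_def)
      qed
      then have "card {l \<in> L. p \<in> l} \<le> card {l \<in> crossed Q. p \<in> l}" using fin by (intro card_mono) auto
      then show ?thesis using rich[of p] p by auto
    qed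
  qed blast
  also have "\<dots> \<le> 4096 * (12 * real (card (edge_lines Q)) * K) * K / k ^ 3 + 2 * (12 * real (card (edge_lines Q)) * K) / k"
  proof -
    have "real (card (crossed Q)) \<le> real (12 * card (edge_lines Q) * K)"
      using card_crossed_le[OF Q] by (rule of_nat_mono)
    then have "real (card (crossed Q)) \<le> 12 * real (card (edge_lines Q)) * K" by simp
    then show ?thesis using k by (intro add_mono divide_right_mono mult_right_mono mult_left_mono) auto
  qed
  finally show ?thesis by (simp add: power2_eq_square algebra_simps)
qed

lemma card_rich_in_closed_cell:
  fixes k :: real
  assumes Q: "Q \<in> cells R" and P: "finite P"
    and v: "v \<noteq> 0" "\<And>l x. l \<in> L \<Longrightarrow> x \<in> l \<Longrightarrow> x + v \<notin> l"
    and rich: "\<And>p. p \<in> P \<Longrightarrow> k \<le> real (card {l \<in> L. p \<in> l})" and k: "16 \<le> k"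
  shows "real (card (P \<inter> closure Q)) \<le>
    real (card (edge_lines Q)) * (50000 * (real K)\<^sup>2 / k ^ 3 + 30 * real K / k + 2)"
proof -
  let ?b = "real (card (edge_lines Q))"
  have "P \<inter> closure Q = (P \<inter> Q) \<union> (P \<inter> (closure Q - Q))" using closure_subset by blast
  then have "card (P \<inter> closure Q) \<le> card (P \<inter> Q) + card (P \<inter> (closure Q - Q))"
    using card_Un_le by metis
  then have "real (card (P \<inter> closure Q)) \<le> real (card (P \<inter> Q)) + real (card (P \<inter> (closure Q - Q)))"
    by linarith
  also have "\<dots> \<le> ?b * (49152 * (real K)\<^sup>2 / k ^ 3 + 24 * real K / k) + ?b * (2 + 2 * real K / k)"
    using card_rich_in_cell[OF assms] card_rich_on_boundary[OF Q P rich] k by (intro add_mono) auto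
  also have "\<dots> = ?b * (49152 * (real K)\<^sup>2 / k ^ 3 + 26 * real K / k + 2)"
    by (simp add: algebra_simps)
  also have "\<dots> \<le> ?b * (50000 * (real K)\<^sup>2 / k ^ 3 + 30 * real K / k + 2)"
    using k by (intro mult_left_mono add_mono divide_right_mono mult_right_mono) auto
  finally show ?thesis .
qed

text \<open>Where the number \<open>b\<close> of edge lines exceeds \<open>\<beta>\<close>, the
  bound \<open>b * M\<close> is at most \<open>b^2 * M / \<beta>\<close>, and the squares are summed
  over all cells.\<close>

lemma card_points_in_complex_cells:
  fixes \<beta> M :: real
  assumes P: "finite P" and \<beta>: "0 < \<beta>" and M: "0 \<le> M"
    and cell: "\<And>Q. Q \<in> cells R \<Longrightarrow> real (card (P \<inter> closure Q)) \<le> real (card (edge_lines Q)) * M"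
  shows "real (card (P \<inter> (\<Union>Q\<in>{Q \<in> cells R. \<beta> < card (edge_lines Q)}. closure Q))) \<le> 28 * (real (card R))\<^sup>2 * M / \<beta>"
proof -
  define D where "D = {Q \<in> cells R. \<beta> < card (edge_lines Q)}"
  have fin: "finite (cells R)" "finite D" using finite_cells[OF R_nonempty] by (auto simp: D_def)
  have "P \<inter> (\<Union>Q\<in>D. closure Q) = (\<Union>Q\<in>D. P \<inter> closure Q)" by blast
  then have "card (P \<inter> (\<Union>Q\<in>D. closure Q)) \<le> (\<Sum>Q\<in>D. card (P \<inter> closure Q))"
    using card_UN_le[OF fin(2), of "\<lambda>Q. P \<inter> closure Q"] by simp
  then have "real (card (P \<inter> (\<Union>Q\<in>D. closure Q))) \<le> (\<Sum>Q\<in>D. real (card (P \<inter> closure Q)))"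
    by (simp flip: of_nat_sum)
  also have "\<dots> \<le> (\<Sum>Q\<in>D. (real (card (edge_lines Q)))\<^sup>2 * (M / \<beta>))"
  proof (rule sum_mono)
    fix Q assume Q: "Q \<in> D"
    let ?b = "real (card (edge_lines Q))"
    have "?b * \<beta> \<le> ?b * ?b" using Q by (intro mult_left_mono) (auto simp: D_def)
    then have "?b \<le> ?b\<^sup>2 / \<beta>" using \<beta> by (simp add: field_simps power2_eq_square)
    then have "?b * M \<le> ?b\<^sup>2 / \<beta> * M" using M by (rule mult_right_mono)
    then show "real (card (P \<inter> closure Q)) \<le> ?b\<^sup>2 * (M / \<beta>)" using cell[of Q] Q by (simp add: D_def)
  qed
  also have "\<dots> \<le> (\<Sum>Q\<in>cells R. (real (card (edge_lines Q)))\<^sup>2 * (M / \<beta>))"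
    using fin M \<beta> by (intro sum_mono2) (auto simp: D_def)
  also have "\<dots> = real (\<Sum>Q\<in>cells R. (card (edge_lines Q))\<^sup>2) * (M / \<beta>)"
    by (simp only: sum_distrib_right[symmetric] of_nat_sum of_nat_power)
  also have "\<dots> \<le> real (28 * (card R)\<^sup>2) * (M / \<beta>)"
    using sum_card_edge_lines_squared[OF R_nonempty] M \<beta> by (intro mult_right_mono of_nat_mono) auto
  finally show ?thesis by (simp add: D_def)
qed

end

section \<open>Partitions of points induced by the cells\<close>

lemma partition_on_cell_partition: "partition_on P (cell_partition P f)"
  by (auto simp: partition_on_def cell_partition_def disjoint_def)

lemma (in line_arrangement) cell_partition_bounds:
  assumes P: "finite P" and f: "cell_assignment R P f" and R: "R \<noteq> {}"
  shows "card (cell_partition P f) \<le> 28 * (card R)\<^sup>2"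
    and "is_line l \<Longrightarrow> card {Q \<in> cell_partition P f. l \<inter> Q \<noteq> {}} \<le> 3 * card R + 2"
    and "Q \<in> cell_partition P f \<Longrightarrow> \<exists>c\<in>cells R. Q \<subseteq> P \<inter> closure c"
proof -
  have "card (cell_partition P f) \<le> card (f ` P)"
    unfolding cell_partition_def using P by (intro card_image_le) auto
  also have "\<dots> \<le> card (cells R)"
    using f finite_cells[OF R] by (intro card_mono) (auto simp: cell_assignment_def)
  also have "\<dots> \<le> 28 * (card R)\<^sup>2" by (rule card_cells_le[OF R])
  finally show "card (cell_partition P f) \<le> 28 * (card R)\<^sup>2" .
  show "card {Q \<in> cell_partition P f. l \<inter> Q \<noteq> {}} \<le> 3 * card R + 2" if l: "is_line l"
  proof -
    have "{Q \<in> cell_partition P f. l \<inter> Q \<noteq> {}} \<subseteq> (\<lambda>c. {p \<in> P. f p = c}) ` (f ` (P \<inter> l))"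
      by (auto simp: cell_partition_def)
    then have "card {Q \<in> cell_partition P f. l \<inter> Q \<noteq> {}} \<le> card (f ` (P \<inter> l))"
      using card_cells_assigned_on_line(2)[OF f l] by (rule surj_card_le[rotated])
    then show ?thesis using card_cells_assigned_on_line(1)[OF f l] by linarith
  qed
  show "\<exists>c\<in>cells R. Q \<subseteq> P \<inter> closure c" if "Q \<in> cell_partition P f"
    using that f by (fastforce simp: cell_partition_def cell_assignment_def)
qed

lemma card_partition_ge:
  fixes M :: real
  assumes part: "partition_on P \<Q>" and P: "finite P" and M: "\<And>Q. Q \<in> \<Q> \<Longrightarrow> real (card Q) \<le> M"
  shows "real (card P) \<le> real (card \<Q>) * M"
proof -
  have P_eq: "P = \<Union>\<Q>" using part by (rule partition_onD1)
  then have fin: "finite \<Q>" using P finite_UnionD by blast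
  have "card P \<le> sum card \<Q>" unfolding P_eq by (rule card_Union_le_sum_card)
  then have "real (card P) \<le> (\<Sum>Q\<in>\<Q>. real (card Q))" by (simp flip: of_nat_sum)
  also have "\<dots> \<le> (\<Sum>Q\<in>\<Q>. M)" using M by (rule sum_mono)
  finally show ?thesis by simp
qed

lemma card_incidences_ge:
  assumes "finite L" "finite P" "\<And>p. p \<in> P \<Longrightarrow> rich k L p"
  shows "real (card P) * k \<le> real (card (incidences L P))"
proof -
  have "incidences L P = (\<lambda>(p, l). (l, p)) ` (SIGMA p:P. {l \<in> L. p \<in> l})"
    by (auto simp: incidences_def image_iff)
  moreover have "inj_on (\<lambda>(p, l). (l, p)) (SIGMA p:P. {l \<in> L. p \<in> l})"
    by (auto simp: inj_on_def)
  ultimately have "card (incidences L P) = (\<Sum>p\<in>P. card {l \<in> L. p \<in> l})"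
    using assms(1,2) by (simp add: card_image card_SigmaI)
  moreover have "real (card P) * k \<le> (\<Sum>p\<in>P. real (card {l \<in> L. p \<in> l}))"
    using sum_mono[of P "\<lambda>_. k"] assms(3) by (simp add: rich_def)
  ultimately show ?thesis by simp
qed

section \<open>The refinement\<close>

lemma powr_ge_threshold:
  fixes N :: real
  assumes "0 < x" "0 < a" "a powr (1 / x) \<le> N"
  shows "a \<le> N powr x"
proof -
  have "a = (a powr (1 / x)) powr x" using assms by (simp add: powr_powr)
  also have "\<dots> \<le> N powr x" using assms by (intro powr_mono2) auto
  finally show ?thesis .
qed

text \<open>Half of the exponent \<open>e\<close> absorbs the logarithm, the other half the
  constants; the summand 1 makes room for rounding \<open>K0\<close> up.\<close>

lemma K0_bounds:
  fixes N C e :: real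
  assumes "0 < C" "0 < e" "1 < N" "2 * C / e + 1 \<le> N powr (e / 2)"
  shows "0 < K0 C N" "K0 C N + 1 \<le> N powr (2/3 + e)"
proof -
  show "0 < K0 C N" using assms by (simp add: K0_def)
  have "N powr 1 / N powr (1/3) = N powr (2/3)" by (subst powr_diff[symmetric]) simp
  then have "N / N powr (1/3) = N powr (2/3)" using assms by simp
  then have K: "K0 C N = C * ln N * N powr (2/3)" unfolding K0_def by (metis mult.assoc mult.commute times_divide_eq_right)
  have "ln N \<le> N powr (e/2) / (e/2)" using assms by (intro ln_powr_bound) auto
  then have "C * ln N \<le> C * (N powr (e/2) / (e/2))" using assms by (intro mult_left_mono) auto
  also have "\<dots> = (2 * C / e) * N powr (e/2)" by simp
  finally have "K0 C N \<le> (2 * C / e) * N powr (e/2) * N powr (2/3)"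
    unfolding K by (intro mult_right_mono) auto
  moreover have "1 * 1 \<le> N powr (e/2) * N powr (2/3)"
    using assms by (intro mult_mono ge_one_powr_ge_zero) auto
  ultimately have "K0 C N + 1 \<le> (2 * C / e + 1) * (N powr (e/2) * N powr (2/3))"
    by (simp add: algebra_simps)
  also have "\<dots> \<le> N powr (e/2) * (N powr (e/2) * N powr (2/3))"
    using assms by (intro mult_right_mono) auto
  also have "\<dots> = N powr (e/2 + (e/2 + 2/3))" by (simp only: powr_add)
  also have "e/2 + (e/2 + 2/3) = 2/3 + e" by simp
  finally show "K0 C N + 1 \<le> N powr (2/3 + e)" .
qed

text \<open>The main term has exponent
  \<open>2 * (2/3 + e) - 3 * (1/3 - A * e) = 1/3 + (3 * A + 2) * e\<close>. The other terms are no
  larger, and one more \<open>e\<close> absorbs 50032 = 50000 + 30 + 2.\<close>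

lemma cell_count_bound:
  fixes N A e K k :: real
  assumes N: "1 < N" and A: "0 < A" and e: "0 < e" and K: "0 \<le> K" "K \<le> N powr (2/3 + e)"
    and k: "k = N powr (1/3 - A * e)" and big: "50032 \<le> N powr e"
  shows "50000 * K\<^sup>2 / k ^ 3 + 30 * K / k + 2 \<le> N powr (1/3 + (3 * A + 3) * e)"
proof -
  let ?m = "N powr (1/3 + (3 * A + 2) * e)"
  have kpos: "0 < k" using N k by simp
  have k3: "k ^ 3 = N powr (1 - 3 * A * e)"
    using N unfolding k by (simp add: powr_power algebra_simps)
  have "K\<^sup>2 \<le> (N powr (2/3 + e))\<^sup>2" using K by (rule power_mono[rotated])
  also have "\<dots> = N powr (4/3 + 2 * e)" using N by (simp add: powr_power algebra_simps)
  finally have "K\<^sup>2 / k ^ 3 \<le> N powr (4/3 + 2 * e) / N powr (1 - 3 * A * e)"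
    unfolding k3 by (rule divide_right_mono) simp
  also have "\<dots> = ?m"
    unfolding powr_diff[symmetric] by (rule arg_cong[of _ _ "(powr) N"]) (simp add: algebra_simps)
  finally have 1: "K\<^sup>2 / k ^ 3 \<le> ?m" .
  have "K / k \<le> N powr (2/3 + e) / N powr (1/3 - A * e)"
    unfolding k using K(2) by (rule divide_right_mono) simp
  also have "\<dots> = N powr (2/3 + e - (1/3 - A * e))" by (rule powr_diff[symmetric])
  also have "\<dots> \<le> ?m"
  proof (rule powr_mono)
    have "0 \<le> A * e" using A e by simp
    then show "2/3 + e - (1/3 - A * e) \<le> 1/3 + (3 * A + 2) * e" using e by (simp add: algebra_simps)
  qed (use N in simp)
  finally have 2: "K / k \<le> ?m" .
  have 3: "1 \<le> ?m" using N A e by (intro ge_one_powr_ge_zero) auto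
  have "50000 * K\<^sup>2 / k ^ 3 + 30 * K / k + 2 \<le> 50032 * ?m" using 1 2 3 by simp
  also have "\<dots> \<le> N powr e * ?m" using big by (intro mult_right_mono) auto
  also have "\<dots> = N powr (1/3 + (3 * A + 3) * e)"
    unfolding powr_add[symmetric] by (rule arg_cong[of _ _ "(powr) N"]) (simp add: algebra_simps)
  finally show ?thesis .
qed

text \<open>Losses are multiples of \<open>(A + 1) * e\<close>: 3 for the points per edge line, 4
  for the threshold \<open>\<beta>\<close>, so that the removed part falls below \<open>N\<close> by
  one multiple, and 3 + 4 = 7 for the points per cell. The lower bound for the number of parts
  divides \<open>card P'\<close>, which loses \<open>A * e\<close>, by the cell size; 8 covers
  this.\<close>

lemma refinement_exists:
  fixes A e c C N :: real
  assumes A: "0 < A" and e: "0 < e" and c: "0 < c" and C: "0 < C" and N: "1 < N"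
    and big: "50032 \<le> N powr e" "224 / c \<le> N powr e" "2 * C / e + 1 \<le> N powr (e / 2)"
      "16 \<le> N powr (1/3 - A * e)"
    and ext: "extremal c (A * e) N L P"
    and rich: "\<forall>p\<in>P. rich (N powr (1/3 - A * e)) L p"
    and acc: "acceptable C N L v R"
  defines "B \<equiv> 8 * A + 8"
  shows "\<exists>P'\<subseteq>P.
      real (card P') \<ge> 1/2 * real (card P) \<and>
      (\<forall>Q\<in>cells R. real (card (sides Q)) > N powr (B * e) \<longrightarrow> P' \<inter> closure Q = {}) \<and>
      (\<forall>Q\<in>cells R. real (card (P' \<inter> closure Q)) \<le> N powr (1/3 + B * e)) \<and>
      extremal (c / 2) (B * e) N L P' \<and>
      (\<forall>f. cell_assignment R P' f \<longrightarrow>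
         point_weighted_cell_decomposition (c / 2) 112 (B * e) N (N powr (1/3)) L P' (cell_partition P' f))"
proof -
  have conf: "finite L" "finite P" "\<And>l. l \<in> L \<Longrightarrow> is_line l" "c * N powr (1 - A * e) \<le> card L"
      "card L \<le> N" "c * N powr (1 - A * e) \<le> card P" "card P \<le> N"
    using ext by (auto simp: extremal_def configuration_def)
  define K where "K = nat \<lceil>K0 C N\<rceil>"
  have K0: "0 < K0 C N" "K0 C N + 1 \<le> N powr (2/3 + e)" using K0_bounds[OF C e N big(3)] .
  have K: "K0 C N \<le> real K" "real K \<le> N powr (2/3 + e)" "1 \<le> K"
  proof -
    show "K0 C N \<le> real K" by (simp add: K_def real_nat_ceiling_ge)
    have "real K \<le> K0 C N + 1" using K0(1) by (simp add: K_def)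
    then show "real K \<le> N powr (2/3 + e)" using K0(2) by linarith
    show "1 \<le> K" using K0(1) by (simp add: K_def Suc_le_eq)
  qed
  have R: "R \<subseteq> L" "N powr (1/3) / 2 \<le> card R" "card R \<le> 2 * N powr (1/3)"
      "\<And>l. l \<in> L \<Longrightarrow> acceptable_along K L R l" and v: "v \<noteq> 0" "\<And>l x. l \<in> L \<Longrightarrow> x \<in> l \<Longrightarrow> x + v \<notin> l"
    using acc unfolding acceptable_def K_def by blast+
  have between: "\<exists>l\<in>R. l \<inter> open_segment p q \<noteq> {}"
    if "p \<in> intersection_points L" "q \<in> intersection_points L"
      "K0 C N \<le> real (card {l \<in> L. l \<inter> open_segment p q \<noteq> {}})" for p q
    using acc that unfolding acceptable_def by blast
  have R_ne: "R \<noteq> {}" using R(2) N by auto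
  have R1: "1 \<le> card R" using R_ne finite_subset[OF R(1) conf(1)] by (simp add: Suc_le_eq card_gt_0_iff)
  interpret acceptable_sample R L K "K0 C N"
  proof
    show "finite R" using R(1) conf(1) finite_subset by blast
  qed (use conf R R_ne K between in auto)
  define k where "k = N powr (1/3 - A * e)"
  define M where "M = N powr (1/3 + (3 * A + 3) * e)"
  define \<beta> where "\<beta> = N powr ((4 * A + 4) * e)"
  have Ae: "0 < A * e" using A e by simp
  have krich: "k \<le> real (card {l \<in> L. p \<in> l})" if "p \<in> P" for p
    using rich that by (auto simp: rich_def k_def)
  have cellM: "real (card (P \<inter> closure Q)) \<le> real (card (edge_lines Q)) * M" if "Q \<in> cells R" for Q
  proof -
    have "real (card (P \<inter> closure Q)) \<le>
        real (card (edge_lines Q)) * (50000 * (real K)\<^sup>2 / k ^ 3 + 30 * real K / k + 2)"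
      by (rule card_rich_in_closed_cell[OF that conf(2) v krich]) (use big(4) in \<open>auto simp: k_def\<close>)
    also have "\<dots> \<le> real (card (edge_lines Q)) * M"
      unfolding M_def by (intro mult_left_mono cell_count_bound[OF N A e _ K(2) k_def big(1)]) auto
    finally show ?thesis .
  qed
  define U where "U = (\<Union>Q\<in>{Q \<in> cells R. \<beta> < card (edge_lines Q)}. closure Q)"
  define P' where "P' = P - U"
  have \<beta>: "0 < \<beta>" and M: "0 \<le> M" using N by (auto simp: \<beta>_def M_def)
  have R2: "(real (card R))\<^sup>2 \<le> 4 * N powr (2/3)"
  proof -
    have "(real (card R))\<^sup>2 \<le> (2 * N powr (1/3))\<^sup>2" using R(3) by (intro power_mono) auto
    also have "\<dots> = 4 * N powr (2/3)" using N by (simp add: power_mult_distrib powr_power)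
    finally show ?thesis .
  qed
  have "real (card (P \<inter> U)) \<le> 28 * (real (card R))\<^sup>2 * M / \<beta>"
    unfolding U_def by (rule card_points_in_complex_cells[OF conf(2) \<beta> M cellM])
  also have "\<dots> \<le> 28 * (4 * N powr (2/3)) * M / \<beta>"
    using R2 M \<beta> by (intro divide_right_mono mult_right_mono mult_left_mono) auto
  also have "\<dots> = 112 * (N powr (2/3) * M / \<beta>)" by simp
  also have "N powr (2/3) * M / \<beta> = N powr (1 - (A + 1) * e)"
    unfolding M_def \<beta>_def powr_add[symmetric] powr_diff[symmetric]
    by (rule arg_cong[of _ _ "(powr) N"]) (simp add: algebra_simps)
  \<comment> \<open>The exponent is smaller by \<open>e\<close> than in the lower bound for
    \<open>card P\<close>. This \<open>e\<close> pays for the factor 112 with \<open>c / 2\<close>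
    to spare, which is where \<open>224 / c\<close> comes from.\<close>
  also have "112 * N powr (1 - (A + 1) * e) \<le> (c / 2 * N powr e) * N powr (1 - (A + 1) * e)"
    using big(2) c by (intro mult_right_mono) (auto simp: field_simps)
  also have "\<dots> = c / 2 * (N powr e * N powr (1 - (A + 1) * e))" by simp
  also have "N powr e * N powr (1 - (A + 1) * e) = N powr (1 - A * e)"
    unfolding powr_add[symmetric] by (rule arg_cong[of _ _ "(powr) N"]) (simp add: algebra_simps)
  also have "c / 2 * N powr (1 - A * e) \<le> real (card P) / 2" using conf(6) by simp
  finally have removed: "real (card (P \<inter> U)) \<le> real (card P) / 2" .
  have "P = P' \<union> (P \<inter> U)" by (auto simp: P'_def)
  then have "card P \<le> card P' + card (P \<inter> U)" using card_Un_le by metis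
  then have half: "1/2 * real (card P) \<le> real (card P')" using removed by linarith
  have sub: "P' \<subseteq> P" by (auto simp: P'_def)
  have finP': "finite P'" using sub conf(2) finite_subset by blast
  have avoid: "P' \<inter> closure Q = {}" if "Q \<in> cells R" "\<beta> < card (edge_lines Q)" for Q
    using that by (auto simp: P'_def U_def)
  have cellP': "real (card (P' \<inter> closure Q)) \<le> N powr (1/3 + (7 * A + 7) * e)" if Q: "Q \<in> cells R" for Q
  proof (cases "\<beta> < card (edge_lines Q)")
    case True
    then show ?thesis using avoid[OF Q] by simp
  next
    case False
    have "real (card (P' \<inter> closure Q)) \<le> real (card (P \<inter> closure Q))"
      using sub conf(2) by (intro of_nat_mono card_mono) auto
    also have "\<dots> \<le> real (card (edge_lines Q)) * M" by (rule cellM[OF Q])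
    also have "\<dots> \<le> \<beta> * M" using False M by (intro mult_right_mono) auto
    also have "\<dots> = N powr (1/3 + (7 * A + 7) * e)"
      unfolding M_def \<beta>_def powr_add[symmetric]
      by (rule arg_cong[of _ _ "(powr) N"]) (simp add: algebra_simps)
    finally show ?thesis .
  qed
  have cellB: "real (card (P' \<inter> closure Q)) \<le> N powr (1/3 + B * e)" if Q: "Q \<in> cells R" for Q
  proof -
    have "N powr (1/3 + (7 * A + 7) * e) \<le> N powr (1/3 + B * e)"
      using N A e by (intro powr_mono add_left_mono mult_right_mono) (auto simp: B_def)
    then show ?thesis using cellP'[OF Q] by linarith
  qed
  have sidesB: "P' \<inter> closure Q = {}" if Q: "Q \<in> cells R" and s: "N powr (B * e) < real (card (sides Q))" for Q
  proof (rule avoid[OF Q])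
    have "\<beta> \<le> N powr (B * e)"
      using N A e unfolding \<beta>_def by (intro powr_mono mult_right_mono) (auto simp: B_def)
    then show "\<beta> < card (edge_lines Q)" using s card_sides_le[OF Q] by linarith
  qed
  have P'_lower: "c / 2 * N powr (1 - A * e) \<le> real (card P')" using half conf(6) by simp
  have Bmono: "N powr (1 - B * e) \<le> N powr (1 - A * e)"
    using N A e by (intro powr_mono diff_left_mono mult_right_mono) (auto simp: B_def)
  have extP': "extremal (c / 2) (B * e) N L P'"
    unfolding extremal_def configuration_def
  proof (intro conjI)
    have "c / 2 * N powr (1 - B * e) \<le> c / 2 * N powr (1 - A * e)"
      using Bmono c by (intro mult_left_mono) auto
    then show "c / 2 * N powr (1 - B * e) \<le> real (card P')" using P'_lower by linarith
    have "c / 2 * N powr (1 - B * e) \<le> c * N powr (1 - A * e)"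
      using Bmono c by (intro mult_mono) auto
    then show "c / 2 * N powr (1 - B * e) \<le> real (card L)" using conf(4) by linarith
    show "real (card P') \<le> N" using card_mono[OF conf(2) sub] conf(7) by linarith
    \<comment> \<open>Richness gives the incidences of the refinement directly:
      \<open>card P' * k\<close> loses \<open>2 * A * e\<close>, which \<open>B\<close>
      covers.\<close>
    have "c / 2 * N powr (4/3 - B * e) \<le> c / 2 * N powr (1 - A * e + (1/3 - A * e))"
    proof (intro mult_left_mono powr_mono)
      have "2 * A * e \<le> B * e" using A e by (intro mult_right_mono) (auto simp: B_def)
      then show "4/3 - B * e \<le> 1 - A * e + (1/3 - A * e)" by (simp add: algebra_simps)
    qed (use N c in auto)
    also have "\<dots> = (c / 2 * N powr (1 - A * e)) * k" unfolding k_def powr_add by (simp only: mult.assoc)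
    also have "\<dots> \<le> real (card P') * k" using P'_lower by (intro mult_right_mono) (auto simp: k_def)
    also have "\<dots> \<le> real (card (incidences L P'))"
      using rich sub by (intro card_incidences_ge[OF conf(1) finP']) (auto simp: k_def)
    finally show "c / 2 * N powr (4/3 - B * e) \<le> real (card (incidences L P'))" .
  qed (use conf finP' in auto)
  have r2: "(N powr (1/3))\<^sup>2 = N powr (2/3)" using N by (simp add: powr_power)
  have N13: "1 \<le> N powr (1/3)" using N by (intro ge_one_powr_ge_zero) auto
  have decomposition: "point_weighted_cell_decomposition (c / 2) 112 (B * e) N (N powr (1/3)) L P' (cell_partition P' f)"
    if f: "cell_assignment R P' f" for f
    unfolding point_weighted_cell_decomposition_def
  proof (intro conjI ballI)
    note bounds = cell_partition_bounds[OF finP' f R_ne]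
    show part: "partition_on P' (cell_partition P' f)" by (rule partition_on_cell_partition)
    have size: "real (card Q) \<le> N powr (1/3 + (7 * A + 7) * e)" if Q: "Q \<in> cell_partition P' f" for Q
    proof -
      obtain q where q: "q \<in> cells R" "Q \<subseteq> P' \<inter> closure q" using bounds(3)[OF Q] by blast
      have "card Q \<le> card (P' \<inter> closure q)" using q(2) finP' by (intro card_mono) auto
      then show ?thesis using cellP'[OF q(1)] by linarith
    qed
    define m where "m = N powr (1/3 + (7 * A + 7) * e)"
    have m: "0 < m" using N by (simp add: m_def)
    have "c / 2 * N powr (1 - A * e) \<le> real (card (cell_partition P' f)) * m"
      using card_partition_ge[OF part finP' size] P'_lower unfolding m_def by linarith
    moreover have "N powr (- (B * e)) * (N powr (1/3))\<^sup>2 * m = N powr (1 - (A + 1) * e)"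
      unfolding r2 m_def powr_add[symmetric]
      by (rule arg_cong[of _ _ "(powr) N"]) (simp add: algebra_simps B_def)
    moreover have "N powr (1 - (A + 1) * e) \<le> N powr (1 - A * e)"
      using N e by (intro powr_mono) (auto simp: algebra_simps)
    then have "c / 2 * N powr (1 - (A + 1) * e) \<le> c / 2 * N powr (1 - A * e)"
      using c by (intro mult_left_mono) auto
    ultimately have "(c / 2 * N powr (- (B * e)) * (N powr (1/3))\<^sup>2) * m \<le> real (card (cell_partition P' f)) * m"
      by (simp add: mult.assoc)
    then show "c / 2 * N powr (- (B * e)) * (N powr (1/3))\<^sup>2 \<le> real (card (cell_partition P' f))"
      using m by (rule mult_right_le_imp_le)
    have "real (card (cell_partition P' f)) \<le> real (28 * (card R)\<^sup>2)" using bounds(1) by (rule of_nat_mono)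
    then show "real (card (cell_partition P' f)) \<le> 112 * (N powr (1/3))\<^sup>2" using R2 unfolding r2 by simp
    show "real (card {Q \<in> cell_partition P' f. l \<inter> Q \<noteq> {}}) \<le> 112 * N powr (1/3)" if "l \<in> L" for l
    proof -
      have "card {Q \<in> cell_partition P' f. l \<inter> Q \<noteq> {}} \<le> 5 * card R"
        using bounds(2)[OF line_L[OF that]] R1 by linarith
      then have "real (card {Q \<in> cell_partition P' f. l \<inter> Q \<noteq> {}}) \<le> 5 * real (card R)" by linarith
      also have "\<dots> \<le> 10 * N powr (1/3)" using R(3) by linarith
      finally show ?thesis using N13 by linarith
    qed
    show "real (card Q) \<le> 112 * N powr (1 + B * e) / (N powr (1/3))\<^sup>2" if "Q \<in> cell_partition P' f" for Q
    proof -
      have "real (card Q) \<le> N powr (1/3 + (7 * A + 7) * e)" by (rule size[OF that])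
      also have "\<dots> \<le> N powr (1/3 + B * e)"
        using N A e by (intro powr_mono add_left_mono mult_right_mono) (auto simp: B_def)
      also have "\<dots> = N powr (1 + B * e) / N powr (2/3)"
        unfolding powr_diff[symmetric] by (rule arg_cong[of _ _ "(powr) N"]) simp
      also have "\<dots> \<le> 112 * N powr (1 + B * e) / N powr (2/3)"
        by (intro divide_right_mono) auto
      finally show ?thesis unfolding r2 by simp
    qed
  qed
  show ?thesis
    using sub half sidesB cellB extP' decomposition by blast
qed

theorem theorem3p9:
  fixes A :: real
  assumes "A > 0"
  shows "\<exists>B>0. \<exists>\<delta>>0. \<forall>\<epsilon>0 c C :: real.
    0 < \<epsilon>0 \<and> \<epsilon>0 < \<delta> \<and> 0 < c \<and> 0 < C \<longrightarrow>
    (\<exists>c'>0. \<exists>C'>0. \<exists>N0\<ge>1. \<forall>N\<ge>N0. \<forall>L P v Lr.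
       extremal c (A * \<epsilon>0) N L P \<and>
       (\<forall>p\<in>P. rich (N powr (1/3 - A * \<epsilon>0)) L p) \<and>
       acceptable C N L v Lr \<longrightarrow>
       (\<exists>P'\<subseteq>P.
          real (card P') \<ge> 1/2 * real (card P) \<and>
          (\<forall>Q\<in>cells Lr. real (card (sides Q)) > N powr (B * \<epsilon>0) \<longrightarrow> P' \<inter> closure Q = {}) \<and>
          (\<forall>Q\<in>cells Lr. real (card (P' \<inter> closure Q)) \<le> N powr (1/3 + B * \<epsilon>0)) \<and>
          extremal c' (B * \<epsilon>0) N L P' \<and>
          (\<forall>f. cell_assignment Lr P' f \<longrightarrow>
             point_weighted_cell_decomposition c' C' (B * \<epsilon>0) N (N powr (1/3)) L P'
               (cell_partition P' f))))"
proof (rule exI[of _ "8 * A + 8"], intro conjI, goal_cases)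
  case 2
  show ?case
  \<comment> \<open>With this choice \<open>A * e < 1/6\<close>, so the richness exponent
    \<open>1/3 - A * e\<close> stays positive and the richness reaches 16 for large
    \<open>N\<close>.\<close>
  proof (rule exI[of _ "1 / (6 * A)"], intro conjI allI impI, goal_cases)
    case (2 e c C)
    then have e: "0 < e" "A * e < 1/6" and c: "0 < c" and C: "0 < C"
      using assms by (auto simp: field_simps)
    \<comment> \<open>One threshold for each asymptotic inequality of
      \<open>refinement_exists\<close>; the entry 2 guarantees \<open>1 < N\<close>.\<close>
    define N0 where "N0 = Max {2, 50032 powr (1 / e), (224 / c) powr (1 / e),
        (2 * C / e + 1) powr (1 / (e / 2)), 16 powr (1 / (1/3 - A * e))}"
    have N0: "2 \<le> N0" "50032 powr (1 / e) \<le> N0" "(224 / c) powr (1 / e) \<le> N0"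
      "(2 * C / e + 1) powr (1 / (e / 2)) \<le> N0" "16 powr (1 / (1/3 - A * e)) \<le> N0"
      unfolding N0_def by (intro Max_ge; simp)+
    show ?case
    proof (rule exI[of _ "c / 2"], rule conjI, goal_cases)
      case 2
      show ?case
      proof (rule exI[of _ 112], rule conjI, goal_cases)
        case 2
        show ?case
        proof (rule exI[of _ N0], intro conjI allI impI, goal_cases)
          case (2 N L P v Lr)
          then have N: "N0 \<le> N" and h: "extremal c (A * e) N L P"
            "\<forall>p\<in>P. rich (N powr (1/3 - A * e)) L p" "acceptable C N L v Lr" by auto
          show ?case
          proof (rule refinement_exists[OF assms e(1) c C _ _ _ _ _ h])
            show "1 < N" using N N0 by linarith
            show "50032 \<le> N powr e" by (rule powr_ge_threshold) (use e N N0 in auto)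
            show "224 / c \<le> N powr e" by (rule powr_ge_threshold) (use e c N N0 in auto)
            have "0 < 2 * C / e" using C e by simp
            then show "2 * C / e + 1 \<le> N powr (e / 2)"
              using e N N0 by (intro powr_ge_threshold) linarith+
            show "16 \<le> N powr (1/3 - A * e)"
              using e N N0 by (intro powr_ge_threshold) linarith+
          qed
        qed (use N0 in simp)
      qed simp
    qed (use c in simp)
  qed (use assms in simp)
qed (use assms in simp)

end
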